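(* Let $\Omega\subset\mathbb{R}^d$ be a bounded Lipschitz domain, $1\le q<\infty$, and $u\in\mathrm{BV}(\Omega)$. Let $T:D\to L^1(\Omega,\mathbb{R}^d;|\mathrm{D}u|)$ be the full trace operator associated with $u$ and $q$. Then every $\phi\in C(\overline\Omega,\mathbb{R}^d)\cap W^q(\mathrm{div};\Omega)$ belongs to $D$ and $$T\phi=\phi\quad\text{in } L^1(\Omega,\mathbb{R}^d;|\mathrm{D}u|).$$ If, in addition, $u\in L^p(\Omega)$ with $p=\frac{q}{q-1}$ for $1<q<\infty$ and $p=\infty$ for $q=1$ (so that the normal trace operator $T_N$ with values in $L^1(\Omega;|\mathrm{D}u|)$ is defined on $D$), then for every $g\in D$ $$T_N g=Tg\cdot\sigma_u ,$$ where $\sigma_u$ is the density of $\mathrm{D}u$ with respect to $|\mathrm{D}u|$.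
   Context: $\mathrm{BV}(\Omega)$ is the set of $u\in L^1(\Omega)$ whose distributional gradient is a finite $\mathbb{R}^d$-valued Radon measure $\mathrm{D}u$; $|\mathrm{D}u|$ is its variation measure and $\mathrm{D}u=\sigma_u|\mathrm{D}u|$. $\|\cdot\|_\infty$ of a vector field is the (essential) supremum of its pointwise Euclidean norm. $W^q(\mathrm{div};\Omega)$ is the space of $g\in L^q(\Omega,\mathbb{R}^d)$ with weak divergence $\mathrm{div}\, g\in L^q(\Omega)$, with norm $\|g\|_{W^q(\mathrm{div})}^q=\|g\|_{L^q}^q+\|\mathrm{div}\, g\|_{L^q}^q$. $C(\overline\Omega,\mathbb{R}^d)$ denotes functions on $\overline\Omega$ that are (uniformly) continuous; $C^\infty(\overline\Omega,\mathbb{R}^d)$ denotes the restrictions to $\overline\Omega$ of functions in $C_c^\infty(\mathbb{R}^d,\mathbb{R}^d)$. A point $x\in\Omega$ is a Lebesgue point of $g$ if $\lim_{r\to0}\frac{1}{|B(x,r)|}\int_{B(x,r)}|g(y)-g(x)|\,\mathrm{d}y=0$, where $g(x)$ is the value of the fixed representative of $g$ (the continuous representative if $g$ is continuous). Convergence $\overset{\sim}{\to}$: for $g\in W^q(\mathrm{div};\Omega)\cap L^\infty(\Omega,\mathbb{R}^d)$ and $(g_n)\subset C(\overline\Omega,\mathbb{R}^d)\cap W^q(\mathrm{div};\Omega)$, write $g_n\overset{\sim}{\to}g$ if (1) $\|g_n-g\|_{W^q(\mathrm{div})}\to0$, (2) $\|g_n\|_\infty\le\|g\|_\infty$ for all $n$,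 (3) $g_n(x)\to g(x)$ for every Lebesgue point $x\in\Omega$ of $g$. (Every such $g$ admits a sequence in $C^\infty(\overline\Omega,\mathbb{R}^d)$ with $g_n\overset{\sim}{\to}g$.) Full trace operator: given $u\in\mathrm{BV}(\Omega)$, let $D$ be the set of $g\in W^q(\mathrm{div};\Omega)\cap L^\infty(\Omega,\mathbb{R}^d)$ for which there is $v\in L^1(\Omega,\mathbb{R}^d;|\mathrm{D}u|)$ such that for all sequences $(g_n)\subset C^\infty(\overline\Omega,\mathbb{R}^d)$ with $g_n\overset{\sim}{\to}g$ one has $\|g_n-v\|_{L^1(\Omega,\mathbb{R}^d;|\mathrm{D}u|)}\to0$. For $g\in D$ this $v$ is unique, and $Tg:=v$. Normal trace (Anzellotti): for $u\in\mathrm{BV}(\Omega)\cap L^p(\Omega)$ and $z\in W^q(\mathrm{div};\Omega)\cap L^\infty(\Omega,\mathbb{R}^d)$ there is a unique $\theta(z,\mathrm{D}u)\in L^1(\Omega;|\mathrm{D}u|)$ with $\int_\Omega\theta(z,\mathrm{D}u)\psi\,\mathrm{d}|\mathrm{D}u|=-\int_\Omega u\,\mathrm{div}(z\psi)\,\mathrm{d}x$ for all $\psi\in C_c^\infty(\Omega)$. $T_N$ is the closure, as an operator from $W^q(\mathrm{div};\Omega)$ to $L^1(\Omega;|\mathrm{D}u|)$, of $z\mapsto\theta(z,\mathrm{D}u)$ defined on $W^q(\mathrm{div};\Omega)\cap L^\infty(\Omega,\mathbb{R}^d)$; in particular $T_Nz=\theta(z,\mathrm{D}u)$ for $z$ in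 that set. *)

theory Defs
  imports "HOL-Analysis.Analysis" "HOL-Probability.Essential_Supremum"
begin

text \<open>
  Elements of function spaces are represented by functions on the whole of \<^typ>\<open>'a\<close>; only their
  values on the set \<open>\<Omega>\<close> (or its closure) matter, and equality in an \<open>L\<^sup>p\<close> space is equality almost
  everywhere.
\<close>

section \<open>Domains and smooth functions\<close>

text \<open>Near every boundary point, after a rigid motion, \<open>\<Omega>\<close> is the strict epigraph of a Lipschitz
  function \<open>\<gamma>\<close> on the hyperplane orthogonal to a unit vector \<open>e\<close>.\<close>

definition lipschitz_boundary :: "'a::euclidean_space set \<Rightarrow> bool" where
  "lipschitz_boundary \<Omega> \<longleftrightarrow> (\<forall>x\<in>frontier \<Omega>. \<exists>r>0. \<exists>e. norm e = 1 \<and>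
     (\<exists>L \<gamma>. L-lipschitz_on {y. y \<bullet> e = 0} \<gamma> \<and>
        \<Omega> \<inter> ball x r = {y \<in> ball x r. \<gamma> (y - (y \<bullet> e) *\<^sub>R e) < y \<bullet> e}))"

definition bounded_lipschitz_domain :: "'a::euclidean_space set \<Rightarrow> bool" where
  "bounded_lipschitz_domain \<Omega> \<longleftrightarrow>
     \<Omega> \<noteq> {} \<and> open \<Omega> \<and> connected \<Omega> \<and> bounded \<Omega> \<and> lipschitz_boundary \<Omega>"

primrec C_k :: "nat \<Rightarrow> ('a::euclidean_space \<Rightarrow> 'b::real_normed_vector) \<Rightarrow> bool" where
  "C_k 0 f \<longleftrightarrow> continuous_on UNIV f"
| "C_k (Suc k) f \<longleftrightarrow> (\<forall>x. f differentiable (at x)) \<and>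
     (\<forall>v. C_k k (\<lambda>x. frechet_derivative f (at x) v))"

definition test_functions ::
    "'a::euclidean_space set \<Rightarrow> ('a \<Rightarrow> 'b::real_normed_vector) set" where
  "test_functions \<Omega> = {\<psi>. (\<forall>k. C_k k \<psi>) \<and>
     compact (closure {x. \<psi> x \<noteq> 0}) \<and> closure {x. \<psi> x \<noteq> 0} \<subseteq> \<Omega>}"

definition gradient :: "('a::euclidean_space \<Rightarrow> real) \<Rightarrow> 'a \<Rightarrow> 'a" where
  "gradient \<psi> x = (\<Sum>b\<in>Basis. frechet_derivative \<psi> (at x) b *\<^sub>R b)"

definition smooth_up_to_boundary :: "'a::euclidean_space set \<Rightarrow> ('a \<Rightarrow> 'a) set" where
  "smooth_up_to_boundary \<Omega> = {g. \<exists>f\<in>test_functions UNIV. \<forall>x\<in>closure \<Omega>. g x = f x}"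

section \<open>Lebesgue spaces and weak divergence\<close>

definition norm_esssup :: "'a measure \<Rightarrow> ('a \<Rightarrow> 'b::real_normed_vector) \<Rightarrow> ereal" where
  "norm_esssup M f = esssup M (\<lambda>x. ereal (norm (f x)))"

definition Lp_space :: "ereal \<Rightarrow> 'a measure \<Rightarrow> ('a \<Rightarrow> 'b::real_normed_vector) set" where
  "Lp_space p M = {f \<in> borel_measurable M.
     if p = \<infinity> then norm_esssup M f < \<infinity>
     else integrable M (\<lambda>x. norm (f x) powr real_of_ereal p)}"

definition Lp_norm :: "real \<Rightarrow> 'a measure \<Rightarrow> ('a \<Rightarrow> 'b::real_normed_vector) \<Rightarrow> real" where
  "Lp_norm p M f = (LINT x|M. norm (f x) powr p) powr (1 / p)"

definition loc_integrable ::
    "'a::euclidean_space set \<Rightarrow> ('a \<Rightarrow> 'b::{banach, second_countable_topology}) \<Rightarrow> bool" where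
  "loc_integrable \<Omega> f \<longleftrightarrow> (\<forall>K. compact K \<and> K \<subseteq> \<Omega> \<longrightarrow> set_integrable lebesgue K f)"

definition is_weak_div ::
    "'a::euclidean_space set \<Rightarrow> ('a \<Rightarrow> 'a) \<Rightarrow> ('a \<Rightarrow> real) \<Rightarrow> bool" where
  "is_weak_div \<Omega> g h \<longleftrightarrow> loc_integrable \<Omega> g \<and> loc_integrable \<Omega> h \<and>
     (\<forall>\<psi>\<in>test_functions \<Omega>.
        (LINT x|lebesgue_on \<Omega>. g x \<bullet> gradient \<psi> x) = - (LINT x|lebesgue_on \<Omega>. h x * \<psi> x))"

text \<open>A representative of the weak divergence, which is unique up to null sets.\<close>

definition weak_div :: "'a::euclidean_space set \<Rightarrow> ('a \<Rightarrow> 'a) \<Rightarrow> 'a \<Rightarrow> real" where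
  "weak_div \<Omega> g = (SOME h. is_weak_div \<Omega> g h)"

definition Wdiv :: "real \<Rightarrow> 'a::euclidean_space set \<Rightarrow> ('a \<Rightarrow> 'a) set" where
  "Wdiv q \<Omega> = {g \<in> Lp_space q (lebesgue_on \<Omega>).
     \<exists>h \<in> Lp_space q (lebesgue_on \<Omega>). is_weak_div \<Omega> g h}"

definition Wdiv_norm :: "real \<Rightarrow> 'a::euclidean_space set \<Rightarrow> ('a \<Rightarrow> 'a) \<Rightarrow> real" where
  "Wdiv_norm q \<Omega> g = (Lp_norm q (lebesgue_on \<Omega>) g powr q
     + Lp_norm q (lebesgue_on \<Omega>) (weak_div \<Omega> g) powr q) powr (1 / q)"

section \<open>Vector measures and functions of bounded variation\<close>

text \<open>A vector measure on \<open>\<Omega>\<close> is a set function, considered on the Borel subsets of \<open>\<Omega>\<close> only.\<close>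

definition variation ::
    "'a::euclidean_space set \<Rightarrow> ('a set \<Rightarrow> 'a) \<Rightarrow> 'a set \<Rightarrow> ennreal" where
  "variation \<Omega> \<nu> A = (SUP E \<in> {E :: nat \<Rightarrow> 'a set. range E \<subseteq> sets (restrict_space borel \<Omega>) \<and>
     disjoint_family E \<and> (\<Union>n. E n) = A}. \<Sum>n. ennreal (norm (\<nu> (E n))))"

definition variation_measure ::
    "'a::euclidean_space set \<Rightarrow> ('a set \<Rightarrow> 'a) \<Rightarrow> 'a measure" where
  "variation_measure \<Omega> \<nu> = measure_of \<Omega> (sets (restrict_space borel \<Omega>)) (variation \<Omega> \<nu>)"

text \<open>Finite Borel measures on open subsets of a Euclidean space are Radon, so no regularity is
  required here.\<close>

definition finite_vector_measure :: "'a::euclidean_space set \<Rightarrow> ('a set \<Rightarrow> 'a) \<Rightarrow> bool" where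
  "finite_vector_measure \<Omega> \<nu> \<longleftrightarrow>
     (\<forall>E :: nat \<Rightarrow> 'a set. range E \<subseteq> sets (restrict_space borel \<Omega>) \<and> disjoint_family E \<longrightarrow>
        (\<lambda>n. \<nu> (E n)) sums \<nu> (\<Union>n. E n)) \<and>
     variation \<Omega> \<nu> \<Omega> < \<infinity>"

text \<open>The density \<open>\<sigma>\<close> in the polar decomposition \<open>\<nu> = \<sigma>|\<nu>|\<close>; it exists and is unique
  \<open>|\<nu>|\<close>-almost everywhere by the Radon-Nikodym theorem.\<close>

definition polar_density ::
    "'a::euclidean_space set \<Rightarrow> ('a set \<Rightarrow> 'a) \<Rightarrow> 'a \<Rightarrow> 'a" where
  "polar_density \<Omega> \<nu> = (SOME \<sigma>. integrable (variation_measure \<Omega> \<nu>) \<sigma> \<and>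
     (\<forall>A \<in> sets (restrict_space borel \<Omega>).
        \<nu> A = set_lebesgue_integral (variation_measure \<Omega> \<nu>) A \<sigma>))"

definition vector_measure_integral ::
    "'a::euclidean_space set \<Rightarrow> ('a set \<Rightarrow> 'a) \<Rightarrow> ('a \<Rightarrow> real) \<Rightarrow> 'a" where
  "vector_measure_integral \<Omega> \<nu> \<psi> =
     (LINT x|variation_measure \<Omega> \<nu>. \<psi> x *\<^sub>R polar_density \<Omega> \<nu> x)"

definition is_gradient_measure ::
    "'a::euclidean_space set \<Rightarrow> ('a \<Rightarrow> real) \<Rightarrow> ('a set \<Rightarrow> 'a) \<Rightarrow> bool" where
  "is_gradient_measure \<Omega> u \<nu> \<longleftrightarrow> finite_vector_measure \<Omega> \<nu> \<and>
     (\<forall>\<psi>\<in>test_functions \<Omega>.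
        (LINT x|lebesgue_on \<Omega>. u x *\<^sub>R gradient \<psi> x) = - vector_measure_integral \<Omega> \<nu> \<psi>)"

definition BV :: "'a::euclidean_space set \<Rightarrow> ('a \<Rightarrow> real) set" where
  "BV \<Omega> = {u. integrable (lebesgue_on \<Omega>) u \<and> (\<exists>\<nu>. is_gradient_measure \<Omega> u \<nu>)}"

text \<open>The measure \<open>Du\<close>, which is unique on the Borel subsets of \<open>\<Omega>\<close>, its variation \<open>|Du|\<close> and
  the density \<open>\<sigma>\<^sub>u\<close>.\<close>

definition gradient_measure :: "'a::euclidean_space set \<Rightarrow> ('a \<Rightarrow> real) \<Rightarrow> 'a set \<Rightarrow> 'a" where
  "gradient_measure \<Omega> u = (SOME \<nu>. is_gradient_measure \<Omega> u \<nu>)"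

definition TV :: "'a::euclidean_space set \<Rightarrow> ('a \<Rightarrow> real) \<Rightarrow> 'a measure" where
  "TV \<Omega> u = variation_measure \<Omega> (gradient_measure \<Omega> u)"

definition TV_density :: "'a::euclidean_space set \<Rightarrow> ('a \<Rightarrow> real) \<Rightarrow> 'a \<Rightarrow> 'a" where
  "TV_density \<Omega> u = polar_density \<Omega> (gradient_measure \<Omega> u)"

section \<open>The full trace operator\<close>

text \<open>The point value \<open>g x\<close> is that of the given function. All representatives of an element of
  an \<open>L\<^sup>p\<close> space are thus admitted, and they may have different Lebesgue points. A function that is
  continuous on \<open>\<Omega>\<close> is its own continuous representative.\<close>

definition lebesgue_point ::
    "'a::euclidean_space set \<Rightarrow> ('a \<Rightarrow> 'a) \<Rightarrow> 'a \<Rightarrow> bool" where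
  "lebesgue_point \<Omega> g x \<longleftrightarrow> x \<in> \<Omega> \<and>
     ((\<lambda>r. (LINT y:ball x r|lebesgue. norm (g y - g x)) / measure lebesgue (ball x r))
        \<longlongrightarrow> 0) (at_right 0)"

definition trace_conv :: "'a::euclidean_space set \<Rightarrow> real \<Rightarrow>
    (nat \<Rightarrow> 'a \<Rightarrow> 'a) \<Rightarrow> ('a \<Rightarrow> 'a) \<Rightarrow> bool" where
  "trace_conv \<Omega> q G g \<longleftrightarrow>
     g \<in> Wdiv q \<Omega> \<inter> Lp_space \<infinity> (lebesgue_on \<Omega>) \<and>
     (\<forall>n. continuous_on (closure \<Omega>) (G n) \<and> G n \<in> Wdiv q \<Omega>) \<and>
     (\<lambda>n. Wdiv_norm q \<Omega> (\<lambda>x. G n x - g x)) \<longlonglongrightarrow> 0 \<and>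
     (\<forall>n. norm_esssup (lebesgue_on \<Omega>) (G n) \<le> norm_esssup (lebesgue_on \<Omega>) g) \<and>
     (\<forall>x. lebesgue_point \<Omega> g x \<longrightarrow> (\<lambda>n. G n x) \<longlonglongrightarrow> g x)"

definition is_full_trace :: "'a::euclidean_space set \<Rightarrow> real \<Rightarrow> ('a \<Rightarrow> real) \<Rightarrow>
    ('a \<Rightarrow> 'a) \<Rightarrow> ('a \<Rightarrow> 'a) \<Rightarrow> bool" where
  "is_full_trace \<Omega> q u g v \<longleftrightarrow> integrable (TV \<Omega> u) v \<and>
     (\<forall>G. (\<forall>n. G n \<in> smooth_up_to_boundary \<Omega>) \<and> trace_conv \<Omega> q G g \<longrightarrow>
        (\<lambda>n. LINT x|TV \<Omega> u. norm (G n x - v x)) \<longlonglongrightarrow> 0)"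

definition full_trace_dom :: "'a::euclidean_space set \<Rightarrow> real \<Rightarrow> ('a \<Rightarrow> real) \<Rightarrow>
    ('a \<Rightarrow> 'a) set" where
  "full_trace_dom \<Omega> q u = {g \<in> Wdiv q \<Omega> \<inter> Lp_space \<infinity> (lebesgue_on \<Omega>).
     \<exists>v. is_full_trace \<Omega> q u g v}"

definition full_trace :: "'a::euclidean_space set \<Rightarrow> real \<Rightarrow> ('a \<Rightarrow> real) \<Rightarrow>
    ('a \<Rightarrow> 'a) \<Rightarrow> 'a \<Rightarrow> 'a" where
  "full_trace \<Omega> q u g = (SOME v. is_full_trace \<Omega> q u g v)"

section \<open>The normal trace operator\<close>

definition is_anzellotti :: "'a::euclidean_space set \<Rightarrow> ('a \<Rightarrow> real) \<Rightarrow>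
    ('a \<Rightarrow> 'a) \<Rightarrow> ('a \<Rightarrow> real) \<Rightarrow> bool" where
  "is_anzellotti \<Omega> u z t \<longleftrightarrow> integrable (TV \<Omega> u) t \<and>
     (\<forall>\<psi>\<in>test_functions \<Omega>. (LINT x|TV \<Omega> u. t x * \<psi> x) =
        - (LINT x|lebesgue_on \<Omega>. u x * weak_div \<Omega> (\<lambda>y. \<psi> y *\<^sub>R z y) x))"

definition anzellotti :: "'a::euclidean_space set \<Rightarrow> ('a \<Rightarrow> real) \<Rightarrow> ('a \<Rightarrow> 'a) \<Rightarrow> 'a \<Rightarrow> real" where
  "anzellotti \<Omega> u z = (SOME t. is_anzellotti \<Omega> u z t)"

text \<open>The graph of the closure of the operator \<^term>\<open>anzellotti \<Omega> u\<close>.\<close>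

definition is_normal_trace :: "'a::euclidean_space set \<Rightarrow> real \<Rightarrow> ('a \<Rightarrow> real) \<Rightarrow>
    ('a \<Rightarrow> 'a) \<Rightarrow> ('a \<Rightarrow> real) \<Rightarrow> bool" where
  "is_normal_trace \<Omega> q u z w \<longleftrightarrow> z \<in> Wdiv q \<Omega> \<and> integrable (TV \<Omega> u) w \<and>
     (\<exists>Z. (\<forall>n. Z n \<in> Wdiv q \<Omega> \<inter> Lp_space \<infinity> (lebesgue_on \<Omega>)) \<and>
        (\<lambda>n. Wdiv_norm q \<Omega> (\<lambda>x. Z n x - z x)) \<longlonglongrightarrow> 0 \<and>
        (\<lambda>n. LINT x|TV \<Omega> u. \<bar>anzellotti \<Omega> u (Z n) x - w x\<bar>) \<longlonglongrightarrow> 0)"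

definition normal_trace_dom :: "'a::euclidean_space set \<Rightarrow> real \<Rightarrow> ('a \<Rightarrow> real) \<Rightarrow>
    ('a \<Rightarrow> 'a) set" where
  "normal_trace_dom \<Omega> q u = {z. \<exists>w. is_normal_trace \<Omega> q u z w}"

definition normal_trace :: "'a::euclidean_space set \<Rightarrow> real \<Rightarrow> ('a \<Rightarrow> real) \<Rightarrow>
    ('a \<Rightarrow> 'a) \<Rightarrow> 'a \<Rightarrow> real" where
  "normal_trace \<Omega> q u z = (SOME w. is_normal_trace \<Omega> q u z w)"

end

theory Submission
  imports Defs
begin

text \<open>
  Near a boundary point the domain lies above a Lipschitz graph in some direction \<open>e\<close>, so that
  averages over small cubes displaced by a suitable multiple of \<open>e\<close> only involve values inside
  \<open>\<Omega>\<close>. Let \<open>J\<^sub>i\<close> be the corresponding mollifications and \<open>\<theta>\<^sub>i\<close> a subordinate smooth partition of unity,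
  and put \<open>G = \<Sum>\<^sub>i \<theta>\<^sub>i J\<^sub>i g\<close>. As \<open>\<Sum>\<^sub>i \<theta>\<^sub>i = 1\<close>, the supremum norm does not increase, \<open>G\<close> converges to \<open>g\<close>
  at Lebesgue points, and
  \<open>div G - div g = \<Sum>\<^sub>i (\<nabla>\<theta>\<^sub>i \<bullet> (J\<^sub>i g - g) + \<theta>\<^sub>i (J\<^sub>i (div g) - div g))\<close> tends to zero in \<open>L\<^sup>q\<close>. Hence
  approximating sequences exist, and full traces are unique.

  For continuous \<open>\<phi>\<close> all points are Lebesgue points, and \<open>T\<phi> = \<phi>\<close> follows by dominated convergence.

  For smooth \<open>G\<close> the pairing \<open>\<theta>(G, Du)\<close> is \<open>G \<bullet> \<sigma>\<^sub>u\<close> by the definition of \<open>Du\<close>. If \<open>u \<in> L\<^sup>p\<close>, then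
  \<open>z \<mapsto> \<integral> u div(\<psi> z) dx\<close> is continuous on \<open>W\<^sup>q(div)\<close>. Therefore \<open>\<theta>(z, Du)\<close> exists for bounded \<open>z\<close> as
  a weak limit of \<open>G\<^sub>n \<bullet> \<sigma>\<^sub>u\<close>, a normal trace of \<open>z\<close> is determined by this functional, and
  \<open>T\<^sub>N g = lim G\<^sub>n \<bullet> \<sigma>\<^sub>u = Tg \<bullet> \<sigma>\<^sub>u\<close>.
\<close>


section \<open>Calculus of smooth and compactly supported functions\<close>

section \<open>Smooth functions\<close>

text \<open>The measure |Du| may live on Lebesgue null sets, so statements that hold almost
  everywhere in \<Omega> say nothing about integrals against it. Bounds and limits of the
  approximants are therefore obtained at every point: mollified fields are bounded everywhere,
  convergence is proved towards a prescribed value \<open>c\<close> at a prescribed point, and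
  essential bounds on continuous fields are turned into pointwise ones.

  Weak divergences, pairings and traces are chosen by \<open>SOME\<close>. Each is usable only after
  existence is known, and each identity holds up to null sets and rests on uniqueness. Uniqueness of
  the weak divergence (for Lebesgue measure) and of the pairing (for |Du|) come from one fundamental
  lemma for an arbitrary measure on the Borel sets.

  Fields are given on \<Omega> only, modulo null sets, and are replaced by Borel functions on the
  whole space that vanish outside \<Omega>. This extension may jump at the boundary, where its
  distributional divergence need not be a function; hence the divergence may be exchanged with a
  mollification only at points whose averaging cube stays in \<Omega>.\<close>

definition smooth :: "('a::euclidean_space \<Rightarrow> 'b::real_normed_vector) \<Rightarrow> bool" where
  "smooth f \<longleftrightarrow> (\<forall>k. C_k k f)"

text \<open>The definition speaks of \<open>frechet_derivative\<close>; since derivatives are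
  unique, any explicit derivative \<open>f'\<close> may take its place. The closure properties that
  follow are inductions through this rule.\<close>

lemma C_k_SucI:
  assumes "\<And>x. (f has_derivative f' x) (at x)" and "\<And>v. C_k k (\<lambda>x. f' x v)"
  shows "C_k (Suc k) f"
proof -
  have "frechet_derivative f (at x) = f' x" for x
    using frechet_derivative_at[OF assms(1)] by simp
  then show ?thesis
    using assms by (auto simp: differentiable_def)
qed

lemma C_k_Suc_has_derivative:
  "C_k (Suc k) f \<Longrightarrow> (f has_derivative frechet_derivative f (at x)) (at x)"
  by (simp add: frechet_derivative_works)

lemma C_k_SucD: "C_k (Suc k) f \<Longrightarrow> C_k k f"
proof (induction k arbitrary: f)
  case 0
  then show ?case
    by (auto simp: continuous_on_eq_continuous_at differentiable_imp_continuous_within)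
next
  case (Suc k)
  have "C_k k (\<lambda>x. frechet_derivative f (at x) v)" for v
    using Suc.prems by (intro Suc.IH) simp
  with Suc.prems show ?case by simp
qed

lemma C_k_bounded_linear:
  assumes "bounded_linear T" "C_k k f"
  shows "C_k k (\<lambda>x. T (f x))"
  using assms(2)
proof (induction k arbitrary: f)
  case 0
  then show ?case using bounded_linear.continuous_on[OF assms(1)] by simp
next
  case (Suc k)
  show ?case
    by (rule C_k_SucI[OF bounded_linear.has_derivative[OF assms(1) C_k_Suc_has_derivative[OF Suc.prems]]])
       (use Suc in simp)
qed

lemma C_k_comp_affine:
  fixes L :: "'a::euclidean_space \<Rightarrow> 'b::euclidean_space"
  assumes "bounded_linear L" "C_k k f"
  shows "C_k k (\<lambda>x. f (L x + a))"
  using assms(2)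
proof (induction k arbitrary: f)
  case 0
  then have "continuous_on UNIV f" by simp
  moreover have "continuous_on UNIV (\<lambda>x. L x + a)"
    by (intro continuous_on_add continuous_on_const linear_continuous_on assms(1))
  ultimately show ?case
    using continuous_on_compose2[of UNIV f UNIV "\<lambda>x. L x + a"] by simp
next
  case (Suc k)
  have "((\<lambda>x. f (L x + a)) has_derivative (\<lambda>v. frechet_derivative f (at (L x + a)) (L v))) (at x)" for x
    by (rule has_derivative_compose[OF _ C_k_Suc_has_derivative[OF Suc.prems]])
       (auto intro!: derivative_eq_intros bounded_linear_imp_has_derivative assms)
  then show ?case
    by (rule C_k_SucI) (use Suc.prems in \<open>auto intro: Suc.IH[where f="\<lambda>y. frechet_derivative f (at y) (L v)" for v]\<close>)
qed

lemma C_k_const: "C_k k (\<lambda>x. c)"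
proof (induction k arbitrary: c)
  case (Suc k)
  show ?case by (rule C_k_SucI[OF has_derivative_const]) (rule Suc)
qed simp

lemma C_k_add:
  assumes "C_k k f" "C_k k g"
  shows "C_k k (\<lambda>x. f x + g x)"
  using assms
proof (induction k arbitrary: f g)
  case 0
  then show ?case by (simp add: continuous_on_add)
next
  case (Suc k)
  show ?case
    by (rule C_k_SucI[OF has_derivative_add[OF C_k_Suc_has_derivative[OF Suc.prems(1)]
          C_k_Suc_has_derivative[OF Suc.prems(2)]]])
       (use Suc in auto)
qed

text \<open>One Leibniz rule for scalar multiples of vectors and for products of reals. In each of
  its two summands the undifferentiated factor has one order to spare, which \<open>C_k_SucD\<close>
  gives up to match the induction hypothesis.\<close>

lemma C_k_bilinear:
  assumes "bounded_bilinear p" "C_k k f" "C_k k g"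
  shows "C_k k (\<lambda>x. p (f x) (g x))"
  using assms(2,3)
proof (induction k arbitrary: f g)
  case 0
  then show ?case by (auto intro: bounded_bilinear.continuous_on[OF assms(1)])
next
  case (Suc k)
  show ?case
  proof (rule C_k_SucI[OF bounded_bilinear.FDERIV[OF assms(1) C_k_Suc_has_derivative[OF Suc.prems(1)]
          C_k_Suc_has_derivative[OF Suc.prems(2)]]])
    show "C_k k (\<lambda>x. p (f x) (frechet_derivative g (at x) v) + p (frechet_derivative f (at x) v) (g x))" for v
      using Suc.prems C_k_SucD[OF Suc.prems(1)] C_k_SucD[OF Suc.prems(2)]
      by (intro C_k_add Suc.IH) auto
  qed
qed

lemma smooth_has_derivative: "smooth f \<Longrightarrow> (f has_derivative frechet_derivative f (at x)) (at x)"
  unfolding smooth_def using C_k_Suc_has_derivative by blast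

lemma smooth_frechet_derivative: "smooth f \<Longrightarrow> smooth (\<lambda>x. frechet_derivative f (at x) v)"
  unfolding smooth_def by (metis C_k.simps(2))

lemma smooth_continuous_on: "smooth f \<Longrightarrow> continuous_on S f"
  unfolding smooth_def by (metis C_k.simps(1) continuous_on_subset subset_UNIV)

lemma smooth_borel_measurable:
  "smooth f \<Longrightarrow> f \<in> borel_measurable borel"
  by (simp add: borel_measurable_continuous_onI smooth_continuous_on)

lemma smooth_const: "smooth (\<lambda>x. c)"
  by (simp add: smooth_def C_k_const)

lemma smooth_add: "smooth f \<Longrightarrow> smooth g \<Longrightarrow> smooth (\<lambda>x. f x + g x)"
  by (simp add: smooth_def C_k_add)

lemma smooth_bounded_linear: "bounded_linear T \<Longrightarrow> smooth f \<Longrightarrow> smooth (\<lambda>x. T (f x))"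
  by (simp add: smooth_def C_k_bounded_linear)

lemma smooth_scaleR: "smooth f \<Longrightarrow> smooth g \<Longrightarrow> smooth (\<lambda>x. f x *\<^sub>R g x)"
  by (simp add: smooth_def C_k_bilinear[OF bounded_bilinear_scaleR])

lemma smooth_mult:
  fixes f g :: "'a::euclidean_space \<Rightarrow> real"
  shows "smooth f \<Longrightarrow> smooth g \<Longrightarrow> smooth (\<lambda>x. f x * g x)"
  by (simp add: smooth_def C_k_bilinear[OF bounded_bilinear_mult])

lemma smooth_comp_affine:
  fixes L :: "'a::euclidean_space \<Rightarrow> 'b::euclidean_space"
  shows "bounded_linear L \<Longrightarrow> smooth f \<Longrightarrow> smooth (\<lambda>x. f (L x + a))"
  by (simp add: smooth_def C_k_comp_affine)

lemma smooth_sum: "(\<And>i. i \<in> I \<Longrightarrow> smooth (f i)) \<Longrightarrow> smooth (\<lambda>x. \<Sum>i\<in>I. f i x)"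
  by (induction I rule: infinite_finite_induct) (auto intro: smooth_const smooth_add)

lemma smooth_prod:
  fixes f :: "'i \<Rightarrow> 'a::euclidean_space \<Rightarrow> real"
  shows "(\<And>i. i \<in> I \<Longrightarrow> smooth (f i)) \<Longrightarrow> smooth (\<lambda>x. \<Prod>i\<in>I. f i x)"
  by (induction I rule: infinite_finite_induct) (auto intro: smooth_const smooth_mult)

text \<open>Reduces uniform estimates for the derivative to those for finitely many directional
  derivatives, each of which is again a smooth function.\<close>

lemma frechet_derivative_basis_expansion:
  assumes "smooth f"
  shows "frechet_derivative f (at x) v = (\<Sum>b\<in>Basis. (v \<bullet> b) *\<^sub>R frechet_derivative f (at x) b)"
proof -
  interpret bounded_linear "frechet_derivative f (at x)"
    using smooth_has_derivative[OF assms] by (rule has_derivative_bounded_linear)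
  have "frechet_derivative f (at x) v = frechet_derivative f (at x) (\<Sum>b\<in>Basis. (v \<bullet> b) *\<^sub>R b)"
    by (simp add: euclidean_representation)
  then show ?thesis by (simp add: sum scaleR)
qed

lemma gradient_inner:
  assumes "smooth \<psi>"
  shows "gradient \<psi> x \<bullet> w = frechet_derivative \<psi> (at x) w"
  unfolding frechet_derivative_basis_expansion[OF assms, of x w]
  by (simp add: gradient_def inner_sum_left inner_sum_right inner_commute mult.commute)

lemma smooth_gradient: "smooth \<psi> \<Longrightarrow> smooth (gradient \<psi>)"
proof -
  assume "smooth \<psi>"
  then show ?thesis
    unfolding gradient_def[abs_def]
    by (intro smooth_sum smooth_scaleR smooth_frechet_derivative smooth_const)
qed

lemma gradientI: "(\<psi> has_derivative (\<lambda>v. w \<bullet> v)) (at x) \<Longrightarrow> gradient \<psi> x = w"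
  unfolding gradient_def
  by (subst frechet_derivative_at[symmetric]) (auto simp: euclidean_representation)

section \<open>Test functions\<close>

text \<open>Any compact set that contains the support will do, so that closures of supports never
  have to be computed.\<close>

lemma test_functionsI:
  assumes "smooth \<psi>" "compact K" "K \<subseteq> \<Omega>" "\<And>x. x \<notin> K \<Longrightarrow> \<psi> x = 0"
  shows "\<psi> \<in> test_functions \<Omega>"
proof -
  have sub: "{x. \<psi> x \<noteq> 0} \<subseteq> K"
    using assms(4) by auto
  have 1: "compact (closure {x. \<psi> x \<noteq> 0})"
    unfolding compact_closure by (rule bounded_subset[OF compact_imp_bounded[OF assms(2)] sub])
  have 2: "closure {x. \<psi> x \<noteq> 0} \<subseteq> \<Omega>"
    by (rule subset_trans[OF closure_minimal[OF sub compact_imp_closed[OF assms(2)]] assms(3)])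
  show ?thesis
    unfolding test_functions_def
    by (rule CollectI, rule conjI[OF assms(1)[unfolded smooth_def] conjI[OF 1 2]])
qed

lemma test_functionsE:
  assumes "\<psi> \<in> test_functions \<Omega>"
  obtains K where "smooth \<psi>" "compact K" "K \<subseteq> \<Omega>" "\<And>x. x \<notin> K \<Longrightarrow> \<psi> x = 0"
proof -
  note * = assms[unfolded test_functions_def mem_Collect_eq]
  have 1: "smooth \<psi>"
    unfolding smooth_def by (rule *[THEN conjunct1])
  have 2: "\<psi> x = 0" if "x \<notin> closure {x. \<psi> x \<noteq> 0}" for x
    using that closure_subset[of "{x. \<psi> x \<noteq> 0}"] by auto
  show thesis
    by (rule that[OF 1 *[THEN conjunct2, THEN conjunct1] *[THEN conjunct2, THEN conjunct2] 2])
qed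

lemma test_functions_smooth: "\<psi> \<in> test_functions \<Omega> \<Longrightarrow> smooth \<psi>"
  unfolding test_functions_def mem_Collect_eq smooth_def by (erule conjunct1)

lemma frechet_derivative_zero_outside:
  fixes \<psi> :: "'a::euclidean_space \<Rightarrow> 'b::real_normed_vector"
  assumes "compact K" "\<And>x. x \<notin> K \<Longrightarrow> \<psi> x = 0" "x \<notin> K"
  shows "frechet_derivative \<psi> (at x) v = 0"
proof -
  have "(\<psi> has_derivative (\<lambda>v. 0)) (at x)"
    by (rule has_derivative_transform_within_open[OF has_derivative_const[of 0], where s="- K"])
       (use assms in \<open>auto simp: compact_imp_closed open_Compl\<close>)
  then show ?thesis by (metis frechet_derivative_at)
qed

lemma test_functions_frechet_derivative:
  assumes "\<psi> \<in> test_functions \<Omega>"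
  shows "(\<lambda>x. frechet_derivative \<psi> (at x) v) \<in> test_functions \<Omega>"
proof (rule test_functionsE[OF assms])
  fix K assume K: "smooth \<psi>" "compact K" "K \<subseteq> \<Omega>" "\<And>x. x \<notin> K \<Longrightarrow> \<psi> x = 0"
  show ?thesis
    by (rule test_functionsI[OF smooth_frechet_derivative[OF K(1)] K(2,3)])
       (rule frechet_derivative_zero_outside[OF K(2,4)])
qed

lemma test_functions_gradient:
  assumes "\<psi> \<in> test_functions \<Omega>"
  shows "gradient \<psi> \<in> test_functions \<Omega>"
proof (rule test_functionsE[OF assms])
  fix K assume K: "smooth \<psi>" "compact K" "K \<subseteq> \<Omega>" "\<And>x. x \<notin> K \<Longrightarrow> \<psi> x = 0"
  show ?thesis
    by (rule test_functionsI[OF smooth_gradient[OF K(1)] K(2,3)])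
       (simp add: gradient_def frechet_derivative_zero_outside[OF K(2,4)])
qed

lemma test_functions_scaleR_left:
  assumes "\<psi> \<in> test_functions \<Omega>" "smooth f"
  shows "(\<lambda>x. \<psi> x *\<^sub>R f x) \<in> test_functions \<Omega>"
proof (rule test_functionsE[OF assms(1)])
  fix K assume K: "smooth \<psi>" "compact K" "K \<subseteq> \<Omega>" "\<And>x. x \<notin> K \<Longrightarrow> \<psi> x = 0"
  show ?thesis
    by (rule test_functionsI[OF smooth_scaleR[OF K(1) assms(2)] K(2,3)]) (simp add: K(4))
qed

lemma test_functions_bounded_linear:
  assumes "\<psi> \<in> test_functions \<Omega>" "bounded_linear T"
  shows "(\<lambda>x. T (\<psi> x)) \<in> test_functions \<Omega>"
proof (rule test_functionsE[OF assms(1)])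
  fix K assume K: "smooth \<psi>" "compact K" "K \<subseteq> \<Omega>" "\<And>x. x \<notin> K \<Longrightarrow> \<psi> x = 0"
  show ?thesis
    by (rule test_functionsI[OF smooth_bounded_linear[OF assms(2) K(1)] K(2,3)])
       (simp add: K(4) linear_0[OF bounded_linear.linear[OF assms(2)]])
qed

lemma test_functions_bounded:
  assumes "\<psi> \<in> test_functions \<Omega>"
  obtains B where "B > 0" "\<And>x. norm (\<psi> x) \<le> B"
proof (rule test_functionsE[OF assms])
  fix K assume K: "smooth \<psi>" "compact K" "K \<subseteq> \<Omega>" "\<And>x. x \<notin> K \<Longrightarrow> \<psi> x = 0"
  have "bounded (\<psi> ` K)"
    by (rule compact_imp_bounded[OF compact_continuous_image[OF smooth_continuous_on[OF K(1)] K(2)]])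
  then obtain B where B: "B > 0" "\<And>x. x \<in> K \<Longrightarrow> norm (\<psi> x) \<le> B"
    by (auto simp: bounded_pos)
  have "norm (\<psi> x) \<le> B" for x
    using B K(4)[of x] by (cases "x \<in> K") auto
  with B(1) show ?thesis by (rule that)
qed

lemma test_functions_integrable_lborel:
  fixes \<psi> :: "'a::euclidean_space \<Rightarrow> 'b::euclidean_space"
  assumes "\<psi> \<in> test_functions \<Omega>"
  shows "integrable lborel \<psi>"
proof (rule test_functionsE[OF assms])
  fix K assume K: "smooth \<psi>" "compact K" "K \<subseteq> \<Omega>" "\<And>x. x \<notin> K \<Longrightarrow> \<psi> x = 0"
  have "integrable lborel (\<lambda>x. indicator K x *\<^sub>R \<psi> x)"
    by (rule borel_integrable_compact[OF K(2) smooth_continuous_on[OF K(1)]])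
  moreover have "(\<lambda>x. indicator K x *\<^sub>R \<psi> x) = \<psi>"
    using K(4) by (auto simp: indicator_def)
  ultimately show ?thesis by simp
qed

section \<open>Smooth functions supported in boxes\<close>

text \<open>The derivatives of \<open>exp (- 1 / t)\<close> have the form \<open>P (1 / t) * exp (- 1 / t)\<close> with a
  polynomial \<open>P\<close>; flatness at the origin is only needed for this whole family at once.\<close>

definition flat_exp :: "real poly \<Rightarrow> real \<Rightarrow> real" where
  "flat_exp P t = (if t > 0 then poly P (1 / t) * exp (- (1 / t)) else 0)"

lemma tendsto_poly_mult_exp_minus:
  "((\<lambda>s::real. poly P s * exp (- s)) \<longlongrightarrow> 0) at_top"
proof -
  have "((\<lambda>s::real. \<Sum>i\<le>degree P. coeff P i * (s ^ i / exp s)) \<longlongrightarrow> 0) at_top"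
    by (rule tendsto_null_sum, rule tendsto_mult_right_zero, rule tendsto_power_div_exp_0)
  then show ?thesis
    by (simp add: poly_altdef exp_minus sum_distrib_right divide_inverse mult.assoc)
qed

text \<open>For t > 0 the difference quotient at 0 is (1 / t) P(1 / t) exp(- 1 / t), so it belongs
  to the polynomial \<open>pCons 0 P\<close> and vanishes in the limit because the exponential beats
  every polynomial. From the left it is zero.\<close>

lemma flat_exp_has_derivative_at_0: "(flat_exp P has_real_derivative 0) (at 0)"
proof -
  have "((\<lambda>t. flat_exp P t / t) \<longlongrightarrow> 0) (at_right 0)"
  proof -
    have "((\<lambda>t. poly (pCons 0 P) (inverse t) * exp (- inverse t)) \<longlongrightarrow> 0) (at_right (0::real))"
      by (rule filterlim_compose[OF tendsto_poly_mult_exp_minus filterlim_inverse_at_top_right])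
    then show ?thesis
      by (rule Lim_transform_eventually)
         (auto simp: eventually_at_right_field flat_exp_def field_simps intro!: exI[of _ 1])
  qed
  moreover have "((\<lambda>t. flat_exp P t / t) \<longlongrightarrow> 0) (at_left 0)"
    by (rule Lim_transform_eventually[OF tendsto_const])
       (auto simp: eventually_at_left_field flat_exp_def intro!: exI[of _ "-1"])
  ultimately have "((\<lambda>t. flat_exp P t / t) \<longlongrightarrow> 0) (at 0)"
    by (rule filterlim_split_at[rotated])
  then show ?thesis
    by (simp add: has_field_derivative_iff flat_exp_def)
qed

text \<open>With s = 1 / t and ds/dt = - s^2, the derivative of P(s) exp(- s) in t is s^2 (P(s) -
  P'(s)) exp(- s); this is the polynomial \<open>[:0, 0, 1:] * (P - pderiv P)\<close>. The family is
  closed under differentiation, hence all its members are smooth.\<close>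

lemma flat_exp_has_derivative:
  "(flat_exp P has_real_derivative flat_exp ([:0, 0, 1:] * (P - pderiv P)) t) (at t)"
proof (cases "t = 0")
  case True
  have "flat_exp ([:0, 0, 1:] * (P - pderiv P)) 0 = 0" by (simp add: flat_exp_def)
  then show ?thesis using flat_exp_has_derivative_at_0 True by simp
next
  case False
  show ?thesis
  proof (cases "t > 0")
    case True
    have "((\<lambda>t. poly P (1 / t) * exp (- (1 / t))) has_real_derivative
        flat_exp ([:0, 0, 1:] * (P - pderiv P)) t) (at t)"
      using True
      by (auto intro!: derivative_eq_intros DERIV_chain'[OF _ poly_DERIV]
          simp: flat_exp_def field_simps power2_eq_square)
    then show ?thesis
      by (rule has_field_derivative_transform_within[where d=t])
         (use True in \<open>auto simp: flat_exp_def dist_real_def\<close>)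
  next
    case 2: False
    show ?thesis
    proof (rule has_field_derivative_transform_within_open[where f="\<lambda>_. 0" and S="{..<0}"])
      show "((\<lambda>_. 0) has_real_derivative flat_exp ([:0, 0, 1:] * (P - pderiv P)) t) (at t)"
        using 2 by (simp add: flat_exp_def)
    qed (use False 2 in \<open>auto simp: flat_exp_def\<close>)
  qed
qed

lemma C_k_flat_exp: "C_k k (flat_exp P)"
proof (induction k arbitrary: P)
  case 0
  show ?case
    unfolding C_k.simps(1) by (rule DERIV_continuous_on[OF has_field_derivative_at_within[OF flat_exp_has_derivative]])
next
  case (Suc k)
  show ?case
    by (rule C_k_SucI[OF flat_exp_has_derivative[unfolded has_field_derivative_def]])
       (rule C_k_bounded_linear[OF bounded_linear_mult_left Suc])
qed

text \<open>For n > 0 this is positive exactly on the open box. The parameter \<open>n\<close>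
  steepens the flanks: as n grows, the functions tend to the indicator of \<open>box a b\<close>
  from below, while n = 1 supplies the mollifier.\<close>

definition bump :: "'a::euclidean_space \<Rightarrow> 'a \<Rightarrow> real \<Rightarrow> 'a \<Rightarrow> real" where
  "bump a b n x = (\<Prod>i\<in>Basis. flat_exp 1 (n * (x \<bullet> i - a \<bullet> i)) * flat_exp 1 (n * (b \<bullet> i - x \<bullet> i)))"

lemma flat_exp_1: "flat_exp 1 t = (if t > 0 then exp (- (1 / t)) else 0)"
  by (simp add: flat_exp_def)

lemma bump_bounds: "0 \<le> bump a b n x" "bump a b n x \<le> 1"
  unfolding bump_def by (auto intro!: prod_nonneg prod_le_1 mult_nonneg_nonneg mult_le_one simp: flat_exp_1)

lemma bump_eq_0: "n > 0 \<Longrightarrow> x \<notin> box a b \<Longrightarrow> bump a b n x = 0"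
  by (force simp: bump_def mem_box flat_exp_1 not_less zero_less_mult_iff)

lemma bump_pos: "n > 0 \<Longrightarrow> x \<in> box a b \<Longrightarrow> bump a b n x > 0"
  by (auto simp: bump_def mem_box flat_exp_1 intro!: prod_pos)

lemma smooth_bump: "smooth (bump a b n)"
proof -
  have fl: "smooth (flat_exp 1)"
    by (simp add: smooth_def C_k_flat_exp)
  have "smooth (\<lambda>x::'a. flat_exp 1 (n * (x \<bullet> i - a \<bullet> i)))" for i
    using smooth_comp_affine[OF bounded_linear_const_mult[OF bounded_linear_inner_left[of i], of n] fl, of "- (n * (a \<bullet> i))"]
    by (simp add: right_diff_distrib)
  moreover have "smooth (\<lambda>x::'a. flat_exp 1 (n * (b \<bullet> i - x \<bullet> i)))" for i
    using smooth_comp_affine[OF bounded_linear_const_mult[OF bounded_linear_inner_left[of i], of "- n"] fl, of "n * (b \<bullet> i)"]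
    by (simp add: right_diff_distrib add.commute)
  ultimately have "smooth (\<lambda>x::'a. flat_exp 1 (n * (x \<bullet> i - a \<bullet> i)) * flat_exp 1 (n * (b \<bullet> i - x \<bullet> i)))" for i
    by (rule smooth_mult)
  then show ?thesis
    unfolding bump_def[abs_def] by (rule smooth_prod)
qed

lemma bump_test_function:
  assumes "n > 0" "cbox a b \<subseteq> \<Omega>"
  shows "bump a b n \<in> test_functions \<Omega>"
proof (rule test_functionsI[OF smooth_bump compact_cbox assms(2)])
  fix x assume "x \<notin> cbox a b"
  then have "x \<notin> box a b"
    using box_subset_cbox by auto
  then show "bump a b n x = 0"
    by (rule bump_eq_0[OF assms(1)])
qed

lemma tendsto_bump: "(\<lambda>n. bump a b (real (Suc n)) x) \<longlonglongrightarrow> indicator (box a b) x"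
proof (cases "x \<in> box a b")
  case True
  have *: "(\<lambda>n. flat_exp 1 (real (Suc n) * t)) \<longlonglongrightarrow> 1" if "t > 0" for t
  proof -
    have "(\<lambda>n. exp (- (inverse (real (Suc n)) * inverse t))) \<longlonglongrightarrow> exp (- (0 * inverse t))"
      by (rule tendsto_exp[OF tendsto_minus[OF tendsto_mult[OF LIMSEQ_inverse_real_of_nat tendsto_const]]])
    moreover have "exp (- (inverse (real (Suc n)) * inverse t)) = flat_exp 1 (real (Suc n) * t)" for n
      using that by (simp only: flat_exp_1 inverse_eq_divide) (simp add: zero_less_mult_iff)
    ultimately show ?thesis by simp
  qed
  have "(\<lambda>n. bump a b (real (Suc n)) x) \<longlonglongrightarrow> (\<Prod>i\<in>(Basis::'a set). 1 * 1)"
    unfolding bump_def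
  proof (rule tendsto_prod)
    fix i :: 'a assume "i \<in> Basis"
    then have "0 < x \<bullet> i - a \<bullet> i" "0 < b \<bullet> i - x \<bullet> i"
      using True by (auto simp: mem_box)
    then show "(\<lambda>n. flat_exp 1 (real (Suc n) * (x \<bullet> i - a \<bullet> i)) * flat_exp 1 (real (Suc n) * (b \<bullet> i - x \<bullet> i)))
        \<longlonglongrightarrow> 1 * 1"
      by (intro tendsto_mult[OF * *])
  qed
  then show ?thesis using True by simp
next
  case False
  then show ?thesis by (simp add: bump_eq_0)
qed


lemma test_functions_zero_outside:
  assumes "\<psi> \<in> test_functions \<Omega>" "x \<notin> \<Omega>"
  shows "\<psi> x = 0"
proof (rule test_functionsE[OF assms(1)])
  fix K assume K: "smooth \<psi>" "compact K" "K \<subseteq> \<Omega>" "\<And>x. x \<notin> K \<Longrightarrow> \<psi> x = 0"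
  show ?thesis
    by (rule K(4)) (use K(3) assms(2) in auto)
qed

section \<open>Uniqueness and integration by parts for weak divergences\<close>

section \<open>The fundamental lemma of the calculus of variations\<close>

text \<open>Boxes are an intersection-stable generator of the Borel sets, so by Dynkin's argument
  the integral of \<open>f\<close> over every Borel set vanishes. The measure \<open>N\<close> is
  left open because both Lebesgue measure and the image of |Du| will be inserted.\<close>

lemma AE_zero_if_box_integrals_zero:
  fixes f :: "'a::euclidean_space \<Rightarrow> real"
  assumes sets: "sets N = sets borel" and f: "integrable N f"
    and box: "\<And>a b. (LINT x|N. indicator (box a b) x * f x) = 0"
  shows "AE x in N. f x = 0"
proof -
  let ?I = "\<lambda>A. LINT x|N. indicator A x * f x"
  have int: "integrable N (\<lambda>x. indicator A x * f x)" if "A \<in> sets N" for A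
    using integrable_mult_indicator[OF that f] by simp
  have sp: "space N = UNIV"
    using sets_eq_imp_space_eq[OF sets] by simp
  have UN: "?I (\<Union>i. A i) = 0" if "disjoint_family A" "\<And>i. A i \<in> sets N" "\<And>i. ?I (A i) = 0"
    for A :: "nat \<Rightarrow> 'a set"
  proof -
    have "?I (\<Union>i. A i) = (\<Sum>i. ?I (A i))"
      using lebesgue_integral_countable_add[of A N f] that int
      by (simp add: set_lebesgue_integral_def set_integrable_def disjoint_family_on_def)
    then show ?thesis using that by simp
  qed
  \<comment> \<open>Complements in the Dynkin argument require the integral over the whole space,
    which is a limit of integrals over growing boxes.\<close>
  have UNIV0: "?I UNIV = 0"
  proof -
    have "(\<lambda>n. ?I (box (- real n *\<^sub>R One) (real n *\<^sub>R One))) \<longlonglongrightarrow> ?I UNIV"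
    proof (rule integral_dominated_convergence[where w="\<lambda>x. norm (f x)"])
      show "AE x in N. (\<lambda>n. indicator (box (- real n *\<^sub>R One) (real n *\<^sub>R One)) x * f x)
          \<longlonglongrightarrow> indicator UNIV x * f x"
      proof (rule AE_I2)
        fix x :: 'a
        obtain m :: nat where m: "norm x < real m"
          using reals_Archimedean2 by blast
        have "x \<in> box (- real n *\<^sub>R One) (real n *\<^sub>R One)" if "n \<ge> m" for n
        proof -
          have "\<bar>x \<bullet> i\<bar> < real n" if "i \<in> Basis" for i
            using Basis_le_norm[OF that, of x] m \<open>n \<ge> m\<close> by linarith
          then show ?thesis by (fastforce simp: mem_box)
        qed
        then have "eventually (\<lambda>n. indicator (box (- real n *\<^sub>R One) (real n *\<^sub>R One)) x * f x = indicator UNIV x * f x) sequentially"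
          by (auto simp: eventually_sequentially intro!: exI[of _ m])
        then show "(\<lambda>n. indicator (box (- real n *\<^sub>R One) (real n *\<^sub>R One)) x * f x)
          \<longlonglongrightarrow> indicator UNIV x * f x"
          by (rule tendsto_eventually)
      qed
    qed (use f int in \<open>auto simp: sets intro!: borel_measurable_integrable AE_I2 integrable_norm simp: indicator_def\<close>)
    moreover have "(\<lambda>n. ?I (box (- real n *\<^sub>R One) (real n *\<^sub>R One))) \<longlonglongrightarrow> 0"
      by (simp add: box)
    ultimately show ?thesis by (rule LIMSEQ_unique)
  qed
  have zero: "?I A = 0" if A: "A \<in> sets N" for A
  proof -
    have IS: "Int_stable (range (\<lambda>(a, b). box a b :: 'a set))"
      by (auto simp: Int_stable_def box_Int_box)
    have PW: "range (\<lambda>(a, b). box a b :: 'a set) \<subseteq> Pow UNIV"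
      by simp
    have "A \<in> sigma_sets UNIV (range (\<lambda>(a, b). box a b :: 'a set))"
      using A by (simp add: sets borel_eq_box)
    from IS PW this show ?thesis
    proof (induction rule: sigma_sets_induct_disjoint)
      case (basic A)
      then show ?case using box by auto
    next
      case (compl A)
      then have [measurable]: "A \<in> sets N" by (simp add: sets borel_eq_box)
      have "?I (UNIV - A) = (LINT x|N. indicator UNIV x * f x - indicator A x * f x)"
        by (rule Bochner_Integration.integral_cong) (auto simp: indicator_def)
      also have "\<dots> = ?I UNIV - ?I A"
        using f int by (intro Bochner_Integration.integral_diff) auto
      finally show ?case using compl UNIV0 by simp
    next
      case (union A)
      then show ?case
        by (intro UN) (auto simp: sets borel_eq_box)
    qed auto
  qed
  have "AE x in N. f x = (\<lambda>_. 0) x"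
    by (rule density_unique_real) (use f zero in \<open>auto simp: set_lebesgue_integral_def\<close>)
  then show ?thesis by simp
qed

text \<open>Bumps increase a box indicator to the limit and stay below it, so vanishing test
  integrals become vanishing box integrals, for boxes whose closure lies in \<Omega>. The preceding
  lemma then works on each such box, and countably many of them cover \<Omega> by Lindelof.\<close>

lemma AE_zero_if_test_integrals_zero:
  fixes f :: "'a::euclidean_space \<Rightarrow> real"
  assumes sets: "sets N = sets borel" and "open \<Omega>"
    and f: "f \<in> borel_measurable borel"
    and loc: "\<And>K. compact K \<Longrightarrow> K \<subseteq> \<Omega> \<Longrightarrow> integrable N (\<lambda>x. indicator K x * f x)"
    and test: "\<And>\<psi>. \<psi> \<in> test_functions \<Omega> \<Longrightarrow> (LINT x|N. \<psi> x * f x) = 0"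
  shows "AE x in N. x \<in> \<Omega> \<longrightarrow> f x = 0"
proof -
  note [measurable_cong] = sets
  have on_box: "AE x in N. x \<in> box a b \<longrightarrow> f x = 0" if ab: "cbox a b \<subseteq> \<Omega>" for a b
  proof -
    let ?g = "\<lambda>x. indicator (box a b) x * f x"
    have sub: "integrable N (\<lambda>x. indicator (box c d) x * f x)" if "cbox c d \<subseteq> \<Omega>" for c d
    proof -
      have "integrable N (\<lambda>x. indicator (box c d) x *\<^sub>R (indicator (cbox c d) x * f x))"
        by (intro integrable_mult_indicator loc compact_cbox that) (simp add: sets)
      moreover have "(\<lambda>x. indicator (box c d) x *\<^sub>R (indicator (cbox c d) x * f x)) = (\<lambda>x. indicator (box c d) x * f x)"
        using box_subset_cbox[of c d] by (intro ext) (auto simp: indicator_def)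
      ultimately show ?thesis by (simp only:)
    qed
    have zero: "(LINT x|N. indicator (box c d) x * f x) = 0" if cd: "cbox c d \<subseteq> \<Omega>" for c d
    proof -
      have "(\<lambda>n. LINT x|N. bump c d (real (Suc n)) x * f x) \<longlonglongrightarrow> (LINT x|N. indicator (box c d) x * f x)"
      proof (rule integral_dominated_convergence[where w="\<lambda>x. norm (indicator (box c d) x * f x)"])
        show "AE x in N. (\<lambda>n. bump c d (real (Suc n)) x * f x) \<longlonglongrightarrow> indicator (box c d) x * f x"
          by (rule AE_I2) (rule tendsto_mult[OF tendsto_bump tendsto_const])
        show "AE x in N. norm (bump c d (real (Suc n)) x * f x) \<le> norm (indicator (box c d) x * f x)" for n
        proof (rule AE_I2)
          fix x
          show "norm (bump c d (real (Suc n)) x * f x) \<le> norm (indicator (box c d) x * f x)"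
            using bump_bounds[of c d "real (Suc n)" x] bump_eq_0[of "real (Suc n)" x c d]
            by (cases "x \<in> box c d") (auto simp: abs_mult mult_left_le_one_le)
        qed
        show "(\<lambda>x. bump c d (real (Suc n)) x * f x) \<in> borel_measurable N" for n
          unfolding measurable_cong_sets[OF sets refl]
          by (rule borel_measurable_times[OF smooth_borel_measurable[OF smooth_bump] f])
        show "(\<lambda>x. indicator (box c d) x * f x) \<in> borel_measurable N"
          using sub[OF cd] by (rule borel_measurable_integrable)
        show "integrable N (\<lambda>x. norm (indicator (box c d) x * f x))"
          using sub[OF cd] by (rule integrable_norm)
      qed
      moreover have "(LINT x|N. bump c d (real (Suc n)) x * f x) = 0" for n
        by (rule test[OF bump_test_function[OF _ cd]]) simp
      ultimately show ?thesis using LIMSEQ_unique[OF _ tendsto_const] by simp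
    qed
    \<comment> \<open>Cut off at a box, \<open>f\<close> is integrable on the whole space, and its
      integrals over arbitrary boxes reduce to boxes inside \<Omega> because two boxes meet in a
      box.\<close>
    have "AE x in N. ?g x = 0"
    proof (rule AE_zero_if_box_integrals_zero[OF sets sub[OF ab]])
      fix c d :: 'a
      obtain a' b' where *: "box c d \<inter> box a b = box a' b'"
        by (auto simp: box_Int_box)
      show "(LINT x|N. indicator (box c d) x * (indicator (box a b) x * f x)) = 0"
      proof (cases "box a' b' = {}")
        case True
        with * have "(\<lambda>x. indicator (box c d) x * (indicator (box a b) x * f x)) = (\<lambda>x. 0)"
          by (intro ext) (auto simp: indicator_def)
        then show ?thesis by simp
      next
        case False
        \<comment> \<open>A nonempty open box has the closed box as its closure; this fails for
          empty ones, hence the case distinction.\<close>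
        have "cbox a' b' \<subseteq> cbox a b"
          using False * closure_box[OF False] closure_mono[of "box a' b'" "cbox a b"] box_subset_cbox[of a b]
          by (metis closed_cbox closure_closed inf_le2 subset_trans)
        then have "(LINT x|N. indicator (box a' b') x * f x) = 0"
          using ab by (intro zero) auto
        moreover have "(\<lambda>x. indicator (box c d) x * (indicator (box a b) x * f x)) = (\<lambda>x. indicator (box a' b') x * f x)"
          unfolding *[symmetric] by (intro ext) (simp add: indicator_inter_arith)
        ultimately show ?thesis by (simp only:)
      qed
    qed
    then show ?thesis
      by eventually_elim (auto simp: indicator_def split: if_splits)
  qed
  let ?F = "{box a b | a b. cbox a b \<subseteq> \<Omega>}"
  obtain F' where F': "F' \<subseteq> ?F" "countable F'" "\<Union>F' = \<Union>?F"
    using Lindelof[of ?F] by (auto simp: open_box)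
  have cov: "\<Union>?F = \<Omega>"
  proof
    show "\<Omega> \<subseteq> \<Union>?F"
    proof
      fix x assume "x \<in> \<Omega>"
      obtain a b where "cbox a b \<subseteq> \<Omega>" "x \<in> box a b"
        by (rule open_contains_cbox[OF \<open>open \<Omega>\<close> \<open>x \<in> \<Omega>\<close>])
      then show "x \<in> \<Union>?F" by auto
    qed
    show "\<Union>?F \<subseteq> \<Omega>"
      using box_subset_cbox by fastforce
  qed
  have "AE x in N. \<forall>X\<in>F'. x \<in> X \<longrightarrow> f x = 0"
    using F'(1) on_box by (subst AE_ball_countable[OF F'(2)]) auto
  then show ?thesis
  proof eventually_elim
    case (elim x)
    show ?case
    proof
      assume "x \<in> \<Omega>"
      then obtain X where "X \<in> F'" "x \<in> X"
        using F'(3) cov by auto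
      with elim show "f x = 0" by auto
    qed
  qed
qed

section \<open>Integration by parts\<close>

text \<open>Each directional derivative is itself a test function and so bounded; summing over the
  basis bounds the whole derivative, and the mean value inequality turns the bound into a Lipschitz
  constant.\<close>

lemma test_functions_derivative_bounded:
  fixes \<psi> :: "'a::euclidean_space \<Rightarrow> 'b::real_normed_vector"
  assumes "\<psi> \<in> test_functions \<Omega>"
  obtains B where "B > 0" "\<And>x v. norm (frechet_derivative \<psi> (at x) v) \<le> B * norm v"
    "\<And>x y. norm (\<psi> x - \<psi> y) \<le> B * norm (x - y)"
proof -
  have "\<exists>B>0. \<forall>x. norm (frechet_derivative \<psi> (at x) b) \<le> B" for b
    using test_functions_bounded[OF test_functions_frechet_derivative[OF assms, of b]] by metis
  then obtain B where B: "\<And>b. B b > 0" "\<And>b x. norm (frechet_derivative \<psi> (at x) b) \<le> B b"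
    by metis
  let ?B = "sum B (Basis :: 'a set)"
  have "?B > 0" using B(1) by (simp add: sum_pos)
  have der: "norm (frechet_derivative \<psi> (at x) v) \<le> ?B * norm v" for x v
  proof -
    have "norm (frechet_derivative \<psi> (at x) v) \<le> (\<Sum>b\<in>Basis. norm v * B b)"
      unfolding frechet_derivative_basis_expansion[OF test_functions_smooth[OF assms], of x v]
    proof (rule sum_norm_le)
      fix b :: 'a assume "b \<in> Basis"
      then show "norm ((v \<bullet> b) *\<^sub>R frechet_derivative \<psi> (at x) b) \<le> norm v * B b"
        using B Basis_le_norm[of b v] by (auto intro!: mult_mono)
    qed
    then show ?thesis by (simp add: sum_distrib_left mult.commute)
  qed
  have "norm (\<psi> x - \<psi> y) \<le> ?B * norm (x - y)" for x y
    by (rule differentiable_bound[of UNIV \<psi> "\<lambda>x. frechet_derivative \<psi> (at x)"])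
       (auto intro!: onorm_le der smooth_has_derivative[OF test_functions_smooth[OF assms]])
  with \<open>?B > 0\<close> der show thesis by (rule that)
qed

lemma smooth_difference_quotient:
  fixes f :: "'a::euclidean_space \<Rightarrow> real"
  assumes "smooth f"
  shows "(\<lambda>n. real (Suc n) * (f (x + (1 / real (Suc n)) *\<^sub>R v) - f x)) \<longlonglongrightarrow> frechet_derivative f (at x) v"
proof -
  have D: "((\<lambda>t::real. f (x + t *\<^sub>R v)) has_derivative (\<lambda>t. frechet_derivative f (at x) (t *\<^sub>R v))) (at 0)"
    by (rule has_derivative_compose[of "\<lambda>t. x + t *\<^sub>R v" _ _ _ f])
       (auto intro!: derivative_eq_intros simp: smooth_has_derivative[OF assms])
  have "(\<lambda>t. frechet_derivative f (at x) (t *\<^sub>R v)) = (*) (frechet_derivative f (at x) v)"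
    using linear_scale[OF bounded_linear.linear[OF has_derivative_bounded_linear[OF smooth_has_derivative[OF assms]]]]
    by (intro ext) (simp add: mult.commute)
  with D have "((\<lambda>t::real. f (x + t *\<^sub>R v)) has_real_derivative frechet_derivative f (at x) v) (at 0)"
    by (simp add: has_field_derivative_def)
  then have L: "((\<lambda>t. (f (x + t *\<^sub>R v) - f x) / t) \<longlongrightarrow> frechet_derivative f (at x) v) (at 0)"
    by (simp add: has_field_derivative_iff)
  have F: "filterlim (\<lambda>n. 1 / real (Suc n)) (at 0) sequentially"
    unfolding filterlim_at using LIMSEQ_inverse_real_of_nat by (simp add: inverse_eq_divide)
  have "(\<lambda>n. (f (x + (1 / real (Suc n)) *\<^sub>R v) - f x) / (1 / real (Suc n))) \<longlonglongrightarrow> frechet_derivative f (at x) v"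
    by (rule filterlim_compose[OF L F])
  then show ?thesis
    by (simp add: mult.commute)
qed

lemma lborel_integrable_translate:
  fixes f :: "'a::euclidean_space \<Rightarrow> 'b::{banach, second_countable_topology}"
  assumes "integrable lborel f"
  shows "integrable lborel (\<lambda>x. f (x + h))" "(LINT x|lborel. f (x + h)) = (LINT x|lborel. f x)"
proof -
  have f: "f \<in> borel_measurable borel"
    using borel_measurable_integrable[OF assms] by simp
  have *: "distr lborel borel (\<lambda>x. x + h) = lborel"
    unfolding add.commute[of _ h] by (rule lborel_distr_plus)
  show "integrable lborel (\<lambda>x. f (x + h))"
    using assms integrable_distr_eq[of "\<lambda>x. x + h" lborel borel f] f by (simp add: *)
  show "(LINT x|lborel. f (x + h)) = (LINT x|lborel. f x)"
    using integral_distr[of "\<lambda>x. x + h" lborel borel f] f by (simp add: *)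
qed

text \<open>Difference quotients have integral zero by translation invariance, and they converge to
  the directional derivative under a common integrable bound.\<close>

lemma test_functions_integral_derivative_zero:
  fixes f :: "'a::euclidean_space \<Rightarrow> real"
  assumes "f \<in> test_functions \<Omega>"
  shows "(LINT x|lborel. frechet_derivative f (at x) v) = 0"
proof (rule test_functionsE[OF assms])
  fix K assume K: "smooth f" "compact K" "K \<subseteq> \<Omega>" "\<And>x. x \<notin> K \<Longrightarrow> f x = 0"
  obtain R where R: "R > 0" "\<And>x. x \<in> K \<Longrightarrow> norm x \<le> R"
    using compact_imp_bounded[OF K(2)] by (auto simp: bounded_pos)
  obtain B where B: "B > 0" "\<And>x y. norm (f x - f y) \<le> B * norm (x - y)"
    using test_functions_derivative_bounded[OF assms] by metis
  let ?q = "\<lambda>n x. real (Suc n) * (f (x + (1 / real (Suc n)) *\<^sub>R v) - f x)"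
  have meas: "f \<in> borel_measurable borel"
    using smooth_borel_measurable[OF K(1)] .
  note int = test_functions_integrable_lborel[OF assms]
  have "(\<lambda>n. LINT x|lborel. ?q n x) \<longlonglongrightarrow> (LINT x|lborel. frechet_derivative f (at x) v)"
  \<comment> \<open>The increments \<open>(1 / real (Suc n)) *\<^sub>R v\<close> are no longer than
    \<open>v\<close>, so beyond radius R + norm v neither of the two points meets the support;
    within it the Lipschitz constant B bounds the quotient by B * norm v.\<close>
  proof (rule integral_dominated_convergence[where w="\<lambda>x. indicator (cball 0 (R + norm v)) x *\<^sub>R (B * norm v)"])
    show "AE x in lborel. norm (?q n x) \<le> indicator (cball 0 (R + norm v)) x *\<^sub>R (B * norm v)" for n
    proof (rule AE_I2)
      fix x
      let ?h = "(1 / real (Suc n)) *\<^sub>R v"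
      have h: "norm ?h \<le> norm v"
        by (simp add: divide_le_eq mult_le_cancel_left1)
      show "norm (?q n x) \<le> indicator (cball 0 (R + norm v)) x *\<^sub>R (B * norm v)"
      proof (cases "x \<in> cball 0 (R + norm v)")
        case True
        have "norm (?q n x) \<le> real (Suc n) * (B * norm ?h)"
          unfolding norm_mult using B(2)[of "x + ?h" x] by (intro mult_mono) auto
        also have "\<dots> = B * norm v" by simp
        finally show ?thesis using True by simp
      next
        case False
        then have "norm x > R + norm v" by simp
        moreover have "norm x \<le> norm (x + ?h) + norm ?h"
          by (metis add_diff_cancel_right' norm_triangle_ineq4)
        ultimately have "norm (x + ?h) > R" "norm x > R"
          using h norm_ge_zero[of v] by linarith+
        then have "f (x + ?h) = 0" "f x = 0"
          using R(2) K(4) by (meson not_le)+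
        then show ?thesis using B(1) by simp
      qed
    qed
    show "integrable lborel (\<lambda>x. indicator (cball 0 (R + norm v)) x *\<^sub>R (B * norm v))"
      by (rule borel_integrable_compact) auto
    show "AE x in lborel. (\<lambda>n. ?q n x) \<longlonglongrightarrow> frechet_derivative f (at x) v"
      by (rule AE_I2) (rule smooth_difference_quotient[OF K(1)])
  qed (use meas smooth_borel_measurable[OF smooth_frechet_derivative[OF K(1)]] in auto)
  moreover have "(LINT x|lborel. ?q n x) = 0" for n
    using lborel_integrable_translate[OF int, of "(1 / real (Suc n)) *\<^sub>R v"] int by simp
  ultimately show ?thesis using LIMSEQ_unique[OF _ tendsto_const] by simp
qed

definition divergence :: "('a::euclidean_space \<Rightarrow> 'a) \<Rightarrow> 'a \<Rightarrow> real" where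
  "divergence F x = (\<Sum>b\<in>Basis. frechet_derivative F (at x) b \<bullet> b)"

lemma smooth_divergence:
  assumes "smooth F"
  shows "smooth (divergence F)"
  unfolding divergence_def[abs_def]
  by (rule smooth_sum, rule smooth_bounded_linear[OF bounded_linear_inner_left smooth_frechet_derivative[OF assms]])

lemma divergence_scaleR:
  fixes \<psi> :: "'a::euclidean_space \<Rightarrow> real"
  assumes "smooth \<psi>" "smooth F"
  shows "divergence (\<lambda>x. \<psi> x *\<^sub>R F x) x = gradient \<psi> x \<bullet> F x + \<psi> x * divergence F x"
proof -
  have "frechet_derivative (\<lambda>x. \<psi> x *\<^sub>R F x) (at x) =
      (\<lambda>v. \<psi> x *\<^sub>R frechet_derivative F (at x) v + frechet_derivative \<psi> (at x) v *\<^sub>R F x)"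
    by (rule sym, rule frechet_derivative_at,
        rule has_derivative_scaleR[OF smooth_has_derivative[OF assms(1)] smooth_has_derivative[OF assms(2)]])
  then show ?thesis
    by (simp add: divergence_def gradient_def inner_add_left sum.distrib sum_distrib_left inner_sum_left
        inner_commute[of _ "F x"] inner_sum_right)
qed

lemma divergence_sum:
  assumes "\<And>i. i \<in> I \<Longrightarrow> smooth (F i)"
  shows "divergence (\<lambda>x. \<Sum>i\<in>I. F i x) x = (\<Sum>i\<in>I. divergence (F i) x)"
proof -
  have "frechet_derivative (\<lambda>x. \<Sum>i\<in>I. F i x) (at x) = (\<lambda>v. \<Sum>i\<in>I. frechet_derivative (F i) (at x) v)"
    by (rule sym, rule frechet_derivative_at, rule has_derivative_sum, rule smooth_has_derivative[OF assms])
  then show ?thesis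
    by (simp add: divergence_def inner_sum_left) (rule sum.swap)
qed

lemma integral_divergence_test_function:
  fixes F :: "'a::euclidean_space \<Rightarrow> 'a"
  assumes "F \<in> test_functions \<Omega>"
  shows "(LINT x|lborel. divergence F x) = 0"
proof -
  have "(LINT x|lborel. divergence F x) = (\<Sum>b\<in>Basis. LINT x|lborel. frechet_derivative F (at x) b \<bullet> b)"
    unfolding divergence_def
    by (rule Bochner_Integration.integral_sum, rule integrable_inner_left,
        rule test_functions_integrable_lborel[OF test_functions_frechet_derivative[OF assms]])
  also have "\<dots> = 0"
  proof (rule sum.neutral, rule ballI)
    fix b :: 'a
    note T = test_functions_bounded_linear[OF assms bounded_linear_inner_left[of b]]
    have "frechet_derivative (\<lambda>x. F x \<bullet> b) (at x) = (\<lambda>v. frechet_derivative F (at x) v \<bullet> b)" for x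
      by (rule sym, rule frechet_derivative_at,
          rule has_derivative_inner_left[OF smooth_has_derivative[OF test_functions_smooth[OF assms]]])
    then show "(LINT x|lborel. frechet_derivative F (at x) b \<bullet> b) = 0"
      using test_functions_integral_derivative_zero[OF T, of b] by simp
  qed
  finally show ?thesis .
qed

section \<open>Representatives on an open set\<close>

text \<open>Each coordinate of a Lebesgue measurable function agrees almost everywhere with a Borel
  function. Mollification, Fubini and affine substitutions then take place over
  \<open>lborel\<close> on the whole space, and the results are carried back to
  \<open>lebesgue_on \<Omega>\<close>.\<close>

lemma borel_representative:
  fixes f :: "'a::euclidean_space \<Rightarrow> 'b::euclidean_space"
  assumes "open \<Omega>" "f \<in> borel_measurable (lebesgue_on \<Omega>)"
  obtains f' where "f' \<in> borel_measurable borel" "\<And>x. x \<notin> \<Omega> \<Longrightarrow> f' x = 0"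
    "AE x in lebesgue. x \<in> \<Omega> \<longrightarrow> f x = f' x"
proof -
  have [measurable]: "\<Omega> \<in> sets borel" using assms(1) by simp
  have m: "(\<lambda>x. indicator \<Omega> x *\<^sub>R f x) \<in> borel_measurable lebesgue"
    using assms by (subst borel_measurable_restrict_space_iff[symmetric]) auto
  have "\<exists>g\<in>borel_measurable lborel. AE x in lborel. (indicator \<Omega> x *\<^sub>R f x) \<bullet> b = g x" for b
    by (rule completion_ex_borel_measurable_real, rule borel_measurable_inner[OF m borel_measurable_const])
  then obtain g where g: "\<And>b. g b \<in> borel_measurable lborel"
      "\<And>b. AE x in lborel. (indicator \<Omega> x *\<^sub>R f x) \<bullet> b = g b x"
    by metis
  let ?h = "\<lambda>x. indicator \<Omega> x *\<^sub>R (\<Sum>b\<in>Basis. g b x *\<^sub>R b)"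
  have g': "g b \<in> borel_measurable borel" for b
    using g(1)[of b] by simp
  show thesis
  proof
    show "?h \<in> borel_measurable borel"
      using g' by measurable
    have "AE x in lborel. \<forall>b\<in>Basis. (indicator \<Omega> x *\<^sub>R f x) \<bullet> b = g b x"
      using g(2) by (subst AE_ball_countable) (auto simp: countable_finite)
    then have "AE x in lborel. x \<in> \<Omega> \<longrightarrow> f x = ?h x"
    proof eventually_elim
      case (elim x)
      then show ?case by (auto simp: euclidean_eq_iff[where 'a='b])
    qed
    then show "AE x in lebesgue. x \<in> \<Omega> \<longrightarrow> f x = ?h x"
      by (rule AE_completion)
  qed auto
qed

lemma AE_lebesgue_on_open:
  fixes \<Omega> :: "'a::euclidean_space set"
  shows "open \<Omega> \<Longrightarrow> (AE x in lebesgue_on \<Omega>. P x) \<longleftrightarrow> (AE x in lebesgue. x \<in> \<Omega> \<longrightarrow> P x)"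
  by (rule AE_restrict_space_iff) simp

lemma integral_lebesgue_on_eq_lborel:
  fixes f :: "'a::euclidean_space \<Rightarrow> 'b::euclidean_space"
  assumes "open \<Omega>" "f \<in> borel_measurable borel" "\<And>x. x \<notin> \<Omega> \<Longrightarrow> f x = 0"
  shows "(LINT x|lebesgue_on \<Omega>. f x) = (LINT x|lborel. f x)"
    and "integrable (lebesgue_on \<Omega>) f \<longleftrightarrow> integrable lborel f"
proof -
  have *: "(\<lambda>x. indicator \<Omega> x *\<^sub>R f x) = f"
    using assms(3) by (auto simp: indicator_def)
  have "(LINT x|lebesgue_on \<Omega>. f x) = (LINT x|lebesgue. f x)"
    using assms(1) by (subst integral_restrict_space) (auto simp: *)
  then show "(LINT x|lebesgue_on \<Omega>. f x) = (LINT x|lborel. f x)"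
    using assms(2) by (simp add: integral_completion)
  have "integrable (lebesgue_on \<Omega>) f \<longleftrightarrow> integrable lebesgue f"
    using assms(1) by (subst integrable_restrict_space) (auto simp: *)
  then show "integrable (lebesgue_on \<Omega>) f \<longleftrightarrow> integrable lborel f"
    using assms(2) by (simp add: integrable_completion)
qed

section \<open>The weak divergence\<close>

lemma is_weak_divD:
  assumes "is_weak_div \<Omega> g h"
  shows "loc_integrable \<Omega> g" "loc_integrable \<Omega> h"
    and "\<psi> \<in> test_functions \<Omega> \<Longrightarrow>
      (LINT x|lebesgue_on \<Omega>. g x \<bullet> gradient \<psi> x) = - (LINT x|lebesgue_on \<Omega>. h x * \<psi> x)"
proof -
  note * = assms[unfolded is_weak_div_def]
  show "loc_integrable \<Omega> g" by (rule conjunct1[OF *])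
  show "loc_integrable \<Omega> h" by (rule conjunct1[OF conjunct2[OF *]])
  assume "\<psi> \<in> test_functions \<Omega>"
  then show "(LINT x|lebesgue_on \<Omega>. g x \<bullet> gradient \<psi> x) = - (LINT x|lebesgue_on \<Omega>. h x * \<psi> x)"
    by (rule bspec[OF conjunct2[OF conjunct2[OF *]]])
qed

lemma loc_integrable_continuous:
  fixes f :: "'a::euclidean_space \<Rightarrow> 'b::euclidean_space"
  assumes "continuous_on UNIV f"
  shows "loc_integrable \<Omega> f"
  unfolding loc_integrable_def
proof (intro allI impI)
  fix K assume "compact K \<and> K \<subseteq> \<Omega>"
  then have "set_integrable lborel K f"
    using assms unfolding set_integrable_def
    by (intro borel_integrable_compact) (auto intro: continuous_on_subset)
  then show "set_integrable lebesgue K f"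
    by (simp add: set_integrable_def integrable_completion borel_measurable_integrable)
qed

text \<open>The field F need not vanish near the boundary, but \<psi> F does, and the integral of
  its divergence is zero; the product rule splits it into the two terms.\<close>

lemma is_weak_div_divergence:
  fixes F :: "'a::euclidean_space \<Rightarrow> 'a"
  assumes "open \<Omega>" "smooth F"
  shows "is_weak_div \<Omega> F (divergence F)"
proof -
  have "(LINT x|lebesgue_on \<Omega>. F x \<bullet> gradient \<psi> x) = - (LINT x|lebesgue_on \<Omega>. divergence F x * \<psi> x)"
    if \<psi>: "\<psi> \<in> test_functions \<Omega>" for \<psi>
  proof -
    note sm = test_functions_smooth[OF \<psi>]
    note T1 = test_functions_scaleR_left[OF \<psi> smooth_divergence[OF assms(2)]]
    note TF = test_functions_scaleR_left[OF \<psi> assms(2)]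
    note i1 = test_functions_integrable_lborel[OF T1]
    have i: "integrable lborel (divergence (\<lambda>x. \<psi> x *\<^sub>R F x))"
      unfolding divergence_def[abs_def]
      by (rule Bochner_Integration.integrable_sum, rule integrable_inner_left,
        rule test_functions_integrable_lborel[OF test_functions_frechet_derivative[OF TF]])
    have eq: "F x \<bullet> gradient \<psi> x = divergence (\<lambda>x. \<psi> x *\<^sub>R F x) x - \<psi> x *\<^sub>R divergence F x" for x
      by (simp add: divergence_scaleR[OF sm assms(2)] inner_commute)
    have z: "\<psi> x = 0" "gradient \<psi> x = 0" if "x \<notin> \<Omega>" for x
      using test_functions_zero_outside[OF \<psi> that]
        test_functions_zero_outside[OF test_functions_gradient[OF \<psi>] that] by simp_all
    have "(LINT x|lebesgue_on \<Omega>. F x \<bullet> gradient \<psi> x) = (LINT x|lborel. F x \<bullet> gradient \<psi> x)"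
      by (rule integral_lebesgue_on_eq_lborel[OF assms(1)])
         (use z smooth_borel_measurable[OF assms(2)] smooth_borel_measurable[OF smooth_gradient[OF sm]] in auto)
    also have "\<dots> = - (LINT x|lborel. \<psi> x *\<^sub>R divergence F x)"
      unfolding eq using i i1 integral_divergence_test_function[OF TF] by simp
    also have "(LINT x|lborel. \<psi> x *\<^sub>R divergence F x) = (LINT x|lborel. divergence F x * \<psi> x)"
      by (simp add: mult.commute)
    also have "\<dots> = (LINT x|lebesgue_on \<Omega>. divergence F x * \<psi> x)"
      by (rule integral_lebesgue_on_eq_lborel(1)[OF assms(1), symmetric])
         (use z smooth_borel_measurable[OF smooth_divergence[OF assms(2)]] smooth_borel_measurable[OF sm] in auto)
    finally show ?thesis .
  qed
  then show ?thesis
    unfolding is_weak_div_def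
    by (intro conjI ballI loc_integrable_continuous smooth_continuous_on[OF assms(2)]
        smooth_continuous_on[OF smooth_divergence[OF assms(2)]])
qed

text \<open>Integrability on compact subsets gives measurability on each of the countably many
  closed boxes that exhaust the open set, and measurability is a piecewise property.\<close>

lemma loc_integrable_measurable:
  fixes f :: "'a::euclidean_space \<Rightarrow> 'b::euclidean_space"
  assumes "open \<Omega>" "loc_integrable \<Omega> f"
  shows "f \<in> borel_measurable (lebesgue_on \<Omega>)"
proof -
  obtain \<D> where \<D>: "countable \<D>" "\<D> \<subseteq> Pow \<Omega>" "\<And>X. X \<in> \<D> \<Longrightarrow> \<exists>a b. X = cbox a b" "\<Union>\<D> = \<Omega>"
    using open_countable_Union_open_cbox[OF assms(1)] by metis
  show ?thesis
  proof (rule measurable_piecewise_restrict)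
    show "countable \<D>" by (rule \<D>(1))
    show "\<Omega>' \<inter> space (lebesgue_on \<Omega>) \<in> sets (lebesgue_on \<Omega>)" if "\<Omega>' \<in> \<D>" for \<Omega>'
      using \<D>(2,3) that assms(1) by (fastforce simp: sets_restrict_space_iff space_restrict_space)
    show "space (lebesgue_on \<Omega>) \<subseteq> \<Union>\<D>"
      using \<D>(4) by (simp add: space_restrict_space)
    show "f \<in> borel_measurable (restrict_space (lebesgue_on \<Omega>) X)" if X: "X \<in> \<D>" for X
    proof -
      obtain a b where ab: "X = cbox a b" using \<D>(3)[OF X] by auto
      have "X \<subseteq> \<Omega>" using X \<D>(2) by auto
      have "set_integrable lebesgue X f"
        using assms(2) \<open>X \<subseteq> \<Omega>\<close> ab unfolding loc_integrable_def by auto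
      then have "f \<in> borel_measurable (lebesgue_on X)"
        using ab by (subst borel_measurable_restrict_space_iff)
          (auto simp: set_integrable_def dest: borel_measurable_integrable)
      then show ?thesis
        using assms(1) \<open>X \<subseteq> \<Omega>\<close> by (simp add: restrict_restrict_space ab Int_absorb1)
    qed
  qed
qed

text \<open>The inner product lets one lemma serve vector fields against gradients and, through
  \<open>inner_real_def\<close>, scalar functions against test functions.\<close>

lemma loc_integrable_inner_test_function:
  fixes f \<Psi> :: "'a::euclidean_space \<Rightarrow> 'b::euclidean_space"
  assumes "open \<Omega>" "loc_integrable \<Omega> f" "\<Psi> \<in> test_functions \<Omega>"
  shows "integrable (lebesgue_on \<Omega>) (\<lambda>x. f x \<bullet> \<Psi> x)"
proof (rule test_functionsE[OF assms(3)])
  fix C assume C: "smooth \<Psi>" "compact C" "C \<subseteq> \<Omega>" "\<And>x. x \<notin> C \<Longrightarrow> \<Psi> x = 0"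
  obtain B where B: "\<And>x. norm (\<Psi> x) \<le> B"
    using test_functions_bounded[OF assms(3)] by metis
  have f: "integrable lebesgue (\<lambda>x. indicator C x *\<^sub>R f x)"
    using assms(2) C(2,3) unfolding loc_integrable_def set_integrable_def by simp
  have "integrable lebesgue (\<lambda>x. (indicator C x *\<^sub>R f x) \<bullet> \<Psi> x)"
  proof (rule Bochner_Integration.integrable_bound)
    show "integrable lebesgue (\<lambda>x. B *\<^sub>R (indicator C x *\<^sub>R f x))"
      by (rule integrable_scaleR_right[OF f])
    show "(\<lambda>x. (indicator C x *\<^sub>R f x) \<bullet> \<Psi> x) \<in> borel_measurable lebesgue"
    proof (rule borel_measurable_inner[OF borel_measurable_integrable[OF f]])
      show "\<Psi> \<in> borel_measurable lebesgue"
        using smooth_borel_measurable[OF C(1)] by (intro measurable_completion) simp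
    qed
    show "AE x in lebesgue. norm ((indicator C x *\<^sub>R f x) \<bullet> \<Psi> x) \<le> norm (B *\<^sub>R (indicator C x *\<^sub>R f x))"
    proof (rule AE_I2)
      fix x
      have "norm ((indicator C x *\<^sub>R f x) \<bullet> \<Psi> x) \<le> norm (indicator C x *\<^sub>R f x) * norm (\<Psi> x)"
        by (simp only: real_norm_def Cauchy_Schwarz_ineq2)
      also have "\<dots> \<le> norm (indicator C x *\<^sub>R f x) * \<bar>B\<bar>"
        using order_trans[OF B abs_ge_self] by (intro mult_left_mono) auto
      also have "\<dots> = norm (B *\<^sub>R (indicator C x *\<^sub>R f x))"
        by (simp only: norm_scaleR mult.commute)
      finally show "norm ((indicator C x *\<^sub>R f x) \<bullet> \<Psi> x) \<le> norm (B *\<^sub>R (indicator C x *\<^sub>R f x))" .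
    qed
  qed
  moreover have "(\<lambda>x. (indicator C x *\<^sub>R f x) \<bullet> \<Psi> x) = (\<lambda>x. indicator \<Omega> x *\<^sub>R (f x \<bullet> \<Psi> x))"
    using C(3,4) by (intro ext) (auto simp: indicator_def)
  ultimately have "integrable lebesgue (\<lambda>x. indicator \<Omega> x *\<^sub>R (f x \<bullet> \<Psi> x))"
    by (simp only:)
  then show ?thesis
    using assms(1) by (subst integrable_restrict_space) simp_all
qed

lemma loc_integrable_diff:
  assumes "loc_integrable \<Omega> f" "loc_integrable \<Omega> g"
  shows "loc_integrable \<Omega> (\<lambda>x. f x - g x)"
  unfolding loc_integrable_def
proof (intro allI impI)
  fix K assume "compact K \<and> K \<subseteq> \<Omega>"
  then show "set_integrable lebesgue K (\<lambda>x. f x - g x)"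
    using assms unfolding loc_integrable_def by (intro set_integral_diff(1)) simp_all
qed

text \<open>The difference of two candidates is annihilated by all test functions, so the
  fundamental lemma applies to its Borel representative over \<open>lborel\<close>. Together with
  existence this makes the choice in \<open>weak_div\<close> harmless: any weak divergence at hand
  may stand for it.\<close>

lemma is_weak_div_unique:
  fixes g :: "'a::euclidean_space \<Rightarrow> 'a"
  assumes "open \<Omega>" "is_weak_div \<Omega> g h1" "is_weak_div \<Omega> g h2"
  shows "AE x in lebesgue_on \<Omega>. h1 x = h2 x"
proof -
  note loc = is_weak_divD(2)[OF assms(2)] is_weak_divD(2)[OF assms(3)]
  let ?d = "\<lambda>x. h1 x - h2 x"
  have locd: "loc_integrable \<Omega> ?d"
    by (rule loc_integrable_diff[OF loc])
  obtain f where f: "f \<in> borel_measurable borel" "\<And>x. x \<notin> \<Omega> \<Longrightarrow> f x = 0"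
    "AE x in lebesgue. x \<in> \<Omega> \<longrightarrow> ?d x = f x"
    using borel_representative[OF assms(1) loc_integrable_measurable[OF assms(1) locd]] by metis
  have K: "integrable lborel (\<lambda>x. indicator K x * f x)" if "compact K" "K \<subseteq> \<Omega>" for K
  proof -
    have 1: "integrable lebesgue (\<lambda>x. indicator K x * ?d x)"
      using that locd by (auto simp: loc_integrable_def set_integrable_def)
    have 2: "(\<lambda>x. indicator K x * f x) \<in> borel_measurable borel"
      using compact_imp_closed[OF that(1)] f(1) by (intro borel_measurable_times borel_measurable_indicator) auto
    have "integrable lebesgue (\<lambda>x. indicator K x * f x)"
    proof (rule integrable_cong_AE_imp[OF 1])
      show "(\<lambda>x. indicator K x * f x) \<in> borel_measurable lebesgue"
        using 2 by (intro measurable_completion) simp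
      show "AE x in lebesgue. indicator K x * ?d x = indicator K x * f x"
        using f(3) by eventually_elim (use that(2) in \<open>auto simp: indicator_def\<close>)
    qed
    then show "integrable lborel (\<lambda>x. indicator K x * f x)"
      using 2 by (simp add: integrable_completion)
  qed
  have "AE x in lborel. x \<in> \<Omega> \<longrightarrow> f x = 0"
  proof (rule AE_zero_if_test_integrals_zero[OF _ assms(1) f(1)])
    fix \<psi> :: "'a \<Rightarrow> real" assume \<psi>: "\<psi> \<in> test_functions \<Omega>"
    show "(LINT x|lborel. \<psi> x * f x) = 0"
    proof -
      note int = loc_integrable_inner_test_function[OF assms(1) loc(1) \<psi>, unfolded inner_real_def]
        loc_integrable_inner_test_function[OF assms(1) loc(2) \<psi>, unfolded inner_real_def]
      have "(LINT x|lborel. \<psi> x * f x) = (LINT x|lebesgue_on \<Omega>. \<psi> x * f x)"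
        by (rule integral_lebesgue_on_eq_lborel(1)[OF assms(1), symmetric])
           (use f(1,2) smooth_borel_measurable[OF test_functions_smooth[OF \<psi>]] in auto)
      also have "\<dots> = (LINT x|lebesgue_on \<Omega>. h1 x * \<psi> x - h2 x * \<psi> x)"
      proof (rule integral_cong_AE)
        show "(\<lambda>x. \<psi> x * f x) \<in> borel_measurable (lebesgue_on \<Omega>)"
          using f(1) smooth_borel_measurable[OF test_functions_smooth[OF \<psi>]]
          by (intro borel_measurable_times measurable_restrict_space1 measurable_completion) auto
        show "(\<lambda>x. h1 x * \<psi> x - h2 x * \<psi> x) \<in> borel_measurable (lebesgue_on \<Omega>)"
          using int by (intro borel_measurable_diff) auto
        show "AE x in lebesgue_on \<Omega>. \<psi> x * f x = h1 x * \<psi> x - h2 x * \<psi> x"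
          unfolding AE_lebesgue_on_open[OF assms(1)] using f(3)
          by eventually_elim (auto simp: algebra_simps)
      qed
      also have "\<dots> = (LINT x|lebesgue_on \<Omega>. h1 x * \<psi> x) - (LINT x|lebesgue_on \<Omega>. h2 x * \<psi> x)"
        by (rule Bochner_Integration.integral_diff[OF int])
      also have "\<dots> = 0"
        using is_weak_divD(3)[OF assms(2) \<psi>] is_weak_divD(3)[OF assms(3) \<psi>] by simp
      finally show ?thesis .
    qed
  qed (simp_all add: K)
  then have "AE x in lebesgue. x \<in> \<Omega> \<longrightarrow> f x = 0"
    by (rule AE_completion)
  with f(3) have "AE x in lebesgue. x \<in> \<Omega> \<longrightarrow> h1 x = h2 x"
    by eventually_elim auto
  then show ?thesis
    unfolding AE_lebesgue_on_open[OF assms(1)] .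
qed


section \<open>Smooth approximation of fields up to the boundary\<close>

section \<open>Mollification\<close>

lemma lborel_affine_nn_integral:
  fixes f :: "'a::euclidean_space \<Rightarrow> ennreal"
  assumes [measurable]: "f \<in> borel_measurable borel" and c: "c \<noteq> 0"
  shows "(\<integral>\<^sup>+x. f x \<partial>lborel) = ennreal (\<bar>c\<bar> ^ DIM('a)) * (\<integral>\<^sup>+x. f (t + c *\<^sub>R x) \<partial>lborel)"
  by (subst lborel_affine[OF c, of t])
     (simp add: nn_integral_density nn_integral_distr nn_integral_cmult)

lemma lborel_affine_integrable:
  fixes f :: "'a::euclidean_space \<Rightarrow> 'b::{banach, second_countable_topology}"
  assumes f: "integrable lborel f" and c: "c \<noteq> 0"
  shows "integrable lborel (\<lambda>x. f (t + c *\<^sub>R x))"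
proof -
  have [measurable]: "f \<in> borel_measurable borel"
    using borel_measurable_integrable[OF f] by simp
  have "(\<integral>\<^sup>+x. ennreal (norm (f x)) \<partial>lborel) < \<infinity>"
    using f by (simp add: integrable_iff_bounded)
  then have "(\<integral>\<^sup>+x. ennreal (norm (f (t + c *\<^sub>R x))) \<partial>lborel) < \<infinity>"
    using c by (subst (asm) lborel_affine_nn_integral[OF _ c, of _ t]) (auto simp: ennreal_mult_less_top)
  then show ?thesis
    by (simp add: integrable_iff_bounded)
qed

lemma lborel_affine_integral:
  fixes f :: "'a::euclidean_space \<Rightarrow> 'b::{banach, second_countable_topology}"
  assumes [measurable]: "f \<in> borel_measurable borel" and c: "c \<noteq> 0"
  shows "(LINT x|lborel. f x) = (\<bar>c\<bar> ^ DIM('a)) *\<^sub>R (LINT x|lborel. f (t + c *\<^sub>R x))"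
  by (subst lborel_affine[OF c, of t])
     (simp add: integral_density integral_distr)

text \<open>The support is a cube rather than a ball, which is the shape of the smooth bumps; the
  displaced cubes in the geometric condition \<open>shifts_inside\<close> match it.\<close>

definition kernel :: "'a::euclidean_space \<Rightarrow> real" where
  "kernel x = bump (- One) One 1 x / (LINT y|lborel. bump (- One) (One :: 'a) 1 y)"

text \<open>A vanishing integral of a nonnegative function would make the box on which the bump is
  positive a null set, although it has volume 2^d.\<close>

lemma integral_bump_pos: "0 < (LINT y|lborel. bump (- One) (One :: 'a::euclidean_space) 1 y)"
proof -
  have int: "integrable lborel (bump (- One) (One :: 'a) 1)"
    by (rule test_functions_integrable_lborel[OF bump_test_function[of 1 _ _ UNIV]]) auto
  have "(LINT y|lborel. bump (- One) (One :: 'a) 1 y) \<noteq> 0"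
  proof
    assume "(LINT y|lborel. bump (- One) (One :: 'a) 1 y) = 0"
    then have "AE y in lborel. bump (- One) (One :: 'a) 1 y = 0"
      by (subst (asm) integral_nonneg_eq_0_iff_AE[OF int]) (auto intro!: AE_I2 bump_bounds)
    then have "AE y in lborel. y \<notin> box (- One) (One :: 'a)"
      by eventually_elim (use bump_pos[of 1] in force)
    then have "box (- One) (One :: 'a) \<in> null_sets lborel"
      by (subst (asm) AE_iff_null_sets[symmetric]) auto
    then have "emeasure lborel (box (- One) (One :: 'a)) = 0" by auto
    then show False
    proof -
      have "(One - - One :: 'a) \<bullet> b = 2" if "b \<in> Basis" for b
        using that by (simp add: inner_add_left)
      then have "emeasure lborel (box (- One) (One :: 'a)) = ennreal (\<Prod>b\<in>(Basis :: 'a set). 2)"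
        by (subst emeasure_lborel_box) (auto intro!: prod.cong simp del: prod_constant)
      moreover have "(0::real) < 2 ^ DIM('a)" by simp
      ultimately have "emeasure lborel (box (- One) (One :: 'a)) \<noteq> 0"
        by (simp add: ennreal_eq_0_iff del: zero_less_power)
      with \<open>emeasure lborel (box (- One) (One :: 'a)) = 0\<close> show False
        by simp
    qed
  qed
  moreover have "0 \<le> (LINT y|lborel. bump (- One) (One :: 'a) 1 y)"
    by (intro Bochner_Integration.integral_nonneg bump_bounds)
  ultimately show ?thesis by simp
qed

lemma kernel_nonneg: "0 \<le> kernel x"
  unfolding kernel_def by (rule divide_nonneg_nonneg[OF bump_bounds(1) less_imp_le[OF integral_bump_pos]])

lemma kernel_eq_0: "x \<notin> cbox (- One) One \<Longrightarrow> kernel x = 0"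
  using box_subset_cbox[of "- One" One] by (auto simp: kernel_def intro!: bump_eq_0)

lemma kernel_test_function: "kernel \<in> test_functions UNIV"
proof -
  have "kernel = (\<lambda>x::'a. (1 / (LINT y|lborel. bump (- One) (One :: 'a) 1 y)) * bump (- One) One 1 x)"
    by (auto simp: kernel_def)
  then show ?thesis
    using test_functions_bounded_linear[OF bump_test_function[of 1 "- One" "One :: 'a" UNIV]
        bounded_linear_mult_right[of "1 / (LINT y|lborel. bump (- One) (One :: 'a) 1 y)"]]
    by simp
qed

lemma kernel_smooth: "smooth kernel"
  by (rule test_functions_smooth[OF kernel_test_function])

lemma kernel_measurable [measurable]: "kernel \<in> borel_measurable borel"
  by (rule smooth_borel_measurable[OF kernel_smooth])

lemma kernel_integrable: "integrable lborel kernel"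
  by (rule test_functions_integrable_lborel[OF kernel_test_function])

lemma kernel_integral: "(LINT x|lborel. kernel (x::'a::euclidean_space)) = 1"
  using integral_bump_pos[where 'a='a] by (simp add: kernel_def)

lemma kernel_nn_integral: "(\<integral>\<^sup>+x. ennreal (kernel (x::'a::euclidean_space)) \<partial>lborel) = 1"
  by (simp add: nn_integral_eq_integral kernel_integrable kernel_nonneg kernel_integral)

lemma kernel_bounded:
  obtains B where "B > 0" "\<And>x. kernel x \<le> B"
proof -
  obtain B where "B > 0" "\<And>x::'a. norm (kernel x) \<le> B"
    using test_functions_bounded[OF kernel_test_function] by metis
  then have "kernel x \<le> B" for x :: 'a
    using abs_le_D1 by auto
  with \<open>B > 0\<close> show thesis by (rule that)
qed

text \<open>A weighted average over the cube of side 2 e around x + e a: the displacement scales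
  with the size of the cube, so that a fixed \<open>a\<close> keeps the cube away from the boundary
  for all small e. Integrating over the reference cube leaves the weight independent of e; the
  convolution form used for differentiation comes later.\<close>

definition mollify :: "real \<Rightarrow> 'a::euclidean_space \<Rightarrow> ('a \<Rightarrow> 'b::euclidean_space) \<Rightarrow> 'a \<Rightarrow> 'b" where
  "mollify e a f x = (LINT y|lborel. kernel y *\<^sub>R f (x + e *\<^sub>R (a + y)))"

lemma integrable_kernel_scaleR:
  fixes g :: "'a::euclidean_space \<Rightarrow> 'b::euclidean_space"
  assumes "integrable lborel g"
  shows "integrable lborel (\<lambda>y. kernel y *\<^sub>R g y)"
proof -
  obtain B where B: "B > 0" "\<And>x::'a. kernel x \<le> B" using kernel_bounded[where 'a='a] by metis
  show ?thesis
  proof (rule Bochner_Integration.integrable_bound[of _ "\<lambda>y. B *\<^sub>R g y"])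
    show "integrable lborel (\<lambda>y. B *\<^sub>R g y)" using assms by simp
    show "(\<lambda>y. kernel y *\<^sub>R g y) \<in> borel_measurable lborel"
      using borel_measurable_integrable[OF assms] by simp
    show "AE y in lborel. norm (kernel y *\<^sub>R g y) \<le> norm (B *\<^sub>R g y)"
      using B(2) abs_of_pos[OF B(1)] by (intro AE_I2) (simp add: mult_right_mono abs_of_nonneg[OF kernel_nonneg])
  qed
qed

lemma integrable_mollify_integrand:
  fixes f :: "'a::euclidean_space \<Rightarrow> 'b::euclidean_space"
  assumes "integrable lborel f" "e > 0"
  shows "integrable lborel (\<lambda>y. kernel y *\<^sub>R f (x + e *\<^sub>R (a + y)))"
proof -
  have "integrable lborel (\<lambda>y. f ((x + e *\<^sub>R a) + e *\<^sub>R y))"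
    by (rule lborel_affine_integrable) (use assms in auto)
  then show ?thesis
    by (intro integrable_kernel_scaleR) (simp add: scaleR_add_right add.assoc)
qed

lemma mollify_diff:
  fixes f g :: "'a::euclidean_space \<Rightarrow> 'b::euclidean_space"
  assumes "integrable lborel f" "integrable lborel g" "e > 0"
  shows "mollify e a (\<lambda>x. f x - g x) x = mollify e a f x - mollify e a g x"
  unfolding mollify_def scaleR_diff_right
  by (rule Bochner_Integration.integral_diff[OF integrable_mollify_integrand integrable_mollify_integrand])
     (use assms in auto)

lemma mollify_add:
  fixes f g :: "'a::euclidean_space \<Rightarrow> 'b::euclidean_space"
  assumes "integrable lborel f" "integrable lborel g" "e > 0"
  shows "mollify e a (\<lambda>x. f x + g x) x = mollify e a f x + mollify e a g x"
  unfolding mollify_def scaleR_add_right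
  by (rule Bochner_Integration.integral_add[OF integrable_mollify_integrand[unfolded scaleR_add_right]
        integrable_mollify_integrand[unfolded scaleR_add_right]])
     (use assms in auto)

lemma mollify_measurable [measurable]:
  fixes f :: "'a::euclidean_space \<Rightarrow> 'b::euclidean_space"
  assumes [measurable]: "f \<in> borel_measurable borel"
  shows "mollify e a f \<in> borel_measurable borel"
proof -
  have "(\<lambda>x. LINT y|lborel. kernel y *\<^sub>R f (x + e *\<^sub>R (a + y))) \<in> borel_measurable borel"
    by measurable
  then show ?thesis
    by (simp add: mollify_def[abs_def])
qed

lemma norm_mollify_le:
  fixes f :: "'a::euclidean_space \<Rightarrow> 'b::euclidean_space"
  assumes "integrable lborel f" "e > 0"
  shows "norm (mollify e a f x) \<le> (LINT y|lborel. kernel y * norm (f (x + e *\<^sub>R (a + y))))"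
proof -
  have "norm (mollify e a f x) \<le> (LINT y|lborel. norm (kernel y *\<^sub>R f (x + e *\<^sub>R (a + y))))"
    unfolding mollify_def by (rule integral_norm_bound)
  then show ?thesis
    by (simp add: kernel_nonneg)
qed

text \<open>An average with weights of total mass 1. An almost everywhere bound on f suffices for a
  bound at every x, which is what the comparison on sets of Lebesgue measure zero requires.\<close>

lemma norm_mollify_le_bound:
  fixes f :: "'a::euclidean_space \<Rightarrow> 'b::euclidean_space"
  assumes f: "integrable lborel f" and e: "e > 0" and M: "AE x in lborel. norm (f x) \<le> M"
  shows "norm (mollify e a f x) \<le> M"
proof -
  have [measurable]: "f \<in> borel_measurable borel"
    using borel_measurable_integrable[OF f] by simp
  \<comment> \<open>Lebesgue measure is a rescaled image of itself under the affine map, so for each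
    fixed x the bound passes from points z to reference points y.\<close>
  have "AE y in lborel. norm (f ((x + e *\<^sub>R a) + e *\<^sub>R y)) \<le> M"
  proof -
    have "AE z in density (distr lborel borel (\<lambda>y. (x + e *\<^sub>R a) + e *\<^sub>R y)) (\<lambda>_. \<bar>e\<bar> ^ DIM('a)). norm (f z) \<le> M"
      using M e by (subst lborel_affine[symmetric]) auto
    then show ?thesis
      using e by (simp add: AE_density AE_distr_iff)
  qed
  then have ae: "AE y in lborel. kernel y * norm (f (x + e *\<^sub>R (a + y))) \<le> kernel y * M"
    by eventually_elim (auto intro!: mult_left_mono kernel_nonneg simp: scaleR_add_right add.assoc)
  have "(LINT y|lborel. kernel y * norm (f (x + e *\<^sub>R (a + y)))) \<le> (LINT y|lborel. kernel (y::'a) * M)"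
  proof (rule integral_mono_AE[OF _ _ ae])
    show "integrable lborel (\<lambda>y. kernel y * norm (f (x + e *\<^sub>R (a + y))))"
      using integrable_norm[OF integrable_mollify_integrand[OF f e, of x a]] by (simp add: kernel_nonneg)
    show "integrable lborel (\<lambda>y::'a. kernel y * M)"
      by (simp add: kernel_integrable)
  qed
  then show ?thesis
    using norm_mollify_le[OF f e, of a x] by (simp add: kernel_integral)
qed

section \<open>Convergence of mollifications in Lebesgue spaces\<close>

text \<open>The graph of t^q lies above its tangent at s. After rearrangement this is Young's
  inequality with exponents q and q / (q - 1) for the factors t and s^(q-1).\<close>

lemma powr_tangent:
  fixes q s t :: real
  assumes "1 \<le> q" "0 \<le> s" "0 \<le> t"
  shows "q * (t * s powr (q - 1)) \<le> t powr q + (q - 1) * s powr q"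
proof (cases "q = 1")
  case True
  \<comment> \<open>For q = 1 the conjugate exponent degenerates, and s = 0 stands apart because
    \<open>0 powr 0\<close> is 0.\<close>
  then show ?thesis using assms by (cases "s = 0") auto
next
  case False
  then have q: "q > 1" using assms by simp
  have "t * s powr (q - 1) \<le> t powr q / q + (s powr (q - 1)) powr (q / (q - 1)) / (q / (q - 1))"
    using q assms by (intro Youngs_inequality) (auto simp: field_simps)
  also have "(s powr (q - 1)) powr (q / (q - 1)) = s powr q"
    using q by (simp add: powr_powr)
  finally have "q * (t * s powr (q - 1)) \<le> q * (t powr q / q + s powr q / (q / (q - 1)))"
    using q by (intro mult_left_mono) auto
  also have "\<dots> = t powr q + (q - 1) * s powr q"
    using q by (simp add: field_simps)
  finally show ?thesis .
qed

text \<open>The tangent inequality, taken at the mean value s and integrated against the weight w;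
  as w has mass 1, the multiples (q - 1) s^q cancel up to a single s^q.\<close>

lemma jensen_powr:
  fixes w g :: "'a \<Rightarrow> real"
  assumes "1 \<le> q" "\<And>x. 0 \<le> w x" "\<And>x. 0 \<le> g x" "integrable M w" "(LINT x|M. w x) = 1"
    "integrable M (\<lambda>x. w x * g x)" "integrable M (\<lambda>x. w x * g x powr q)"
  shows "(LINT x|M. w x * g x) powr q \<le> (LINT x|M. w x * g x powr q)"
proof -
  define s where "s = (LINT x|M. w x * g x)"
  have s: "s \<ge> 0"
    unfolding s_def using assms by (intro Bochner_Integration.integral_nonneg) auto
  have "(LINT x|M. (q * s powr (q - 1)) * (w x * g x)) \<le> (LINT x|M. w x * g x powr q + ((q - 1) * s powr q) * w x)"
  proof (rule integral_mono)
    show "(q * s powr (q - 1)) * (w x * g x) \<le> w x * g x powr q + ((q - 1) * s powr q) * w x" for x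
      using mult_left_mono[OF powr_tangent[OF assms(1) s assms(3)[of x]] assms(2)[of x]]
      by (simp add: algebra_simps)
  qed (use assms in auto)
  then have "q * s powr (q - 1) * s \<le> (LINT x|M. w x * g x powr q) + (q - 1) * s powr q"
    using assms by (simp add: s_def)
  moreover have "s powr (q - 1) * s = s powr q"
  proof (cases "s = 0")
    case False
    then show ?thesis using s powr_add[of s "q - 1" 1] by simp
  qed (use assms in simp)
  ultimately have "q * s powr q \<le> (LINT x|M. w x * g x powr q) + (q - 1) * s powr q"
    by (simp add: mult.assoc)
  then show ?thesis
    by (simp add: s_def algebra_simps)
qed

text \<open>The q-th power of the L^q norm, with values in \<open>ennreal\<close> so that Fubini and
  monotonicity apply before integrability is known.\<close>

definition Lq_mass :: "real \<Rightarrow> ('a::euclidean_space \<Rightarrow> 'b::euclidean_space) \<Rightarrow> ennreal" where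
  "Lq_mass q f = (\<integral>\<^sup>+x. ennreal (norm (f x) powr q) \<partial>lborel)"

lemma Lq_mass_finite:
  "f \<in> borel_measurable borel \<Longrightarrow> Lq_mass q f < \<infinity> \<longleftrightarrow> integrable lborel (\<lambda>x. norm (f x) powr q)"
  by (simp add: Lq_mass_def integrable_iff_bounded)

text \<open>Jensen's inequality with the kernel as weight, then Fubini: for each fixed y the inner
  integral is the mass of a translate. The bound is uniform in e and a, which makes density
  arguments possible.\<close>

lemma Lq_mass_mollify_le:
  fixes f :: "'a::euclidean_space \<Rightarrow> 'b::euclidean_space"
  assumes q: "1 \<le> q" and f: "integrable lborel f" "integrable lborel (\<lambda>x. norm (f x) powr q)" and e: "e > 0"
  shows "Lq_mass q (mollify e a f) \<le> Lq_mass q f"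
proof -
  have [measurable]: "f \<in> borel_measurable borel"
    using borel_measurable_integrable[OF f(1)] by simp
  have pt: "ennreal (norm (mollify e a f x) powr q) \<le>
      (\<integral>\<^sup>+y. ennreal (kernel y) * ennreal (norm (f (x + e *\<^sub>R (a + y))) powr q) \<partial>lborel)" for x
  proof -
    have i: "integrable lborel (\<lambda>y. kernel y * norm (f (x + e *\<^sub>R (a + y))) powr q)"
      using integrable_mollify_integrand[OF f(2) e, of x a] by simp
    have "norm (mollify e a f x) powr q \<le> (LINT y|lborel. kernel y * norm (f (x + e *\<^sub>R (a + y)))) powr q"
      using q norm_mollify_le[OF f(1) e, of a x] by (intro powr_mono2) auto
    also have "\<dots> \<le> (LINT y|lborel. kernel y * norm (f (x + e *\<^sub>R (a + y))) powr q)"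
      using integrable_norm[OF integrable_mollify_integrand[OF f(1) e, of x a]] i
      by (intro jensen_powr) (auto simp: q kernel_nonneg kernel_integrable kernel_integral)
    finally have "ennreal (norm (mollify e a f x) powr q) \<le> ennreal (LINT y|lborel. kernel y * norm (f (x + e *\<^sub>R (a + y))) powr q)"
      by (rule ennreal_leI)
    also have "\<dots> = (\<integral>\<^sup>+y. ennreal (kernel y * norm (f (x + e *\<^sub>R (a + y))) powr q) \<partial>lborel)"
      using i by (subst nn_integral_eq_integral) (auto simp: kernel_nonneg)
    finally show ?thesis
      by (simp add: ennreal_mult kernel_nonneg)
  qed
  have "Lq_mass q (mollify e a f) \<le>
      (\<integral>\<^sup>+x. \<integral>\<^sup>+y. ennreal (kernel y) * ennreal (norm (f (x + e *\<^sub>R (a + y))) powr q) \<partial>lborel \<partial>lborel)"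
    unfolding Lq_mass_def by (intro nn_integral_mono pt)
  also have "\<dots> = (\<integral>\<^sup>+y. \<integral>\<^sup>+x. ennreal (kernel y) * ennreal (norm (f (x + e *\<^sub>R (a + y))) powr q) \<partial>lborel \<partial>lborel)"
    by (rule lborel_pair.Fubini'[symmetric]) simp
  also have "\<dots> = (\<integral>\<^sup>+y. ennreal (kernel (y::'a)) * Lq_mass q f \<partial>lborel)"
  proof (rule nn_integral_cong)
    fix y :: 'a
    have "(\<integral>\<^sup>+x. ennreal (norm (f (x + e *\<^sub>R (a + y))) powr q) \<partial>lborel) = Lq_mass q f"
      unfolding Lq_mass_def
      using lborel_affine_nn_integral[of "\<lambda>x. ennreal (norm (f x) powr q)" 1 "e *\<^sub>R (a + y)"]
      by (simp add: add.commute)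
    then show "(\<integral>\<^sup>+x. ennreal (kernel y) * ennreal (norm (f (x + e *\<^sub>R (a + y))) powr q) \<partial>lborel) = ennreal (kernel y) * Lq_mass q f"
      by (subst nn_integral_cmult) auto
  qed
  also have "\<dots> = Lq_mass q f"
    by (simp add: nn_integral_multc kernel_nn_integral)
  finally show ?thesis .
qed

text \<open>A sum of three terms is at most three times the largest, whence the factor 3^q. Three is
  the number of errors when a function is compared with its mollification by way of an
  approximant.\<close>

lemma Lq_mass_add3:
  fixes f g h k :: "'a::euclidean_space \<Rightarrow> 'b::euclidean_space"
  assumes q: "1 \<le> q" and [measurable]: "f \<in> borel_measurable borel" "g \<in> borel_measurable borel" "h \<in> borel_measurable borel"
    and k: "\<And>x. norm (k x) \<le> norm (f x) + norm (g x) + norm (h x)"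
  shows "Lq_mass q k \<le> ennreal (3 powr q) * (Lq_mass q f + Lq_mass q g + Lq_mass q h)"
proof -
  have "norm (k x) powr q \<le> 3 powr q * (norm (f x) powr q + norm (g x) powr q + norm (h x) powr q)" for x
  proof -
    define m where "m = max (norm (f x)) (max (norm (g x)) (norm (h x)))"
    have "norm (k x) \<le> 3 * m" using k[of x] by (auto simp: m_def)
    then have "norm (k x) powr q \<le> (3 * m) powr q" using q by (intro powr_mono2) auto
    also have "\<dots> = 3 powr q * m powr q" by (intro powr_mult)
    also have "\<dots> \<le> 3 powr q * (norm (f x) powr q + norm (g x) powr q + norm (h x) powr q)"
      by (intro mult_left_mono) (auto simp: m_def max_def)
    finally show ?thesis .
  qed
  then have "Lq_mass q k \<le> (\<integral>\<^sup>+x. ennreal (3 powr q) * (ennreal (norm (f x) powr q) + ennreal (norm (g x) powr q) + ennreal (norm (h x) powr q)) \<partial>lborel)"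
    unfolding Lq_mass_def by (intro nn_integral_mono) (simp add: ennreal_mult[symmetric] flip: ennreal_plus)
  also have "\<dots> = ennreal (3 powr q) * (Lq_mass q f + Lq_mass q g + Lq_mass q h)"
    unfolding Lq_mass_def by (simp add: nn_integral_cmult nn_integral_add)
  finally show ?thesis .
qed

definition Lq_mollifiable :: "real \<Rightarrow> 'a \<Rightarrow> ('a::euclidean_space \<Rightarrow> 'b::euclidean_space) \<Rightarrow> bool" where
  "Lq_mollifiable q a f \<longleftrightarrow>
     (\<forall>\<delta>>0. eventually (\<lambda>e. Lq_mass q (\<lambda>x. mollify e a f x - f x) < ennreal \<delta>) (at_right 0))"

text \<open>Since mollification is a contraction, the functions recovered by it form a closed set: J
  f - f splits into J (f - g), J g - g and g - f.\<close>

lemma Lq_mollifiable_approx: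
  fixes f :: "'a::euclidean_space \<Rightarrow> 'b::euclidean_space"
  assumes q: "1 \<le> q" and f: "integrable lborel f" "integrable lborel (\<lambda>x. norm (f x) powr q)"
    and approx: "\<And>\<delta>. \<delta> > 0 \<Longrightarrow> \<exists>g. integrable lborel g \<and> integrable lborel (\<lambda>x. norm (g x) powr q) \<and>
      Lq_mass q (\<lambda>x. f x - g x) < ennreal \<delta> \<and> Lq_mollifiable q a g"
  shows "Lq_mollifiable q a f"
  unfolding Lq_mollifiable_def
proof (intro allI impI)
  fix \<delta> :: real assume "\<delta> > 0"
  \<comment> \<open>Three errors below d, multiplied by the factor 3^q of
    \<open>Lq_mass_add3\<close>, add up to \<delta>.\<close>
  define d where "d = \<delta> / (3 * 3 powr q)"
  have d: "d > 0" using \<open>\<delta> > 0\<close> by (simp add: d_def)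
  obtain g where g: "integrable lborel g" "integrable lborel (\<lambda>x. norm (g x) powr q)"
      "Lq_mass q (\<lambda>x. f x - g x) < ennreal d" "Lq_mollifiable q a g"
    using approx[OF d] by blast
  have [measurable]: "f \<in> borel_measurable borel" "g \<in> borel_measurable borel"
    using borel_measurable_integrable[OF f(1)] borel_measurable_integrable[OF g(1)] by simp_all
  have dq: "integrable lborel (\<lambda>x. norm (f x - g x) powr q)"
    using g(3) by (subst Lq_mass_finite[symmetric]) (auto intro: less_trans)
  have "eventually (\<lambda>e. Lq_mass q (\<lambda>x. mollify e a g x - g x) < ennreal d) (at_right 0)"
    using g(4) d unfolding Lq_mollifiable_def by blast
  moreover have "eventually (\<lambda>e. e > (0::real)) (at_right 0)"
    by (rule eventually_at_right_less)
  ultimately show "eventually (\<lambda>e. Lq_mass q (\<lambda>x. mollify e a f x - f x) < ennreal \<delta>) (at_right 0)"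
  proof eventually_elim
    case (elim e)
    have "Lq_mass q (\<lambda>x. mollify e a f x - f x) \<le> ennreal (3 powr q) *
       (Lq_mass q (mollify e a (\<lambda>x. f x - g x)) + Lq_mass q (\<lambda>x. mollify e a g x - g x) + Lq_mass q (\<lambda>x. f x - g x))"
    proof (rule Lq_mass_add3[OF q])
      fix x
      have "mollify e a f x - f x = mollify e a (\<lambda>x. f x - g x) x + (mollify e a g x - g x) - (f x - g x)"
        using mollify_diff[OF f(1) g(1) elim(2), of a x] by simp
      then show "norm (mollify e a f x - f x) \<le> norm (mollify e a (\<lambda>x. f x - g x) x) + norm (mollify e a g x - g x) + norm (f x - g x)"
        using norm_triangle_ineq4[of "mollify e a (\<lambda>x. f x - g x) x + (mollify e a g x - g x)" "f x - g x"]
          norm_triangle_ineq[of "mollify e a (\<lambda>x. f x - g x) x" "mollify e a g x - g x"] by simp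
    qed measurable
    also have "\<dots> \<le> ennreal (3 powr q) * (Lq_mass q (\<lambda>x. f x - g x) + Lq_mass q (\<lambda>x. mollify e a g x - g x) + Lq_mass q (\<lambda>x. f x - g x))"
      by (intro mult_left_mono add_mono Lq_mass_mollify_le[OF q _ dq elim(2)] order_refl) (use f g in auto)
    also have "\<dots> \<le> ennreal (3 powr q) * (ennreal d + Lq_mass q (\<lambda>x. mollify e a g x - g x) + ennreal d)"
      using g(3) by (intro mult_left_mono add_mono) auto
    also have "\<dots> < ennreal (3 powr q) * (ennreal d + ennreal d + ennreal d)"
    proof (rule ennreal_mult_strict_left_mono)
      show "ennreal d + Lq_mass q (\<lambda>x. mollify e a g x - g x) + ennreal d < ennreal d + ennreal d + ennreal d"
        using elim(1) d by (simp add: ennreal_add_left_cancel_less add.commute add.left_commute)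
    qed auto
    also have "\<dots> = ennreal \<delta>"
      using d by (simp add: ennreal_mult[symmetric] d_def flip: ennreal_plus)
    finally show ?case .
  qed
qed


lemma mollify_eq_const:
  fixes f :: "'a::euclidean_space \<Rightarrow> 'b::euclidean_space"
  assumes "\<And>y. y \<in> cbox (- One) One \<Longrightarrow> f (x + e *\<^sub>R (a + y)) = c"
  shows "mollify e a f x = c"
proof -
  have "kernel y *\<^sub>R f (x + e *\<^sub>R (a + y)) = kernel y *\<^sub>R c" for y
    using assms[of y] kernel_eq_0[of y] by (cases "y \<in> cbox (- One) One") auto
  then have "mollify e a f x = (LINT y|lborel. kernel (y::'a) *\<^sub>R c)"
    unfolding mollify_def by (simp only:)
  also have "\<dots> = c"
    by (simp add: integral_scaleR_left kernel_integrable kernel_integral)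
  finally show ?thesis .
qed

text \<open>A point of the reference cube has coordinates at most 1 in modulus, so
  \<open>DIM('a)\<close> bounds its l1 norm and therefore its norm.\<close>

lemma norm_shift_le:
  fixes a y :: "'a::euclidean_space"
  assumes "y \<in> cbox (- One) One" "0 \<le> e"
  shows "norm (e *\<^sub>R (a + y)) \<le> e * (norm a + DIM('a))"
proof -
  have "norm y \<le> (\<Sum>b\<in>Basis. \<bar>y \<bullet> b\<bar>)" by (rule norm_le_l1)
  also have "\<dots> \<le> (\<Sum>b\<in>(Basis::'a set). 1)"
    using assms(1) by (intro sum_mono) (auto simp: mem_box abs_le_iff minus_le_iff)
  finally have "norm y \<le> DIM('a)" by simp
  then have "norm (a + y) \<le> norm a + DIM('a)"
    by (metis add_left_mono norm_triangle_ineq order_trans)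
  then show ?thesis using assms(2) by (simp add: mult_left_mono)
qed

lemma eventually_shift_small:
  fixes a :: "'a::euclidean_space"
  assumes "r > 0"
  shows "eventually (\<lambda>e. e > 0 \<and> (\<forall>y\<in>cbox (- One) (One::'a). norm (e *\<^sub>R (a + y)) < r)) (at_right 0)"
proof -
  have "DIM('a) > 0" by simp
  then have p: "norm a + DIM('a) > 0" by (metis add_nonneg_pos norm_ge_zero of_nat_0_less_iff)
  have "eventually (\<lambda>e. 0 < e \<and> e < r / (norm a + DIM('a))) (at_right (0::real))"
    unfolding eventually_at_right_field
    by (rule exI[of _ "r / (norm a + DIM('a))"]) (simp add: p assms)
  then show ?thesis
  proof eventually_elim
    case (elim e)
    then have lt: "e * (norm a + DIM('a)) < r" using p by (simp add: pos_less_divide_eq)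
    have "norm (e *\<^sub>R (a + y)) < r" if "y \<in> cbox (- One) One" for y
      by (rule le_less_trans[OF norm_shift_le[OF that] lt]) (use elim in simp)
    then show ?case
      using elim by blast
  qed
qed

text \<open>|g - f| is twice the positive part of f - g minus f - g itself, and the integral of the
  subtracted term is nonnegative by the last assumption.\<close>

lemma Lq_mass_1_le_twice_pos_part:
  fixes f g :: "'a::euclidean_space \<Rightarrow> real"
  assumes "integrable lborel f" "integrable lborel g" "(LINT x|lborel. g x) \<le> (LINT x|lborel. f x)"
  shows "Lq_mass 1 (\<lambda>x. g x - f x) \<le> ennreal (2 * (LINT x|lborel. max 0 (f x - g x)))"
proof -
  have i: "integrable lborel (\<lambda>x. max 0 (f x - g x))" "integrable lborel (\<lambda>x. f x - g x)"
    using assms by auto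
  have "Lq_mass 1 (\<lambda>x. g x - f x) = ennreal (LINT x|lborel. \<bar>g x - f x\<bar>)"
    unfolding Lq_mass_def using assms by (simp add: nn_integral_eq_integral)
  also have "(LINT x|lborel. \<bar>g x - f x\<bar>) = (LINT x|lborel. 2 * max 0 (f x - g x) - (f x - g x))"
    by (rule Bochner_Integration.integral_cong) (auto simp: max_def)
  also have "\<dots> = 2 * (LINT x|lborel. max 0 (f x - g x)) - ((LINT x|lborel. f x) - (LINT x|lborel. g x))"
    using i assms by simp
  also have "ennreal \<dots> \<le> ennreal (2 * (LINT x|lborel. max 0 (f x - g x)))"
    using assms(3) by (intro ennreal_leI) simp
  finally show ?thesis .
qed

lemma mollify_nonneg:
  fixes f :: "'a::euclidean_space \<Rightarrow> real"
  shows "(\<And>x. 0 \<le> f x) \<Longrightarrow> 0 \<le> mollify e a f x"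
  unfolding mollify_def by (intro Bochner_Integration.integral_nonneg) (simp add: kernel_nonneg)

lemma mollify_integrable:
  fixes f :: "'a::euclidean_space \<Rightarrow> 'b::euclidean_space"
  assumes "integrable lborel f" "e > 0"
  shows "integrable lborel (mollify e a f)"
proof -
  have [measurable]: "f \<in> borel_measurable borel"
    using borel_measurable_integrable[OF assms(1)] by simp
  have "Lq_mass 1 (mollify e a f) \<le> Lq_mass 1 f"
    using assms by (intro Lq_mass_mollify_le) auto
  also have "\<dots> < \<infinity>"
    using assms by (simp add: Lq_mass_def integrable_iff_bounded)
  finally show ?thesis
    by (simp add: Lq_mass_def integrable_iff_bounded)
qed

text \<open>On an open set the indicator is the pointwise limit of its mollifications, and mollification
  does not increase its integral; hence it suffices to control the positive part of the error, which
  is dominated by the indicator.\<close>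

lemma Lq_mollifiable_indicator_open:
  fixes U :: "'a::euclidean_space set"
  assumes U: "open U" "emeasure lborel U < \<infinity>"
  shows "Lq_mollifiable 1 a (indicator U :: 'a \<Rightarrow> real)"
  unfolding Lq_mollifiable_def
proof (intro allI impI)
  fix \<delta> :: real assume \<delta>: "\<delta> > 0"
  let ?f = "indicator U :: 'a \<Rightarrow> real"
  have f: "integrable lborel ?f" using U by (simp add: integrable_indicator_iff)
  define D where "D = (\<lambda>e. LINT x|lborel. max 0 (?f x - mollify e a ?f x))"
  have "(D \<longlongrightarrow> (LINT x|(lborel :: 'a measure). (0::real))) (at_right 0)"
    unfolding D_def tendsto_at_iff_sequentially comp_def
  proof (intro allI impI)
    fix X :: "nat \<Rightarrow> real"
    assume X: "\<forall>i. X i \<in> {0<..} - {0}" "X \<longlonglongrightarrow> 0"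
    then have X': "filterlim X (at_right 0) sequentially"
      by (auto simp: filterlim_at less_imp_neq[symmetric])
    show "(\<lambda>n. LINT x|lborel. max 0 (?f x - mollify (X n) a ?f x)) \<longlonglongrightarrow> (LINT x|(lborel :: 'a measure). (0::real))"
    proof (rule integral_dominated_convergence[where w="?f"])
      show "AE x in lborel. (\<lambda>n. max 0 (?f x - mollify (X n) a ?f x)) \<longlonglongrightarrow> 0"
      proof (rule AE_I2)
        fix x
        show "(\<lambda>n. max 0 (?f x - mollify (X n) a ?f x)) \<longlonglongrightarrow> 0"
        proof (cases "x \<in> U")
          case True
          then obtain r where r: "r > 0" "ball x r \<subseteq> U"
            using U(1) by (auto simp: open_contains_ball)
          \<comment> \<open>Around a point of U the whole displaced cube lies in U for small e, so
            the mollification is exactly 1 there.\<close>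
          have "eventually (\<lambda>e. max 0 (?f x - mollify e a ?f x) = 0) (at_right 0)"
            using eventually_shift_small[OF r(1), of a]
          proof eventually_elim
            case (elim e)
            have "mollify e a ?f x = 1"
            proof (rule mollify_eq_const)
              fix y :: 'a assume "y \<in> cbox (- One) One"
              then have "x + e *\<^sub>R (a + y) \<in> ball x r" using elim by (auto simp: dist_norm)
              then show "?f (x + e *\<^sub>R (a + y)) = 1" using r(2) by (auto simp: indicator_def)
            qed
            then show ?case using True by simp
          qed
          then have "eventually (\<lambda>n. max 0 (?f x - mollify (X n) a ?f x) = 0) sequentially"
            by (rule eventually_compose_filterlim[OF _ X'])
          then show ?thesis by (rule tendsto_eventually)
        next
          case False
          have "0 \<le> mollify e a ?f x" for e by (rule mollify_nonneg) simp
          then have "max 0 (?f x - mollify (X n) a ?f x) = 0" for n using False by (auto simp: max_def intro: antisym)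
          then show ?thesis by simp
        qed
      qed
      show "AE x in lborel. norm (max 0 (?f x - mollify (X n) a ?f x)) \<le> ?f x" for n
      proof (rule AE_I2)
        fix x
        have "0 \<le> mollify (X n) a ?f x" by (rule mollify_nonneg) simp
        then show "norm (max 0 (?f x - mollify (X n) a ?f x)) \<le> ?f x" by (auto simp: max_def)
      qed
    qed (use f U(1) in auto)
  qed
  then have "eventually (\<lambda>e. D e < \<delta> / 2) (at_right 0)"
    using \<delta> order_tendstoD(2)[of D 0 "at_right 0" "\<delta> / 2"] by simp
  moreover have "eventually (\<lambda>e. e > (0::real)) (at_right 0)"
    by (rule eventually_at_right_less)
  ultimately show "eventually (\<lambda>e. Lq_mass 1 (\<lambda>x. mollify e a ?f x - ?f x) < ennreal \<delta>) (at_right 0)"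
  proof eventually_elim
    case (elim e)
    have m: "integrable lborel (mollify e a ?f)" by (rule mollify_integrable[OF f elim(2)])
    have "ennreal (LINT x|lborel. mollify e a ?f x) = Lq_mass 1 (mollify e a ?f)"
      unfolding Lq_mass_def using m mollify_nonneg[of ?f e a] by (simp add: nn_integral_eq_integral)
    also have "\<dots> \<le> Lq_mass 1 ?f" using f elim(2) by (intro Lq_mass_mollify_le) auto
    also have "\<dots> = ennreal (LINT x|lborel. ?f x)"
      unfolding Lq_mass_def using f nn_integral_eq_integral[OF f] by simp
    finally have "(LINT x|lborel. mollify e a ?f x) \<le> (LINT x|lborel. ?f x)"
      by (subst (asm) ennreal_le_iff) auto
    then have "Lq_mass 1 (\<lambda>x. mollify e a ?f x - ?f x) \<le> ennreal (2 * D e)"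
      unfolding D_def by (rule Lq_mass_1_le_twice_pos_part[OF f m])
    also have "\<dots> < ennreal \<delta>"
      using elim(1) \<delta> by (intro ennreal_lessI) auto
    finally show ?case .
  qed
qed

text \<open>Outer regularity: an open U above A exceeds it by a set of measure below \<delta>, and
  for q = 1 the mass of the difference of the indicators is just this measure.\<close>

lemma Lq_mollifiable_indicator:
  fixes A :: "'a::euclidean_space set"
  assumes A: "A \<in> sets lborel" "emeasure lborel A < \<infinity>"
  shows "Lq_mollifiable 1 a (indicator A :: 'a \<Rightarrow> real)"
proof (rule Lq_mollifiable_approx)
  show f: "integrable lborel (indicator A :: 'a \<Rightarrow> real)" using A by (simp add: integrable_indicator_iff)
  then show "integrable lborel (\<lambda>x. norm (indicator A x :: real) powr 1)" by simp
  fix \<delta> :: real assume \<delta>: "\<delta> > 0"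
  obtain U where U: "open U" "A \<subseteq> U" "U - A \<in> lmeasurable" "emeasure lebesgue (U - A) < ennreal \<delta>"
    using sets_lebesgue_outer_open[of A \<delta>] A \<delta> by auto
  have d: "emeasure lborel (U - A) < ennreal \<delta>"
    using U(1,4) A by simp
  have "emeasure lborel U = emeasure lborel A + emeasure lborel (U - A)"
    using U(1,2) A by (subst plus_emeasure) (auto simp: Un_absorb1)
  then have Uf: "emeasure lborel U < \<infinity>"
    using A d by (auto intro: less_trans)
  have "Lq_mass 1 (\<lambda>x. indicator A x - indicator U x :: real) = emeasure lborel (U - A)"
  proof -
    have "ennreal (norm (indicator A x - indicator U x :: real) powr 1) = indicator (U - A) x" for x
      using U(2) by (auto simp: indicator_def)
    then have "Lq_mass 1 (\<lambda>x. indicator A x - indicator U x :: real) = (\<integral>\<^sup>+x. indicator (U - A) x \<partial>lborel)"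
      unfolding Lq_mass_def by (simp only:)
    also have "\<dots> = emeasure lborel (U - A)"
      using U(1) A by (intro nn_integral_indicator) auto
    finally show ?thesis .
  qed
  then show "\<exists>g. integrable lborel g \<and> integrable lborel (\<lambda>x. norm (g x :: real) powr 1) \<and>
      Lq_mass 1 (\<lambda>x. indicator A x - g x) < ennreal \<delta> \<and> Lq_mollifiable 1 a g"
    using d U(1) Uf Lq_mollifiable_indicator_open[OF U(1) Uf, of a]
    by (intro exI[of _ "indicator U"]) (simp add: integrable_indicator_iff)
qed simp

text \<open>Dominated convergence with majorant C^q |f|^q. The constant C is open because it depends
  on how the approximants are built: 3 for those of the induction on integrable functions, 1 for
  truncations.\<close>

lemma Lq_mass_tendsto_0:
  fixes f :: "'a::euclidean_space \<Rightarrow> 'b::euclidean_space"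
  assumes [measurable]: "\<And>i. s i \<in> borel_measurable borel" "f \<in> borel_measurable borel"
    and q: "1 \<le> q" and lim: "\<And>x. (\<lambda>i. s i x) \<longlonglongrightarrow> f x"
    and bd: "\<And>i x. norm (f x - s i x) \<le> C * norm (f x)" and C: "C \<ge> 0"
    and f: "integrable lborel (\<lambda>x. norm (f x) powr q)" and \<delta>: "\<delta> > 0"
  shows "\<exists>i::nat. Lq_mass q (\<lambda>x. f x - s i x) < ennreal \<delta>"
proof -
  let ?h = "\<lambda>i x. norm (f x - s i x) powr q"
  have b: "?h i x \<le> C powr q * norm (f x) powr q" for i x
    using powr_mono2[of q "norm (f x - s i x)" "C * norm (f x)"] bd[of x i] q C by (simp add: powr_mult)
  have i: "integrable lborel (?h i)" for i
    by (rule Bochner_Integration.integrable_bound[of _ "\<lambda>x. C powr q * norm (f x) powr q"]) (use f b in auto)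
  have "(\<lambda>i. LINT x|lborel. ?h i x) \<longlonglongrightarrow> (LINT x|(lborel :: 'a measure). (0::real))"
  proof (rule integral_dominated_convergence[where w="\<lambda>x. C powr q * norm (f x) powr q"])
    show "AE x in lborel. (\<lambda>i. ?h i x) \<longlonglongrightarrow> 0"
    proof (rule AE_I2)
      fix x :: 'a
      have "(\<lambda>i. norm (f x - s i x)) \<longlonglongrightarrow> norm (f x - f x)"
        by (rule tendsto_norm[OF tendsto_diff[OF tendsto_const lim]])
      then have l: "(\<lambda>i. norm (f x - s i x)) \<longlonglongrightarrow> 0" by simp
      then show "(\<lambda>i. ?h i x) \<longlonglongrightarrow> 0"
        using tendsto_zero_powrI[OF l tendsto_const[of q]] q by simp
    qed
  qed (use f b in auto)
  then have "eventually (\<lambda>i. (LINT x|lborel. ?h i x) < \<delta>) sequentially"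
    using \<delta> order_tendstoD(2)[of "\<lambda>i. LINT x|lborel. ?h i x" 0 sequentially \<delta>] by simp
  then obtain k where "(LINT x|lborel. ?h k x) < \<delta>"
    by (auto simp: eventually_sequentially)
  moreover have "Lq_mass q (\<lambda>x. f x - s k x) = ennreal (LINT x|lborel. ?h k x)"
    unfolding Lq_mass_def using i by (intro nn_integral_eq_integral) auto
  ultimately show ?thesis
    using \<delta> by (intro exI[of _ k]) (simp add: ennreal_lessI)
qed

text \<open>Induction on integrable functions: vector multiples of indicators come from the scalar
  case, and the pointwise limits are covered by the closedness under L^1 approximation.\<close>

lemma Lq_mollifiable_1:
  fixes f :: "'a::euclidean_space \<Rightarrow> 'b::euclidean_space"
  assumes "integrable lborel f"
  shows "Lq_mollifiable 1 a f"
  using assms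
proof (induction rule: integrable_induct)
  case (base A c)
  let ?f = "indicator A :: 'a \<Rightarrow> real"
  have eq: "Lq_mass 1 (\<lambda>x. mollify e a (\<lambda>x. ?f x *\<^sub>R c) x - ?f x *\<^sub>R c) =
      ennreal (norm c) * Lq_mass 1 (\<lambda>x. mollify e a ?f x - ?f x)" if "e > 0" for e
  proof -
    have "integrable lborel ?f" using base by (simp add: integrable_indicator_iff)
    then have "mollify e a (\<lambda>x. ?f x *\<^sub>R c) x = mollify e a ?f x *\<^sub>R c" for x
      using integrable_mollify_integrand[of ?f e x a] that
      unfolding mollify_def by (simp flip: integral_scaleR_left)
    then have "norm (mollify e a (\<lambda>x. ?f x *\<^sub>R c) x - ?f x *\<^sub>R c) powr 1 = norm c * norm (mollify e a ?f x - ?f x) powr 1" for x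
      by (simp flip: scaleR_diff_left)
    then show ?thesis
      using base(1) unfolding Lq_mass_def by (simp only: ennreal_mult' norm_ge_zero) (simp add: nn_integral_cmult)
  qed
  show ?case
    unfolding Lq_mollifiable_def
  proof (intro allI impI)
    fix \<delta> :: real assume \<delta>: "\<delta> > 0"
    \<comment> \<open>Division by norm c + 1 also covers c = 0 and leaves a strict
      inequality.\<close>
    have "eventually (\<lambda>e. Lq_mass 1 (\<lambda>x. mollify e a ?f x - ?f x) < ennreal (\<delta> / (norm c + 1))) (at_right 0)"
      using Lq_mollifiable_indicator[OF base, of a] \<delta> unfolding Lq_mollifiable_def
      by (simp add: add_nonneg_pos)
    moreover have "eventually (\<lambda>e. e > (0::real)) (at_right 0)"
      by (rule eventually_at_right_less)
    ultimately show "eventually (\<lambda>e. Lq_mass 1 (\<lambda>x. mollify e a (\<lambda>x. ?f x *\<^sub>R c) x - ?f x *\<^sub>R c) < ennreal \<delta>) (at_right 0)"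
    proof eventually_elim
      case (elim e)
      have "ennreal (norm c) * Lq_mass 1 (\<lambda>x. mollify e a ?f x - ?f x) \<le> ennreal (norm c) * ennreal (\<delta> / (norm c + 1))"
        using elim(1) by (intro mult_left_mono) auto
      also have "\<dots> = ennreal (norm c * (\<delta> / (norm c + 1)))"
        by (rule ennreal_mult[symmetric]) (use \<delta> in auto)
      also have "\<dots> < ennreal \<delta>"
      proof (rule ennreal_lessI[OF \<delta>])
        have "norm c + 1 > 0" by (simp add: add_nonneg_pos)
        then show "norm c * (\<delta> / (norm c + 1)) < \<delta>"
          using \<delta> by (simp add: pos_divide_less_eq algebra_simps)
      qed
      finally show ?case using eq[OF elim(2)] by simp
    qed
  qed
next
  case (add f g)
  have [measurable]: "f \<in> borel_measurable borel" "g \<in> borel_measurable borel"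
    using borel_measurable_integrable[OF add(1)] borel_measurable_integrable[OF add(2)] by simp_all
  show ?case
    unfolding Lq_mollifiable_def
  proof (intro allI impI)
    fix \<delta> :: real assume \<delta>: "\<delta> > 0"
    \<comment> \<open>Two errors and the factor 3 from \<open>Lq_mass_add3\<close>, whose third slot
      is filled with the zero function, account for the 6.\<close>
    have "eventually (\<lambda>e. Lq_mass 1 (\<lambda>x. mollify e a f x - f x) < ennreal (\<delta> / 6)) (at_right 0)"
      "eventually (\<lambda>e. Lq_mass 1 (\<lambda>x. mollify e a g x - g x) < ennreal (\<delta> / 6)) (at_right 0)"
      using add(3,4) \<delta> unfolding Lq_mollifiable_def by simp_all
    moreover have "eventually (\<lambda>e. e > (0::real)) (at_right 0)"
      by (rule eventually_at_right_less)
    ultimately show "eventually (\<lambda>e. Lq_mass 1 (\<lambda>x. mollify e a (\<lambda>x. f x + g x) x - (f x + g x)) < ennreal \<delta>) (at_right 0)"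
    proof eventually_elim
      case (elim e)
      have "Lq_mass 1 (\<lambda>x. mollify e a (\<lambda>x. f x + g x) x - (f x + g x)) \<le> ennreal (3 powr 1) *
         (Lq_mass 1 (\<lambda>x. mollify e a f x - f x) + Lq_mass 1 (\<lambda>x. mollify e a g x - g x) + Lq_mass 1 (\<lambda>x::'a. 0 :: 'b))"
      proof (rule Lq_mass_add3)
        fix x
        have eq: "mollify e a (\<lambda>x. f x + g x) x - (f x + g x) = (mollify e a f x - f x) + (mollify e a g x - g x)"
          using mollify_add[OF add(1,2) elim(3), of a x] by simp
        show "norm (mollify e a (\<lambda>x. f x + g x) x - (f x + g x)) \<le>
            norm (mollify e a f x - f x) + norm (mollify e a g x - g x) + norm (0::'b)"
          unfolding eq using norm_triangle_ineq[of "mollify e a f x - f x" "mollify e a g x - g x"] by simp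
      qed auto
      also have "\<dots> \<le> ennreal 3 * (ennreal (\<delta> / 6) + Lq_mass 1 (\<lambda>x. mollify e a g x - g x))"
        using elim(1) by (auto intro!: mult_left_mono add_right_mono simp: Lq_mass_def)
      also have "\<dots> < ennreal 3 * (ennreal (\<delta> / 6) + ennreal (\<delta> / 6))"
        using elim(2) by (intro ennreal_mult_strict_left_mono) (auto simp: ennreal_add_left_cancel_less)
      also have "\<dots> = ennreal \<delta>"
        using \<delta> by (simp add: ennreal_mult[symmetric] flip: ennreal_plus ennreal_numeral)
      finally show ?case .
    qed
  qed
next
  case (lim f s)
  show ?case
  proof (rule Lq_mollifiable_approx)
    show "integrable lborel f" by (rule lim(4))
    then show "integrable lborel (\<lambda>x. norm (f x) powr 1)" by simp
    fix \<delta> :: real assume \<delta>: "\<delta> > 0"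
    have "\<exists>i. Lq_mass 1 (\<lambda>x. f x - s i x) < ennreal \<delta>"
    \<comment> \<open>The induction rule supplies approximants with |s_i| at most 2 |f|, hence |f -
      s_i| at most 3 |f|.\<close>
    proof (rule Lq_mass_tendsto_0[where C=3])
      show "s i \<in> borel_measurable borel" for i
        using borel_measurable_integrable[OF lim(1)[of i]] by simp
      show "f \<in> borel_measurable borel"
        using borel_measurable_integrable[OF lim(4)] by simp
      show "(\<lambda>i. s i x) \<longlonglongrightarrow> f x" for x
        using lim(2)[of x] by simp
      show "norm (f x - s i x) \<le> 3 * norm (f x)" for i x
        using lim(3)[of x i] norm_triangle_ineq4[of "f x" "s i x"] by simp
      show "integrable lborel (\<lambda>x. norm (f x) powr 1)" using lim(4) by simp
    qed (use \<delta> in auto)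
    then obtain i where i: "Lq_mass 1 (\<lambda>x. f x - s i x) < ennreal \<delta>" by blast
    show "\<exists>g. integrable lborel g \<and> integrable lborel (\<lambda>x. norm (g x) powr 1) \<and>
        Lq_mass 1 (\<lambda>x. f x - g x) < ennreal \<delta> \<and> Lq_mollifiable 1 a g"
      using i lim(1)[of i] lim(5)[of i] by (intro exI[of _ "s i"]) simp
  qed simp
qed

text \<open>The error is at most 2 M everywhere, so its q-th power is at most (2 M)^(q-1) times the
  error itself, and L^1 convergence suffices.\<close>

lemma Lq_mollifiable_bounded:
  fixes f :: "'a::euclidean_space \<Rightarrow> 'b::euclidean_space"
  assumes q: "1 \<le> q" and f: "integrable lborel f" and M: "\<And>x. norm (f x) \<le> M" "M > 0"
  shows "Lq_mollifiable q a f"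
  unfolding Lq_mollifiable_def
proof (intro allI impI)
  fix \<delta> :: real assume \<delta>: "\<delta> > 0"
  have [measurable]: "f \<in> borel_measurable borel"
    using borel_measurable_integrable[OF f] by simp
  define c where "c = (2 * M) powr (q - 1)"
  have c: "c > 0" using M by (simp add: c_def)
  have "eventually (\<lambda>e. Lq_mass 1 (\<lambda>x. mollify e a f x - f x) < ennreal (\<delta> / c)) (at_right 0)"
    using Lq_mollifiable_1[OF f, of a] \<delta> c unfolding Lq_mollifiable_def by simp
  moreover have "eventually (\<lambda>e. e > (0::real)) (at_right 0)"
    by (rule eventually_at_right_less)
  ultimately show "eventually (\<lambda>e. Lq_mass q (\<lambda>x. mollify e a f x - f x) < ennreal \<delta>) (at_right 0)"
  proof eventually_elim
    case (elim e)
    have pt: "norm (mollify e a f x - f x) powr q \<le> c * norm (mollify e a f x - f x)" for x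
    proof (cases "mollify e a f x - f x = 0")
      case False
      let ?t = "norm (mollify e a f x - f x)"
      have "?t \<le> norm (mollify e a f x) + norm (f x)" by (rule norm_triangle_ineq4)
      moreover have "norm (mollify e a f x) \<le> M"
        by (rule norm_mollify_le_bound[OF f elim(2)]) (simp add: M(1))
      ultimately have "?t \<le> 2 * M"
        using M(1)[of x] by linarith
      then have "?t powr (q - 1) \<le> c"
        unfolding c_def using q by (intro powr_mono2) auto
      moreover have "?t powr q = ?t powr (q - 1) * ?t"
        using False powr_add[of ?t "q - 1" 1] by simp
      ultimately show ?thesis using mult_right_mono[of _ c ?t] by simp
    qed simp
    have "Lq_mass q (\<lambda>x. mollify e a f x - f x) \<le> (\<integral>\<^sup>+x. ennreal c * ennreal (norm (mollify e a f x - f x) powr 1) \<partial>lborel)"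
      unfolding Lq_mass_def using pt c by (intro nn_integral_mono) (simp add: ennreal_mult[symmetric] ennreal_leI)
    also have "\<dots> = ennreal c * Lq_mass 1 (\<lambda>x. mollify e a f x - f x)"
      unfolding Lq_mass_def by (rule nn_integral_cmult) simp
    also have "\<dots> < ennreal c * ennreal (\<delta> / c)"
      using elim(1) c by (intro ennreal_mult_strict_left_mono) auto
    also have "\<dots> = ennreal \<delta>"
      using c \<delta> by (simp add: ennreal_mult[symmetric])
    finally show ?case .
  qed
qed

text \<open>Setting f to zero where it exceeds i in norm gives bounded functions that approximate it
  in L^q, and these are treated by comparison with L^1.\<close>

theorem Lq_mollifiable:
  fixes f :: "'a::euclidean_space \<Rightarrow> 'b::euclidean_space"
  assumes q: "1 \<le> q" and f: "integrable lborel f" "integrable lborel (\<lambda>x. norm (f x) powr q)"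
  shows "Lq_mollifiable q a f"
proof (rule Lq_mollifiable_approx[OF q f])
  fix \<delta> :: real assume \<delta>: "\<delta> > 0"
  have [measurable]: "f \<in> borel_measurable borel"
    using borel_measurable_integrable[OF f(1)] by simp
  let ?s = "\<lambda>(i::nat) x. indicator {x. norm (f x) \<le> real i} x *\<^sub>R f x"
  have s [measurable]: "?s i \<in> borel_measurable borel" for i
    by measurable
  have sn: "norm (?s i x) \<le> norm (f x)" for i x by (auto simp: indicator_def)
  have "\<exists>i. Lq_mass q (\<lambda>x. f x - ?s i x) < ennreal \<delta>"
  proof (rule Lq_mass_tendsto_0[where C=1])
    show "(\<lambda>i. ?s i x) \<longlonglongrightarrow> f x" for x
    proof -
      obtain m :: nat where "norm (f x) \<le> real m" using real_arch_simple by blast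
      then have "eventually (\<lambda>i. ?s i x = f x) sequentially"
        by (auto simp: eventually_sequentially intro!: exI[of _ m])
      then show ?thesis by (rule tendsto_eventually)
    qed
    show "norm (f x - ?s i x) \<le> 1 * norm (f x)" for i x by (auto simp: indicator_def)
  qed (use q f \<delta> in auto)
  then obtain i where i: "Lq_mass q (\<lambda>x. f x - ?s i x) < ennreal \<delta>" by blast
  have s1: "integrable lborel (?s i)"
    by (rule Bochner_Integration.integrable_bound[OF f(1)]) (use sn in auto)
  have s2: "integrable lborel (\<lambda>x. norm (?s i x) powr q)"
    by (rule Bochner_Integration.integrable_bound[OF f(2)]) (use sn q in \<open>auto intro!: AE_I2 powr_mono2\<close>)
  \<comment> \<open>The bound must be positive, hence i + 1 instead of i.\<close>
  have s3: "Lq_mollifiable q a (?s i)"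
    by (rule Lq_mollifiable_bounded[OF q s1, of "real i + 1"]) (auto simp: indicator_def)
  show "\<exists>g. integrable lborel g \<and> integrable lborel (\<lambda>x. norm (g x) powr q) \<and>
      Lq_mass q (\<lambda>x. f x - g x) < ennreal \<delta> \<and> Lq_mollifiable q a g"
    by (rule exI[of _ "?s i"], intro conjI s1 s2 s3 i)
qed


section \<open>Smoothness of mollifications\<close>

text \<open>The directional derivatives are Lipschitz as test functions, so the derivative varies by
  at most a multiple of norm h on a ball of radius norm h. The constant does not depend on the
  point, so that the estimate can be integrated.\<close>

lemma test_functions_taylor:
  fixes K :: "'a::euclidean_space \<Rightarrow> real"
  assumes "K \<in> test_functions \<Omega>"
  obtains C where "C \<ge> 0" "\<And>w h. \<bar>K (w + h) - K w - frechet_derivative K (at w) h\<bar> \<le> C * (norm h)\<^sup>2"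
proof -
  note sm = test_functions_smooth[OF assms]
  let ?D = "\<lambda>w. frechet_derivative K (at w)"
  have "\<exists>B>0. \<forall>x y. \<bar>?D x b - ?D y b\<bar> \<le> B * norm (x - y)" for b
    using test_functions_derivative_bounded[OF test_functions_frechet_derivative[OF assms, of b]] real_norm_def by metis
  then obtain B where B: "\<And>b. B b > 0" "\<And>b x y. \<bar>?D x b - ?D y b\<bar> \<le> B b * norm (x - y)"
    by metis
  let ?C = "sum B (Basis :: 'a set)"
  have lip: "\<bar>?D x v - ?D y v\<bar> \<le> ?C * norm (x - y) * norm v" for x y v
  proof -
    have "?D x v - ?D y v = (\<Sum>b\<in>Basis. (v \<bullet> b) * (?D x b - ?D y b))"
      unfolding frechet_derivative_basis_expansion[OF sm, of x v] frechet_derivative_basis_expansion[OF sm, of y v]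
      by (simp add: sum_subtractf right_diff_distrib)
    also have "\<bar>\<dots>\<bar> \<le> (\<Sum>b\<in>Basis. norm v * (B b * norm (x - y)))"
    proof (rule order_trans[OF sum_abs], rule sum_mono)
      fix b :: 'a assume "b \<in> Basis"
      then show "\<bar>(v \<bullet> b) * (?D x b - ?D y b)\<bar> \<le> norm v * (B b * norm (x - y))"
        unfolding abs_mult using B(2) Basis_le_norm by (intro mult_mono) auto
    qed
    also have "\<dots> = ?C * norm (x - y) * norm v"
      by (simp add: sum_distrib_left sum_distrib_right mult_ac)
    finally show ?thesis .
  qed
  have "\<bar>K (w + h) - K w - ?D w h\<bar> \<le> ?C * (norm h)\<^sup>2" for w h
  proof -
    have "norm (K (w + h) - K w - ?D w ((w + h) - w)) \<le> norm ((w + h) - w) * (?C * norm h)"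
    proof (rule differentiable_bound_linearization[of w "w + h" "cball w (norm h)" K ?D])
      show "w + t *\<^sub>R (w + h - w) \<in> cball w (norm h)" if "t \<in> {0..1}" for t
        using that by (simp add: dist_norm mult_left_le_one_le)
      show "(K has_derivative ?D x) (at x within cball w (norm h))" for x
        by (rule has_derivative_at_withinI[OF smooth_has_derivative[OF sm]])
      show "onorm (?D x - ?D w) \<le> ?C * norm h" if "x \<in> cball w (norm h)" for x
        unfolding fun_diff_def
      proof (rule onorm_le)
        fix v :: 'a
        have "norm (x - w) \<le> norm h"
          using that unfolding mem_cball dist_norm norm_minus_commute[of w x] by simp
        then have "?C * norm (x - w) * norm v \<le> ?C * norm h * norm v"
          using B(1) by (intro mult_right_mono mult_left_mono sum_nonneg) (auto intro: less_imp_le)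
        with lip[of x v w] show "norm (?D x v - ?D w v) \<le> ?C * norm h * norm v" by simp
      qed
    qed simp
    then show ?thesis by (simp add: power2_eq_square mult_ac)
  qed
  moreover have "?C \<ge> 0" using B(1) by (intro sum_nonneg) (auto intro: less_imp_le)
  ultimately show thesis using that by blast
qed

lemma integrable_test_function_scaleR:
  fixes f :: "'a::euclidean_space \<Rightarrow> 'b::euclidean_space" and K :: "'a \<Rightarrow> real"
  assumes "K \<in> test_functions \<Omega>" "integrable lborel f"
  shows "integrable lborel (\<lambda>z. K (z - x) *\<^sub>R f z)"
proof -
  obtain B where B: "B > 0" "\<And>x. norm (K x) \<le> B"
    using test_functions_bounded[OF assms(1)] by metis
  have [measurable]: "K \<in> borel_measurable borel" "f \<in> borel_measurable borel"
    using smooth_borel_measurable[OF test_functions_smooth[OF assms(1)]] borel_measurable_integrable[OF assms(2)]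
    by simp_all
  show ?thesis
  proof (rule Bochner_Integration.integrable_bound[of _ "\<lambda>z. B *\<^sub>R f z"])
    show "AE z in lborel. norm (K (z - x) *\<^sub>R f z) \<le> norm (B *\<^sub>R f z)"
      using B by (intro AE_I2) (simp add: mult_right_mono)
  qed (use assms in auto)
qed

text \<open>Differentiation under the integral sign with an explicit remainder: Taylor's estimate is
  uniform in z, so the error is at most C (norm h)^2 times the L^1 norm of f. The minus sign arises
  because x enters as z - x.\<close>

lemma convolution_has_derivative:
  fixes f :: "'a::euclidean_space \<Rightarrow> 'b::euclidean_space" and K :: "'a \<Rightarrow> real"
  assumes K: "K \<in> test_functions \<Omega>" and f: "integrable lborel f"
  shows "((\<lambda>x. LINT z|lborel. K (z - x) *\<^sub>R f z) has_derivative
      (\<lambda>v. LINT z|lborel. (- frechet_derivative K (at (z - x)) v) *\<^sub>R f z)) (at x)"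
    (is "(?F has_derivative ?F') (at x)")
proof -
  let ?D = "\<lambda>w. frechet_derivative K (at w)"
  have lin: "linear (?D w)" for w
    using has_derivative_bounded_linear[OF smooth_has_derivative[OF test_functions_smooth[OF K]]]
    by (rule bounded_linear.linear)
  have i: "integrable lborel (\<lambda>z. K (z - y) *\<^sub>R f z)" for y
    by (rule integrable_test_function_scaleR[OF K f])
  have i': "integrable lborel (\<lambda>z. ?D (z - x) v *\<^sub>R f z)" for v
    by (rule integrable_test_function_scaleR[OF test_functions_frechet_derivative[OF K] f])
  obtain B where B: "B > 0" "\<And>w v. norm (?D w v) \<le> B * norm v"
    using test_functions_derivative_bounded[OF K] by metis
  obtain C where C: "C \<ge> 0" "\<And>w h. \<bar>K (w + h) - K w - ?D w h\<bar> \<le> C * (norm h)\<^sup>2"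
    using test_functions_taylor[OF K] by metis
  define N where "N = (LINT z|lborel. norm (f z))"
  have bl: "bounded_linear ?F'"
  proof (rule bounded_linear_intro[of _ "B * N"])
    show "?F' (v + w) = ?F' v + ?F' w" for v w
    proof -
      have "?F' (v + w) = (LINT z|lborel. - (?D (z - x) v *\<^sub>R f z) + - (?D (z - x) w *\<^sub>R f z))"
        by (simp add: linear_add[OF lin] scaleR_add_left scaleR_diff_left)
      also have "\<dots> = ?F' v + ?F' w"
        using i' by (subst Bochner_Integration.integral_add) simp_all
      finally show ?thesis .
    qed
    show "?F' (r *\<^sub>R v) = r *\<^sub>R ?F' v" for r v
      using i' by (simp add: linear_scale[OF lin] flip: scaleR_scaleR)
    show "norm (?F' v) \<le> norm v * (B * N)" for v
    proof -
      have "norm (?F' v) \<le> (LINT z|lborel. (B * norm v) * norm (f z))"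
        by (rule Bochner_Integration.integral_norm_bound_integral)
           (use i'[of v] f B in \<open>auto intro!: mult_right_mono\<close>)
      then show ?thesis by (simp add: N_def mult_ac)
    qed
  qed
  have est: "norm (?F (x + h) - ?F x - ?F' h) / norm h \<le> C * N * norm h" for h
  proof -
    have "?F (x + h) - ?F x - ?F' h = (LINT z|lborel. K (z - (x + h)) *\<^sub>R f z - K (z - x) *\<^sub>R f z + ?D (z - x) h *\<^sub>R f z)"
      using i i'[of h] by simp
    also have "\<dots> = (LINT z|lborel. (K ((z - x) + (- h)) - K (z - x) - ?D (z - x) (- h)) *\<^sub>R f z)"
      by (rule Bochner_Integration.integral_cong)
         (auto simp: linear_neg[OF lin] scaleR_diff_left scaleR_add_left diff_diff_eq)
    also have "norm \<dots> \<le> (LINT z|lborel. (C * (norm h)\<^sup>2) * norm (f z))"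
    proof (rule Bochner_Integration.integral_norm_bound_integral)
      show "integrable lborel (\<lambda>z. (K ((z - x) + (- h)) - K (z - x) - ?D (z - x) (- h)) *\<^sub>R f z)"
        using i[of "x + h"] i[of x] i'[of "- h"] unfolding scaleR_diff_left
        by (intro Bochner_Integration.integrable_diff) (simp_all add: diff_diff_eq)
      show "norm ((K ((z - x) + (- h)) - K (z - x) - ?D (z - x) (- h)) *\<^sub>R f z) \<le> (C * (norm h)\<^sup>2) * norm (f z)" for z
        using C(2)[of "z - x" "- h"] by (simp add: mult_right_mono)
    qed (use f in auto)
    finally have "norm (?F (x + h) - ?F x - ?F' h) \<le> C * N * norm h * norm h"
      by (simp add: N_def power2_eq_square mult_ac)
    moreover have "C * N * norm h \<ge> 0"
      using C(1) by (auto simp: N_def intro!: mult_nonneg_nonneg Bochner_Integration.integral_nonneg)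
    ultimately show ?thesis
      by (cases "h = 0") (simp_all add: pos_divide_le_eq)
  qed
  have "((\<lambda>h. norm (?F (x + h) - ?F x - ?F' h) / norm h) \<longlongrightarrow> 0) (at 0)"
  proof (rule tendsto_sandwich[of "\<lambda>_. 0" _ _ "\<lambda>h. C * N * norm h"])
    show "eventually (\<lambda>h. norm (?F (x + h) - ?F x - ?F' h) / norm h \<le> C * N * norm h) (at 0)"
      by (rule always_eventually) (rule allI, rule est)
    have "((\<lambda>h::'a. norm h) \<longlongrightarrow> 0) (at 0)"
      by (rule tendsto_norm_zero[OF tendsto_ident_at])
    then show "((\<lambda>h::'a. C * N * norm h) \<longlongrightarrow> 0) (at 0)"
      by (rule tendsto_mult_right_zero)
  qed auto
  with bl show ?thesis
    by (simp only: has_derivative_at)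
qed

lemma test_functions_uminus:
  fixes K :: "'a::euclidean_space \<Rightarrow> 'b::real_normed_vector"
  shows "K \<in> test_functions \<Omega> \<Longrightarrow> (\<lambda>x. - K x) \<in> test_functions \<Omega>"
  by (rule test_functions_bounded_linear[OF _ bounded_linear_minus[OF bounded_linear_ident]])

text \<open>A derivative of the convolution with K is the convolution with minus a directional
  derivative of K, again a test function; the induction therefore runs over all kernels at
  once.\<close>

lemma C_k_convolution:
  fixes f :: "'a::euclidean_space \<Rightarrow> 'b::euclidean_space" and K :: "'a \<Rightarrow> real"
  assumes "K \<in> test_functions \<Omega>" and f: "integrable lborel f"
  shows "C_k k (\<lambda>x. LINT z|lborel. K (z - x) *\<^sub>R f z)"
  using assms(1)
proof (induction k arbitrary: K)
  case 0
  show ?case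
    unfolding C_k.simps(1)
    by (rule has_derivative_continuous_on[OF has_derivative_at_withinI[OF convolution_has_derivative[OF 0 f]]])
next
  case (Suc k)
  show ?case
    by (rule C_k_SucI[OF convolution_has_derivative[OF Suc.prems f]])
       (rule Suc.IH[OF test_functions_uminus[OF test_functions_frechet_derivative[OF Suc.prems]]])
qed

lemma smooth_convolution:
  fixes f :: "'a::euclidean_space \<Rightarrow> 'b::euclidean_space" and K :: "'a \<Rightarrow> real"
  assumes "K \<in> test_functions \<Omega>" "integrable lborel f"
  shows "smooth (\<lambda>x. LINT z|lborel. K (z - x) *\<^sub>R f z)"
  unfolding smooth_def by (rule allI, rule C_k_convolution[OF assms])

text \<open>The weight of \<open>mollify\<close> in terms of w = z - x, where z = x + e (a + y); the
  factor is the Jacobian of this substitution.\<close>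

definition scaled_kernel :: "real \<Rightarrow> 'a::euclidean_space \<Rightarrow> 'a \<Rightarrow> real" where
  "scaled_kernel e a w = (1 / e ^ DIM('a)) * kernel ((1 / e) *\<^sub>R w - a)"

lemma scaled_kernel_eq_0:
  fixes a z :: "'a::euclidean_space"
  assumes "e > 0" "z \<notin> (\<lambda>y. x + e *\<^sub>R (a + y)) ` cbox (- One) One"
  shows "scaled_kernel e a (z - x) = 0"
proof -
  have "z = x + e *\<^sub>R (a + ((1 / e) *\<^sub>R (z - x) - a))"
    using assms(1) by simp
  with assms(2) have "(1 / e) *\<^sub>R (z - x) - a \<notin> cbox (- One) One" by blast
  then show ?thesis by (simp add: scaled_kernel_def kernel_eq_0)
qed

text \<open>The support is the displaced cube belonging to x. When this cube lies in \<Omega>, the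
  translated kernel may be inserted into the definition of the weak divergence.\<close>

lemma scaled_kernel_shift_test_function:
  fixes a x :: "'a::euclidean_space"
  assumes "e > 0" "\<And>y. y \<in> cbox (- One) (One::'a) \<Longrightarrow> x + e *\<^sub>R (a + y) \<in> \<Omega>"
  shows "(\<lambda>z. scaled_kernel e a (z - x)) \<in> test_functions \<Omega>"
proof (rule test_functionsI)
  have "smooth (\<lambda>z::'a. kernel ((1 / e) *\<^sub>R z + (- (1 / e) *\<^sub>R x - a)))"
    by (rule smooth_comp_affine[OF bounded_linear_scaleR_right kernel_smooth])
  then have "smooth (\<lambda>z::'a. (1 / e ^ DIM('a)) * kernel ((1 / e) *\<^sub>R z + (- (1 / e) *\<^sub>R x - a)))"
    by (rule smooth_mult[OF smooth_const])
  moreover have "(\<lambda>z. scaled_kernel e a (z - x)) =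
      (\<lambda>z::'a. (1 / e ^ DIM('a)) * kernel ((1 / e) *\<^sub>R z + (- (1 / e) *\<^sub>R x - a)))"
    by (intro ext) (simp add: scaled_kernel_def algebra_simps)
  ultimately show "smooth (\<lambda>z. scaled_kernel e a (z - x))" by (simp only:)
  show "compact ((\<lambda>y. x + e *\<^sub>R (a + y)) ` cbox (- One) One)"
    by (intro compact_continuous_image continuous_intros compact_cbox)
  show "(\<lambda>y. x + e *\<^sub>R (a + y)) ` cbox (- One) One \<subseteq> \<Omega>"
    using assms(2) by blast
  show "scaled_kernel e a (z - x) = 0" if "z \<notin> (\<lambda>y. x + e *\<^sub>R (a + y)) ` cbox (- One) One" for z
    by (rule scaled_kernel_eq_0[OF assms(1) that])
qed

lemma scaled_kernel_test_function:
  fixes a :: "'a::euclidean_space"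
  assumes "e > 0"
  shows "scaled_kernel e a \<in> test_functions UNIV"
  using scaled_kernel_shift_test_function[OF assms, of 0 a UNIV] by simp

lemma mollify_eq_convolution:
  fixes f :: "'a::euclidean_space \<Rightarrow> 'b::euclidean_space"
  assumes "e > 0" and [measurable]: "f \<in> borel_measurable borel"
  shows "mollify e a f = (\<lambda>x. LINT z|lborel. scaled_kernel e a (z - x) *\<^sub>R f z)"
proof
  fix x
  have [measurable]: "scaled_kernel e a \<in> borel_measurable borel"
    by (rule smooth_borel_measurable[OF test_functions_smooth[OF scaled_kernel_test_function[OF assms(1)]]])
  have "(LINT z|lborel. scaled_kernel e a (z - x) *\<^sub>R f z) =
      (\<bar>e\<bar> ^ DIM('a)) *\<^sub>R (LINT y|lborel. scaled_kernel e a ((x + e *\<^sub>R a + e *\<^sub>R y) - x) *\<^sub>R f (x + e *\<^sub>R a + e *\<^sub>R y))"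
    using assms(1) by (intro lborel_affine_integral) auto
  also have "\<dots> = (LINT y|lborel. \<bar>e\<bar> ^ DIM('a) *\<^sub>R (scaled_kernel e a ((x + e *\<^sub>R a + e *\<^sub>R y) - x) *\<^sub>R f (x + e *\<^sub>R a + e *\<^sub>R y)))"
    by (rule integral_scaleR_right[symmetric])
  also have "\<dots> = mollify e a f x"
    unfolding mollify_def
  proof (rule Bochner_Integration.integral_cong[OF refl])
    fix y :: 'a
    have "(1 / e) *\<^sub>R ((x + e *\<^sub>R a + e *\<^sub>R y) - x) - a = y"
      using assms(1) by (simp add: scaleR_add_right)
    then show "\<bar>e\<bar> ^ DIM('a) *\<^sub>R (scaled_kernel e a ((x + e *\<^sub>R a + e *\<^sub>R y) - x) *\<^sub>R f (x + e *\<^sub>R a + e *\<^sub>R y)) =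
        kernel y *\<^sub>R f (x + e *\<^sub>R (a + y))"
      using assms(1) by (simp add: scaled_kernel_def scaleR_add_right add.assoc)
  qed
  finally show "mollify e a f x = (LINT z|lborel. scaled_kernel e a (z - x) *\<^sub>R f z)" by simp
qed

lemma smooth_mollify:
  fixes f :: "'a::euclidean_space \<Rightarrow> 'b::euclidean_space"
  assumes "e > 0" "integrable lborel f"
  shows "smooth (mollify e a f)"
proof -
  have "f \<in> borel_measurable borel" using borel_measurable_integrable[OF assms(2)] by simp
  then show ?thesis
    by (subst mollify_eq_convolution[OF assms(1)])
       (assumption, rule smooth_convolution[OF scaled_kernel_test_function[OF assms(1)] assms(2)])
qed

text \<open>Differentiating K(z - x) in x is minus differentiating it in z, so the divergence at x
  is minus the integral of g against the gradient of a translated kernel. The geometric hypothesis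
  concerns the one point x only, so it can be verified locally.\<close>

lemma divergence_mollify:
  fixes g :: "'a::euclidean_space \<Rightarrow> 'a" and h :: "'a \<Rightarrow> real"
  assumes e: "e > 0" and g: "integrable lborel g" and h: "h \<in> borel_measurable borel"
    and wd: "\<And>\<psi>. \<psi> \<in> test_functions \<Omega> \<Longrightarrow> (LINT x|lborel. g x \<bullet> gradient \<psi> x) = - (LINT x|lborel. h x * \<psi> x)"
    and x: "\<And>y. y \<in> cbox (- One) (One::'a) \<Longrightarrow> x + e *\<^sub>R (a + y) \<in> \<Omega>"
  shows "divergence (mollify e a g) x = mollify e a h x"
proof -
  let ?K = "scaled_kernel e a"
  note T = scaled_kernel_test_function[OF e, of a]
  have gm: "g \<in> borel_measurable borel" using borel_measurable_integrable[OF g] by simp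
  have "frechet_derivative (mollify e a g) (at x) = (\<lambda>v. LINT z|lborel. (- frechet_derivative ?K (at (z - x)) v) *\<^sub>R g z)"
    unfolding mollify_eq_convolution[OF e gm]
    by (rule sym, rule frechet_derivative_at, rule convolution_has_derivative[OF T g])
  moreover have i: "integrable lborel (\<lambda>z. (- frechet_derivative ?K (at (z - x)) b) *\<^sub>R g z)" for b
    by (rule integrable_test_function_scaleR[OF test_functions_uminus[OF test_functions_frechet_derivative[OF T]] g])
  ultimately have "divergence (mollify e a g) x =
      (\<Sum>b\<in>Basis. (LINT z|lborel. ((- frechet_derivative ?K (at (z - x)) b) *\<^sub>R g z) \<bullet> b))"
    unfolding divergence_def by (simp only: integral_inner_left)
  also have "\<dots> = (LINT z|lborel. (\<Sum>b\<in>Basis. ((- frechet_derivative ?K (at (z - x)) b) *\<^sub>R g z) \<bullet> b))"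
    by (rule Bochner_Integration.integral_sum[symmetric], rule integrable_inner_left, rule i)
  also have "\<dots> = (LINT z|lborel. - (g z \<bullet> gradient (\<lambda>z. ?K (z - x)) z))"
  proof (rule Bochner_Integration.integral_cong[OF refl])
    fix z
    have "((\<lambda>z. ?K (z - x)) has_derivative (\<lambda>v. frechet_derivative ?K (at (z - x)) v)) (at z)"
      by (rule has_derivative_compose[of "\<lambda>z. z - x" _ _ _ ?K, OF _ smooth_has_derivative[OF test_functions_smooth[OF T]]])
         (auto intro!: derivative_eq_intros)
    then have "frechet_derivative (\<lambda>z. ?K (z - x)) (at z) = frechet_derivative ?K (at (z - x))"
      by (rule frechet_derivative_at[symmetric])
    then show "(\<Sum>b\<in>Basis. ((- frechet_derivative ?K (at (z - x)) b) *\<^sub>R g z) \<bullet> b) = - (g z \<bullet> gradient (\<lambda>z. ?K (z - x)) z)"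
      by (simp add: gradient_def inner_sum_right sum_negf)
  qed
  also have "\<dots> = (LINT z|lborel. h z * ?K (z - x))"
    using wd[OF scaled_kernel_shift_test_function[OF e x]] by simp
  also have "\<dots> = mollify e a h x"
    unfolding mollify_eq_convolution[OF e h] by (simp add: mult.commute)
  finally show ?thesis .
qed

section \<open>Mollification at Lebesgue points\<close>

text \<open>The displaced cube lies in a ball around x of comparable size and the scaled kernel is
  at most B / e^d, so the error is dominated by the mean deviation from c over that ball. The value
  c is independent of g, since the point value belongs to the original field and g will be its Borel
  representative.\<close>

lemma mollify_lebesgue_point:
  fixes g :: "'a::euclidean_space \<Rightarrow> 'b::euclidean_space"
  assumes g: "integrable lborel g"
    and lp: "((\<lambda>r. (LINT y|lborel. indicator (ball x r) y * norm (g y - c)) / measure lborel (ball x r)) \<longlongrightarrow> 0) (at_right 0)"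
  shows "((\<lambda>e. mollify e a g x) \<longlongrightarrow> c) (at_right 0)"
proof -
  \<comment> \<open>In units of e, the cube lies within distance norm a + d of x; the extra 1 puts
    it strictly inside an open ball.\<close>
  define R where "R = norm a + DIM('a) + 1"
  have R: "R > 0" by (simp add: R_def add_nonneg_pos)
  obtain B where B: "B > 0" "\<And>x::'a. kernel x \<le> B" using kernel_bounded[where 'a='a] by metis
  \<comment> \<open>The volume of a ball of radius R, which is the ratio of the volume of the ball
    of radius R e to e^d.\<close>
  define w where "w = R ^ DIM('a) * measure lborel (ball (0::'a) 1)"
  let ?A = "\<lambda>r. (LINT y|lborel. indicator (ball x r) y * norm (g y - c)) / measure lborel (ball x r)"
  have [measurable]: "g \<in> borel_measurable borel" using borel_measurable_integrable[OF g] by simp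
  have est: "norm (mollify e a g x - c) \<le> B * w * ?A (R * e)" if e: "e > 0" for e
  proof -
    let ?K = "\<lambda>z. scaled_kernel e a (z - x)"
    have T: "?K \<in> test_functions UNIV" by (rule scaled_kernel_shift_test_function[OF e]) simp
    have iK: "integrable lborel ?K" by (rule test_functions_integrable_lborel[OF T])
    have iKg: "integrable lborel (\<lambda>z. ?K z *\<^sub>R g z)"
      by (rule integrable_test_function_scaleR[OF scaled_kernel_test_function[OF e] g])
    have K1: "(LINT z|lborel. ?K z) = 1"
    proof -
      \<comment> \<open>The total mass of the scaled kernel is read off from the mollification of
        the constant 1.\<close>
      have "mollify e a (\<lambda>_::'a. 1::real) x = 1" by (rule mollify_eq_const) simp
      then show ?thesis by (simp add: mollify_eq_convolution[OF e])
    qed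
    have ball: "measure lborel (ball x (R * e)) = (R * e) ^ DIM('a) * measure lborel (ball (0::'a) 1)"
      using R e content_ball[of "R * e" x] content_ball[of 1 "0::'a"] by simp
    have pos: "measure lborel (ball (0::'a) 1) > 0"
      using content_ball_pos[of 1 "0::'a"] by simp
    have ib: "integrable lborel (\<lambda>y. indicator (ball x (R * e)) y *\<^sub>R (g y - c))"
    proof -
      have "integrable lborel (\<lambda>y. indicator (ball x (R * e)) y *\<^sub>R g y)"
        using g by (intro integrable_mult_indicator) auto
      moreover have "integrable lborel (\<lambda>y. indicator (ball x (R * e)) y *\<^sub>R c)"
        by (intro integrable_scaleR_left) (use emeasure_bounded_finite[OF bounded_ball, of x "R * e"] in \<open>simp add: integrable_indicator_iff\<close>)
      ultimately show ?thesis by (simp add: scaleR_diff_right)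
    qed
    have "mollify e a g x - c = (LINT z|lborel. ?K z *\<^sub>R (g z - c))"
      using iK iKg K1 unfolding scaleR_diff_right
      by (subst Bochner_Integration.integral_diff) (auto simp: mollify_eq_convolution[OF e])
    also have "norm \<dots> \<le> (LINT z|lborel. (B / e ^ DIM('a)) * (indicator (ball x (R * e)) z * norm (g z - c)))"
    proof (rule Bochner_Integration.integral_norm_bound_integral)
      show "integrable lborel (\<lambda>z. ?K z *\<^sub>R (g z - c))"
        unfolding scaleR_diff_right using iK iKg by (intro Bochner_Integration.integrable_diff integrable_scaleR_left)
      show "integrable lborel (\<lambda>z. (B / e ^ DIM('a)) * (indicator (ball x (R * e)) z * norm (g z - c)))"
        using integrable_norm[OF ib] by (intro integrable_mult_right) simp
      fix z
      show "norm (?K z *\<^sub>R (g z - c)) \<le> (B / e ^ DIM('a)) * (indicator (ball x (R * e)) z * norm (g z - c))"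
      proof (cases "z \<in> ball x (R * e)")
        case True
        have "\<bar>?K z\<bar> \<le> B / e ^ DIM('a)"
          unfolding scaled_kernel_def abs_mult using e B(2) kernel_nonneg
          by (simp add: abs_of_nonneg[OF kernel_nonneg] divide_right_mono)
        from mult_right_mono[OF this norm_ge_zero[of "g z - c"]] show ?thesis using True by simp
      next
        case False
        have "z \<notin> (\<lambda>y. x + e *\<^sub>R (a + y)) ` cbox (- One) One"
        proof
          assume "z \<in> (\<lambda>y. x + e *\<^sub>R (a + y)) ` cbox (- One) One"
          then obtain y where y: "y \<in> cbox (- One) One" "z = x + e *\<^sub>R (a + y)" by blast
          have "dist x z = norm (e *\<^sub>R (a + y))" by (simp add: y(2) dist_norm)
          also have "\<dots> \<le> e * (norm a + DIM('a))" using norm_shift_le[OF y(1)] e by simp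
          also have "\<dots> < R * e" using e by (simp add: R_def algebra_simps)
          finally show False using False by simp
        qed
        then show ?thesis
          using scaled_kernel_eq_0[OF e, of z x a] False by simp
      qed
    qed
    also have "\<dots> = B / e ^ DIM('a) * (LINT y|lborel. indicator (ball x (R * e)) y * norm (g y - c))"
      by simp
    also have "\<dots> = B * w * ?A (R * e)"
      unfolding ball w_def using e R pos by (simp add: power_mult_distrib)
    finally show ?thesis .
  qed
  have "filterlim (\<lambda>e. R * e) (at_right 0) (at_right (0::real))"
    using R by (auto simp: filterlim_at eventually_at_right_less intro!: tendsto_eq_intros eventually_mono[OF eventually_at_right_less[of 0]])
  from filterlim_compose[OF lp this] have "((\<lambda>e. B * w * ?A (R * e)) \<longlongrightarrow> 0) (at_right 0)"
    by (rule tendsto_mult_right_zero)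
  moreover have "eventually (\<lambda>e. norm (mollify e a g x - c) \<le> B * w * ?A (R * e)) (at_right 0)"
    using eventually_at_right_less[of "0::real"] by eventually_elim (rule est)
  ultimately have "((\<lambda>e. mollify e a g x - c) \<longlongrightarrow> 0) (at_right 0)"
    by (rule Lim_null_comparison[rotated])
  then show ?thesis
    by (rule LIM_zero_cancel)
qed


section \<open>Shifting a Lipschitz domain into itself\<close>

text \<open>The move raises the point by e m along n, while y lowers it by at most e D and displaces
  its foot in the hyperplane by at most 2 e D, over which the graph rises by at most 2 L e D. The
  choice of m outweighs both losses.\<close>

lemma lipschitz_epigraph_shift:
  fixes n y z :: "'a::euclidean_space"
  assumes L: "L-lipschitz_on {y. y \<bullet> n = 0} \<gamma>" and n: "norm n = 1"
    and z: "\<gamma> (z - (z \<bullet> n) *\<^sub>R n) < z \<bullet> n" and e: "0 < e" and y: "norm y \<le> D"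
    and m: "D * (1 + 2 * L) \<le> m"
  shows "\<gamma> (z + e *\<^sub>R (m *\<^sub>R n + y) - ((z + e *\<^sub>R (m *\<^sub>R n + y)) \<bullet> n) *\<^sub>R n) < (z + e *\<^sub>R (m *\<^sub>R n + y)) \<bullet> n"
proof -
  let ?w = "z + e *\<^sub>R (m *\<^sub>R n + y)"
  let ?z' = "z - (z \<bullet> n) *\<^sub>R n" and ?w' = "?w - (?w \<bullet> n) *\<^sub>R n"
  have nn: "n \<bullet> n = 1" using n by (simp add: norm_eq_1)
  have L0: "L \<ge> 0" using L by (rule lipschitz_on_nonneg)
  have yn: "\<bar>y \<bullet> n\<bar> \<le> D"
    using Cauchy_Schwarz_ineq2[of y n] n y by simp
  have w: "?w \<bullet> n = z \<bullet> n + e * m + e * (y \<bullet> n)"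
    by (simp add: inner_add_left nn algebra_simps)
  have w': "?w' - ?z' = e *\<^sub>R (y - (y \<bullet> n) *\<^sub>R n)"
    unfolding w by (simp add: algebra_simps)
  have "norm (y - (y \<bullet> n) *\<^sub>R n) \<le> norm y + \<bar>y \<bullet> n\<bar>"
    using norm_triangle_ineq4[of y "(y \<bullet> n) *\<^sub>R n"] n by simp
  then have "norm (y - (y \<bullet> n) *\<^sub>R n) \<le> 2 * D" using y yn by simp
  then have d1: "norm (?w' - ?z') \<le> e * (2 * D)"
    unfolding w' using e by simp
  have d2: "dist (\<gamma> ?w') (\<gamma> ?z') \<le> L * dist ?w' ?z'"
    by (rule lipschitz_onD[OF L]) (simp_all add: inner_diff_left nn)
  have "\<bar>\<gamma> ?w' - \<gamma> ?z'\<bar> \<le> L * (e * (2 * D))"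
    using order_trans[OF d2[unfolded dist_norm] mult_left_mono[OF d1 L0]] by (simp only: real_norm_def)
  then have "\<gamma> ?w' \<le> \<gamma> ?z' + e * (2 * L * D)" by (simp add: algebra_simps abs_le_iff)
  also have "\<dots> < z \<bullet> n + e * (2 * L * D)" using z by simp
  also have "\<dots> \<le> z \<bullet> n + e * (m + y \<bullet> n)"
  proof -
    have "2 * L * D \<le> m - D" using m by (simp add: algebra_simps)
    also have "\<dots> \<le> m + y \<bullet> n" using yn by linarith
    finally show ?thesis using e by simp
  qed
  also have "\<dots> = ?w \<bullet> n" unfolding w by (simp add: algebra_simps)
  finally show ?thesis .
qed

text \<open>The threshold d is common to all points of \<Omega> in U, however close they are to the
  boundary; this lets a single e serve on the whole patch.\<close>

definition shifts_inside :: "'a::euclidean_space set \<Rightarrow> 'a set \<Rightarrow> 'a \<Rightarrow> real \<Rightarrow> bool" where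
  "shifts_inside \<Omega> U a d \<longleftrightarrow>
     (\<forall>z\<in>\<Omega> \<inter> U. \<forall>e. 0 < e \<and> e < d \<longrightarrow> (\<forall>y\<in>cbox (- One) One. z + e *\<^sub>R (a + y) \<in> \<Omega>))"

text \<open>Interior points take the displacement 0, boundary points the multiple of the epigraph
  direction computed above. The radius is halved so that a point of the small ball, moved by less
  than r / 2, stays where the local description of \<Omega> is valid.\<close>

lemma exists_shift_inside:
  fixes x :: "'a::euclidean_space"
  assumes "open \<Omega>" "lipschitz_boundary \<Omega>" "x \<in> closure \<Omega>"
  shows "\<exists>r>0. \<exists>a. \<exists>d>0. shifts_inside \<Omega> (ball x r) a d"
proof -
  let ?D = "real DIM('a)"
  have small: "norm (e *\<^sub>R (a + y)) < r" if "0 < e" "e < r / (norm a + ?D)" "y \<in> cbox (- One) One" for e r and a y :: 'a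
  proof -
    have "norm a + ?D > 0" by (simp add: add_nonneg_pos)
    then have "e * (norm a + ?D) < r" using that(2) by (simp add: pos_less_divide_eq)
    then show ?thesis
      by (rule le_less_trans[OF norm_shift_le[OF that(3) less_imp_le[OF that(1)]]])
  qed
  have pos: "norm a + ?D > 0" for a :: 'a by (simp add: add_nonneg_pos)
  show ?thesis
  proof (cases "x \<in> \<Omega>")
    case True
    then obtain r where r: "r > 0" "ball x r \<subseteq> \<Omega>"
      using assms(1) by (auto simp: open_contains_ball)
    have "shifts_inside \<Omega> (ball x (r / 2)) 0 ((r / 2) / (norm (0::'a) + ?D))"
      unfolding shifts_inside_def
    proof (intro ballI allI impI)
      fix z e and y :: 'a
      assume z: "z \<in> \<Omega> \<inter> ball x (r / 2)" and e: "0 < e \<and> e < (r / 2) / (norm (0::'a) + ?D)" and y: "y \<in> cbox (- One) One"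
      have "norm (e *\<^sub>R (0 + y)) < r / 2" by (rule small) (use e y in auto)
      then have "dist z (z + e *\<^sub>R (0 + y)) < r / 2" by (simp add: dist_norm)
      with z have "z + e *\<^sub>R (0 + y) \<in> ball x r"
        using dist_triangle[of x "z + e *\<^sub>R (0 + y)" z] by (simp del: add_0 dist_add_cancel)
      then show "z + e *\<^sub>R (0 + y) \<in> \<Omega>" using r(2) by blast
    qed
    moreover have "(r / 2) / (norm (0::'a) + ?D) > 0" "r / 2 > 0" using r(1) by simp_all
    ultimately show ?thesis by blast
  next
    case False
    then have "x \<in> frontier \<Omega>"
      using assms(1,3) by (simp add: frontier_def interior_open)
    then obtain r n L \<gamma> where r: "r > 0" and n: "norm n = 1" and L: "L-lipschitz_on {y. y \<bullet> n = 0} \<gamma>"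
      and \<Omega>: "\<Omega> \<inter> ball x r = {y \<in> ball x r. \<gamma> (y - (y \<bullet> n) *\<^sub>R n) < y \<bullet> n}"
      using assms(2) unfolding lipschitz_boundary_def by blast
    define m where "m = ?D * (1 + 2 * L)"
    let ?a = "m *\<^sub>R n"
    have "shifts_inside \<Omega> (ball x (r / 2)) ?a ((r / 2) / (norm ?a + ?D))"
      unfolding shifts_inside_def
    proof (intro ballI allI impI)
      fix z e and y :: 'a
      assume z: "z \<in> \<Omega> \<inter> ball x (r / 2)" and e: "0 < e \<and> e < (r / 2) / (norm ?a + ?D)" and y: "y \<in> cbox (- One) One"
      let ?w = "z + e *\<^sub>R (?a + y)"
      have "norm (e *\<^sub>R (?a + y)) < r / 2" by (rule small) (use e y in auto)
      then have "dist z ?w < r / 2" by (simp add: dist_norm)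
      with z have w: "?w \<in> ball x r"
        using dist_triangle[of x ?w z] by (simp del: dist_add_cancel)
      have "norm y \<le> ?D"
        using norm_shift_le[OF y, of 1 0] by simp
      moreover have "z \<in> \<Omega> \<inter> ball x r" using z r by auto
      then have "\<gamma> (z - (z \<bullet> n) *\<^sub>R n) < z \<bullet> n" unfolding \<Omega> by simp
      ultimately have "\<gamma> (?w - (?w \<bullet> n) *\<^sub>R n) < ?w \<bullet> n"
        using e by (intro lipschitz_epigraph_shift[OF L n]) (auto simp: m_def)
      with w have "?w \<in> \<Omega> \<inter> ball x r" unfolding \<Omega> by simp
      then show "?w \<in> \<Omega>" by simp
    qed
    moreover have "(r / 2) / (norm ?a + ?D) > 0" "r / 2 > 0" using r pos[of ?a] by simp_all
    ultimately show ?thesis by blast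
  qed
qed

section \<open>Partitions of unity\<close>

text \<open>The mollified indicator of the ball of radius r / 2, with all averaging points within r
  / 4: it is still 1 on the ball of radius r / 4 and already 0 beyond 3 r / 4.\<close>

lemma exists_cutoff:
  fixes x :: "'a::euclidean_space"
  assumes r: "r > 0"
  shows "\<exists>b::'a \<Rightarrow> real. smooth b \<and> (\<forall>z. 0 \<le> b z \<and> b z \<le> 1) \<and> (\<forall>z\<in>ball x (r / 4). b z = 1) \<and>
    (\<forall>z. z \<notin> cball x (3 * r / 4) \<longrightarrow> b z = 0)"
proof -
  have "eventually (\<lambda>e. e > 0 \<and> (\<forall>y\<in>cbox (- One) (One::'a). norm (e *\<^sub>R (0 + y)) < r / 4)) (at_right 0)"
    by (rule eventually_shift_small) (use r in simp)
  from eventually_happens'[OF trivial_limit_at_right_real this]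
  obtain e where "e > 0 \<and> (\<forall>y\<in>cbox (- One) (One::'a). norm (e *\<^sub>R (0 + y)) < r / 4)" ..
  then have e: "e > 0" "\<And>y. y \<in> cbox (- One) (One::'a) \<Longrightarrow> norm (e *\<^sub>R (0 + y)) < r / 4"
    by blast+
  let ?f = "indicator (ball x (r / 2)) :: 'a \<Rightarrow> real"
  have f: "integrable lborel ?f"
    using emeasure_bounded_finite[OF bounded_ball, of x "r / 2"] by (simp add: integrable_indicator_iff)
  let ?b = "mollify e 0 ?f"
  have shift: "dist z (z + e *\<^sub>R (0 + y)) < r / 4" if "y \<in> cbox (- One) (One::'a)" for y z
    using e(2)[OF that] by (simp add: dist_norm)
  have 1: "?b z \<le> 1" for z
    using norm_mollify_le_bound[OF f e(1), of 1 0 z] by (simp add: AE_I2)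
  have 2: "?b z = 1" if "z \<in> ball x (r / 4)" for z
  proof (rule mollify_eq_const)
    fix y :: 'a assume y: "y \<in> cbox (- One) One"
    have "z + e *\<^sub>R (0 + y) \<in> ball x (r / 2)"
      using that shift[OF y, of z] dist_triangle[of x "z + e *\<^sub>R (0 + y)" z] by (simp del: add_0 dist_add_cancel)
    then show "?f (z + e *\<^sub>R (0 + y)) = 1" by simp
  qed
  have 3: "?b z = 0" if "z \<notin> cball x (3 * r / 4)" for z
  proof (rule mollify_eq_const)
    fix y :: 'a assume y: "y \<in> cbox (- One) One"
    have "z + e *\<^sub>R (0 + y) \<notin> ball x (r / 2)"
      using that shift[OF y, of z] dist_triangle[of x z "z + e *\<^sub>R (0 + y)"]
      by (simp add: dist_commute del: add_0 dist_add_cancel)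
    then show "?f (z + e *\<^sub>R (0 + y)) = 0" by simp
  qed
  have 4: "0 \<le> ?b z" for z
    by (rule mollify_nonneg) simp
  show ?thesis
    by (rule exI[of _ ?b]) (use smooth_mollify[OF e(1) f] 1 2 3 4 in auto)
qed

text \<open>The product of the complements loses exactly the j-th summand when the factor 1 - b_j is
  appended, so the sum telescopes.\<close>

lemma sum_prod_complement:
  fixes b :: "nat \<Rightarrow> real"
  shows "(\<Sum>j<N. b j * (\<Prod>i<j. 1 - b i)) = 1 - (\<Prod>i<N. 1 - b i)"
  by (induction N) (simp_all add: algebra_simps)

text \<open>The functions are b_j times the product of the earlier 1 - b_i. On S some cutoff equals
  1, which annihilates the product of all complements and leaves the sum 1.\<close>

lemma partition_of_unity:
  fixes S :: "'a::euclidean_space set" and r :: "'a \<Rightarrow> real"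
  assumes "compact S" "\<And>x. x \<in> S \<Longrightarrow> r x > 0"
  obtains N :: nat and c :: "nat \<Rightarrow> 'a" and \<theta> :: "nat \<Rightarrow> 'a \<Rightarrow> real" where
    "\<And>i. i < N \<Longrightarrow> c i \<in> S" "\<And>i. i < N \<Longrightarrow> \<theta> i \<in> test_functions UNIV"
    "\<And>i x. i < N \<Longrightarrow> 0 \<le> \<theta> i x" "\<And>i x. i < N \<Longrightarrow> x \<notin> ball (c i) (r (c i)) \<Longrightarrow> \<theta> i x = 0"
    "\<And>x. x \<in> S \<Longrightarrow> (\<Sum>i<N. \<theta> i x) = 1"
proof -
  obtain F where F: "F \<subseteq> S" "finite F" "S \<subseteq> (\<Union>x\<in>F. ball x (r x / 4))"
    by (rule compactE_image[OF assms(1), of S "\<lambda>x. ball x (r x / 4)"]) (use assms(2) in force)+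
  obtain c where c: "bij_betw c {0..<card F} F"
    using ex_bij_betw_nat_finite[OF F(2)] by blast
  define N where "N = card F"
  have cF: "c ` {..<N} = F"
    using c by (simp add: bij_betw_def N_def atLeast0LessThan)
  then have cS: "c i \<in> S" if "i < N" for i using that F(1) by blast
  have "\<forall>i. \<exists>b::'a \<Rightarrow> real. i < N \<longrightarrow> smooth b \<and> (\<forall>z. 0 \<le> b z \<and> b z \<le> 1) \<and>
      (\<forall>z\<in>ball (c i) (r (c i) / 4). b z = 1) \<and> (\<forall>z. z \<notin> cball (c i) (3 * r (c i) / 4) \<longrightarrow> b z = 0)"
  proof
    fix i
    show "\<exists>b::'a \<Rightarrow> real. i < N \<longrightarrow> smooth b \<and> (\<forall>z. 0 \<le> b z \<and> b z \<le> 1) \<and>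
      (\<forall>z\<in>ball (c i) (r (c i) / 4). b z = 1) \<and> (\<forall>z. z \<notin> cball (c i) (3 * r (c i) / 4) \<longrightarrow> b z = 0)"
    proof (cases "i < N")
      case True
      then show ?thesis using exists_cutoff[OF assms(2)[OF cS[OF True]], of "c i"] by metis
    qed simp
  qed
  from choice[OF this] obtain b :: "nat \<Rightarrow> 'a \<Rightarrow> real" where b: "\<forall>i. i < N \<longrightarrow> smooth (b i) \<and> (\<forall>z. 0 \<le> b i z \<and> b i z \<le> 1) \<and>
      (\<forall>z\<in>ball (c i) (r (c i) / 4). b i z = 1) \<and> (\<forall>z. z \<notin> cball (c i) (3 * r (c i) / 4) \<longrightarrow> b i z = 0)"
    by blast
  let ?\<theta> = "\<lambda>j x. b j x * (\<Prod>i<j. 1 - b i x)"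
  have sm: "smooth (b i)" if "i < N" for i using b that by simp
  show thesis
  proof (rule that[of N c ?\<theta>])
    show "?\<theta> j \<in> test_functions UNIV" if j: "j < N" for j
    proof (rule test_functionsI)
      have "smooth (\<lambda>x. 1 + (-1) * b i x)" if "i < N" for i
        by (rule smooth_add[OF smooth_const smooth_mult[OF smooth_const sm[OF that]]])
      then have "smooth (\<lambda>x. 1 - b i x)" if "i < N" for i using that by simp
      then have "smooth (\<lambda>x. \<Prod>i<j. 1 - b i x)"
        by (intro smooth_prod) (use j in simp)
      then show "smooth (?\<theta> j)" by (rule smooth_mult[OF sm[OF j]])
      show "compact (cball (c j) (3 * r (c j) / 4))" by simp
      show "?\<theta> j x = 0" if "x \<notin> cball (c j) (3 * r (c j) / 4)" for x
        using b j that by simp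
    qed simp
    show "0 \<le> ?\<theta> j x" if "j < N" for j x
      using b that by (intro mult_nonneg_nonneg prod_nonneg) simp_all
    show "?\<theta> j x = 0" if j: "j < N" and x: "x \<notin> ball (c j) (r (c j))" for j x
    proof -
      have "x \<notin> cball (c j) (3 * r (c j) / 4)"
        using x assms(2)[OF cS[OF j]] by simp
      then show ?thesis using b j by simp
    qed
    show "(\<Sum>i<N. ?\<theta> i x) = 1" if x: "x \<in> S" for x
    proof -
      obtain i where i: "i < N" "x \<in> ball (c i) (r (c i) / 4)"
        using F(3) x cF by blast
      then have "1 - b i x = 0" using b by simp
      with i(1) have "(\<Prod>i<N. 1 - b i x) = 0" by (intro prod_zero) auto
      then show ?thesis by (simp add: sum_prod_complement)
    qed
  qed (rule cS)
qed


section \<open>Norms on the space of fields with weak divergence\<close>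

lemma is_weak_div_diff:
  fixes f g :: "'a::euclidean_space \<Rightarrow> 'a"
  assumes "open \<Omega>" and f: "is_weak_div \<Omega> f a" and g: "is_weak_div \<Omega> g b"
  shows "is_weak_div \<Omega> (\<lambda>x. f x - g x) (\<lambda>x. a x - b x)"
  unfolding is_weak_div_def
proof (intro conjI ballI)
  show "loc_integrable \<Omega> (\<lambda>x. f x - g x)" "loc_integrable \<Omega> (\<lambda>x. a x - b x)"
    by (rule loc_integrable_diff[OF is_weak_divD(1)[OF f] is_weak_divD(1)[OF g]],
        rule loc_integrable_diff[OF is_weak_divD(2)[OF f] is_weak_divD(2)[OF g]])
  fix \<psi> :: "'a \<Rightarrow> real" assume \<psi>: "\<psi> \<in> test_functions \<Omega>"
  note int = loc_integrable_inner_test_function[OF assms(1)]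
  have "(LINT x|lebesgue_on \<Omega>. (f x - g x) \<bullet> gradient \<psi> x) =
      (LINT x|lebesgue_on \<Omega>. f x \<bullet> gradient \<psi> x) - (LINT x|lebesgue_on \<Omega>. g x \<bullet> gradient \<psi> x)"
    unfolding inner_diff_left
    by (rule Bochner_Integration.integral_diff; rule int[OF _ test_functions_gradient[OF \<psi>]])
       (rule is_weak_divD(1)[OF f] is_weak_divD(1)[OF g])+
  moreover have "(LINT x|lebesgue_on \<Omega>. (a x - b x) * \<psi> x) =
      (LINT x|lebesgue_on \<Omega>. a x * \<psi> x) - (LINT x|lebesgue_on \<Omega>. b x * \<psi> x)"
    unfolding left_diff_distrib
    by (rule Bochner_Integration.integral_diff; rule int[OF _ \<psi>, unfolded inner_real_def])
       (rule is_weak_divD(2)[OF f] is_weak_divD(2)[OF g])+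
  ultimately show "(LINT x|lebesgue_on \<Omega>. (f x - g x) \<bullet> gradient \<psi> x) = - (LINT x|lebesgue_on \<Omega>. (a x - b x) * \<psi> x)"
    using is_weak_divD(3)[OF f \<psi>] is_weak_divD(3)[OF g \<psi>] by simp
qed

lemma is_weak_div_weak_div: "is_weak_div \<Omega> f k \<Longrightarrow> is_weak_div \<Omega> f (weak_div \<Omega> f)"
  unfolding weak_div_def by (rule someI[of "is_weak_div \<Omega> f"])

lemma weak_div_AE:
  assumes "open \<Omega>" "is_weak_div \<Omega> f k"
  shows "AE x in lebesgue_on \<Omega>. weak_div \<Omega> f x = k x"
  by (rule is_weak_div_unique[OF assms(1) is_weak_div_weak_div[OF assms(2)] assms(2)])

lemma Lp_norm_powr: "1 \<le> q \<Longrightarrow> Lp_norm q M f powr q = (LINT x|M. norm (f x) powr q)"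
  unfolding Lp_norm_def by (simp add: powr_powr powr_one integral_nonneg_AE)

text \<open>Frees the norm from the choice made in \<open>weak_div\<close>: by uniqueness any weak
  divergence yields the same integral.\<close>

lemma Wdiv_norm_eq:
  fixes f :: "'a::euclidean_space \<Rightarrow> 'a"
  assumes "open \<Omega>" "1 \<le> q" "is_weak_div \<Omega> f k"
  shows "Wdiv_norm q \<Omega> f =
    ((LINT x|lebesgue_on \<Omega>. norm (f x) powr q) + (LINT x|lebesgue_on \<Omega>. norm (k x) powr q)) powr (1 / q)"
proof -
  note w = is_weak_div_weak_div[OF assms(3)]
  have [measurable]: "k \<in> borel_measurable (lebesgue_on \<Omega>)" "weak_div \<Omega> f \<in> borel_measurable (lebesgue_on \<Omega>)"
    by (rule loc_integrable_measurable[OF assms(1) is_weak_divD(2)[OF assms(3)]],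
        rule loc_integrable_measurable[OF assms(1) is_weak_divD(2)[OF w]])
  have "(LINT x|lebesgue_on \<Omega>. norm (weak_div \<Omega> f x) powr q) = (LINT x|lebesgue_on \<Omega>. norm (k x) powr q)"
  proof (rule integral_cong_AE)
    show "AE x in lebesgue_on \<Omega>. norm (weak_div \<Omega> f x) powr q = norm (k x) powr q"
      using weak_div_AE[OF assms(1,3)] by eventually_elim simp
  qed measurable
  then show ?thesis
    unfolding Wdiv_norm_def Lp_norm_powr[OF assms(2)] by simp
qed

lemma Lp_space_ereal:
  "f \<in> Lp_space (ereal q) M \<longleftrightarrow> f \<in> borel_measurable M \<and> integrable M (\<lambda>x. norm (f x) powr q)"
  by (simp add: Lp_space_def)

text \<open>On a bounded set t \<le> 1 + t^q turns L^q functions into integrable ones, and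
  integrability is what the mollification lemmas start from.\<close>

lemma Lp_representative:
  fixes f :: "'a::euclidean_space \<Rightarrow> 'b::euclidean_space"
  assumes \<Omega>: "open \<Omega>" "bounded \<Omega>" and q: "1 \<le> q" and f: "f \<in> Lp_space (ereal q) (lebesgue_on \<Omega>)"
  obtains f' where "f' \<in> borel_measurable borel" "\<And>x. x \<notin> \<Omega> \<Longrightarrow> f' x = 0"
    "AE x in lebesgue. x \<in> \<Omega> \<longrightarrow> f x = f' x"
    "integrable lborel f'" "integrable lborel (\<lambda>x. norm (f' x) powr q)"
proof -
  have fm: "f \<in> borel_measurable (lebesgue_on \<Omega>)" and fi: "integrable (lebesgue_on \<Omega>) (\<lambda>x. norm (f x) powr q)"
    using f by (simp_all add: Lp_space_ereal)
  obtain f' where f': "f' \<in> borel_measurable borel" "\<And>x. x \<notin> \<Omega> \<Longrightarrow> f' x = 0"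
    "AE x in lebesgue. x \<in> \<Omega> \<longrightarrow> f x = f' x"
    using borel_representative[OF \<Omega>(1) fm] by metis
  note [measurable] = f'(1)
  have "integrable (lebesgue_on \<Omega>) (\<lambda>x. norm (f' x) powr q)"
  proof (rule integrable_cong_AE_imp[OF fi])
    show "(\<lambda>x. norm (f' x) powr q) \<in> borel_measurable (lebesgue_on \<Omega>)"
      by (intro measurable_restrict_space1 measurable_completion) simp
    show "AE x in lebesgue_on \<Omega>. norm (f x) powr q = norm (f' x) powr q"
      unfolding AE_lebesgue_on_open[OF \<Omega>(1)] using f'(3) by eventually_elim auto
  qed
  then have i: "integrable lborel (\<lambda>x. norm (f' x) powr q)"
    by (subst (asm) integral_lebesgue_on_eq_lborel(2)[OF \<Omega>(1)]) (use f'(2) q in auto)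
  have "integrable lborel f'"
  proof (rule Bochner_Integration.integrable_bound)
    show "integrable lborel (\<lambda>x. indicator \<Omega> x + norm (f' x) powr q)"
      using i emeasure_bounded_finite[OF \<Omega>(2)] \<Omega>(1)
      by (intro Bochner_Integration.integrable_add) (simp_all add: integrable_indicator_iff)
    show "AE x in lborel. norm (f' x) \<le> norm (indicator \<Omega> x + norm (f' x) powr q :: real)"
    proof (rule AE_I2)
      fix x
      have "norm (f' x) \<le> indicator \<Omega> x + norm (f' x) powr q"
      proof (cases "x \<in> \<Omega>")
        case True
        have "norm (f' x) \<le> 1 + norm (f' x) powr q"
        proof (cases "norm (f' x) \<le> 1")
          case False
          then have "norm (f' x) powr 1 \<le> norm (f' x) powr q" using q by (intro powr_mono) auto
          then show ?thesis using False by simp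
        qed (simp add: add_increasing2)
        then show ?thesis using True by simp
      qed (simp add: f'(2))
      then show "norm (f' x) \<le> norm (indicator \<Omega> x + norm (f' x) powr q :: real)" by simp
    qed
  qed simp
  with f' i show thesis using that by blast
qed

lemma is_weak_div_lborel:
  fixes g :: "'a::euclidean_space \<Rightarrow> 'a"
  assumes \<Omega>: "open \<Omega>" and wd: "is_weak_div \<Omega> g h"
    and g': "g' \<in> borel_measurable borel" "\<And>x. x \<notin> \<Omega> \<Longrightarrow> g' x = 0" "AE x in lebesgue. x \<in> \<Omega> \<longrightarrow> g x = g' x"
    and h': "h' \<in> borel_measurable borel" "\<And>x. x \<notin> \<Omega> \<Longrightarrow> h' x = 0" "AE x in lebesgue. x \<in> \<Omega> \<longrightarrow> h x = h' x"
    and \<psi>: "\<psi> \<in> test_functions \<Omega>"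
  shows "(LINT x|lborel. g' x \<bullet> gradient \<psi> x) = - (LINT x|lborel. h' x * \<psi> x)"
proof -
  note sm = test_functions_smooth[OF \<psi>]
  have m: "g' \<in> borel_measurable (lebesgue_on \<Omega>)" "h' \<in> borel_measurable (lebesgue_on \<Omega>)"
      "\<psi> \<in> borel_measurable (lebesgue_on \<Omega>)" "gradient \<psi> \<in> borel_measurable (lebesgue_on \<Omega>)"
      "g \<in> borel_measurable (lebesgue_on \<Omega>)" "h \<in> borel_measurable (lebesgue_on \<Omega>)"
    using g'(1) h'(1) smooth_borel_measurable[OF sm] smooth_borel_measurable[OF smooth_gradient[OF sm]]
      loc_integrable_measurable[OF \<Omega> is_weak_divD(1)[OF wd]] loc_integrable_measurable[OF \<Omega> is_weak_divD(2)[OF wd]]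
    by (auto intro!: measurable_restrict_space1 measurable_completion)
  have "(LINT x|lborel. g' x \<bullet> gradient \<psi> x) = (LINT x|lebesgue_on \<Omega>. g' x \<bullet> gradient \<psi> x)"
    by (rule integral_lebesgue_on_eq_lborel(1)[OF \<Omega>, symmetric])
       (use g' smooth_borel_measurable[OF smooth_gradient[OF sm]] in auto)
  also have "\<dots> = (LINT x|lebesgue_on \<Omega>. g x \<bullet> gradient \<psi> x)"
  proof (rule integral_cong_AE)
    show "AE x in lebesgue_on \<Omega>. g' x \<bullet> gradient \<psi> x = g x \<bullet> gradient \<psi> x"
      unfolding AE_lebesgue_on_open[OF \<Omega>] using g'(3) by eventually_elim auto
  qed (intro borel_measurable_inner m)+
  also have "\<dots> = - (LINT x|lebesgue_on \<Omega>. h x * \<psi> x)"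
    by (rule is_weak_divD(3)[OF wd \<psi>])
  also have "(LINT x|lebesgue_on \<Omega>. h x * \<psi> x) = (LINT x|lebesgue_on \<Omega>. h' x * \<psi> x)"
  proof (rule integral_cong_AE)
    show "AE x in lebesgue_on \<Omega>. h x * \<psi> x = h' x * \<psi> x"
      unfolding AE_lebesgue_on_open[OF \<Omega>] using h'(3) by eventually_elim auto
  qed (intro borel_measurable_times m)+
  also have "\<dots> = (LINT x|lborel. h' x * \<psi> x)"
    by (rule integral_lebesgue_on_eq_lborel(1)[OF \<Omega>])
       (use h' smooth_borel_measurable[OF sm] in auto)
  finally show ?thesis .
qed

section \<open>Smooth approximation up to the boundary\<close>

lemma Lq_mollifiable_tendsto:
  assumes "Lq_mollifiable q a f"
  shows "((\<lambda>e. Lq_mass q (\<lambda>x. mollify e a f x - f x)) \<longlongrightarrow> 0) (at_right 0)"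
proof (rule order_tendstoI)
  fix b :: ennreal assume "0 < b"
  then obtain \<delta> :: real where \<delta>: "\<delta> > 0" "ennreal \<delta> \<le> b"
    by (cases b) (auto intro: that[of 1])
  have "eventually (\<lambda>e. Lq_mass q (\<lambda>x. mollify e a f x - f x) < ennreal \<delta>) (at_right 0)"
    using assms \<delta>(1) unfolding Lq_mollifiable_def by simp
  then show "eventually (\<lambda>e. Lq_mass q (\<lambda>x. mollify e a f x - f x) < b) (at_right 0)"
    by eventually_elim (rule less_le_trans[OF _ \<delta>(2)])
qed simp

text \<open>The sum is at most the number of terms times the largest, whose power is one of the
  summands on the right.\<close>

lemma powr_sum_le:
  fixes t :: "'i \<Rightarrow> real"
  assumes "finite I" "1 \<le> q" "\<And>i. i \<in> I \<Longrightarrow> 0 \<le> t i"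
  shows "(\<Sum>i\<in>I. t i) powr q \<le> real (card I) powr q * (\<Sum>i\<in>I. t i powr q)"
proof (cases "I = {}")
  case False
  define m where "m = Max (t ` I)"
  have m: "m \<in> t ` I" "\<And>i. i \<in> I \<Longrightarrow> t i \<le> m"
    using assms(1) False by (auto simp: m_def)
  have "(\<Sum>i\<in>I. t i) \<le> real (card I) * m"
    using sum_bounded_above[of I t m] m(2) by simp
  then have "(\<Sum>i\<in>I. t i) powr q \<le> (real (card I) * m) powr q"
    using assms by (intro powr_mono2 sum_nonneg) auto
  also have "\<dots> = real (card I) powr q * m powr q"
    by (rule powr_mult)
  also have "m powr q \<le> (\<Sum>i\<in>I. t i powr q)"
    using m(1) assms(1) by (auto intro!: member_le_sum)
  finally show ?thesis by (simp add: mult_left_mono)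
qed simp

text \<open>The sum is constant on an open set. This permits subtracting g inside the terms with
  gradients, which would otherwise not tend to zero.\<close>

lemma sum_gradient_partition:
  fixes \<theta> :: "nat \<Rightarrow> 'a::euclidean_space \<Rightarrow> real"
  assumes "open \<Omega>" "x \<in> \<Omega>" "\<And>i. i < N \<Longrightarrow> smooth (\<theta> i)" "\<And>z. z \<in> \<Omega> \<Longrightarrow> (\<Sum>i<N. \<theta> i z) = 1"
  shows "(\<Sum>i<N. gradient (\<theta> i) x) = 0"
proof -
  have "((\<lambda>z. \<Sum>i<N. \<theta> i z) has_derivative (\<lambda>v. \<Sum>i<N. frechet_derivative (\<theta> i) (at x) v)) (at x)"
    by (rule has_derivative_sum, rule smooth_has_derivative[OF assms(3)]) simp
  moreover have "((\<lambda>z. \<Sum>i<N. \<theta> i z) has_derivative (\<lambda>v. 0)) (at x)"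
    by (rule has_derivative_transform_within_open[OF has_derivative_const[of 1] assms(1,2)])
       (simp add: assms(4))
  ultimately have "(\<lambda>v. \<Sum>i<N. frechet_derivative (\<theta> i) (at x) v) = (\<lambda>v. 0)"
    by (rule has_derivative_unique)
  then have 0: "(\<Sum>i<N. frechet_derivative (\<theta> i) (at x) v) = 0" for v
    by (rule fun_cong)
  have "(\<Sum>i<N. gradient (\<theta> i) x) = (\<Sum>b\<in>Basis. \<Sum>i<N. frechet_derivative (\<theta> i) (at x) b *\<^sub>R b)"
    unfolding gradient_def by (rule sum.swap)
  also have "\<dots> = (\<Sum>b\<in>Basis. (\<Sum>i<N. frechet_derivative (\<theta> i) (at x) b) *\<^sub>R b)"
    by (simp add: scaleR_sum_left)
  finally show ?thesis by (simp add: 0)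
qed

text \<open>Both the field and its divergence are compared with the same finite family of
  mollification errors of g and of h, so a single null sequence \<Phi> controls them. The last
  conclusion is phrased for every value c at which the mean deviation vanishes.\<close>

lemma exists_smooth_approximants:
  fixes \<Omega> :: "'a::euclidean_space set" and g :: "'a \<Rightarrow> 'a" and h :: "'a \<Rightarrow> real"
  assumes dom: "bounded_lipschitz_domain \<Omega>" and q: "1 \<le> q"
    and g: "integrable lborel g" "integrable lborel (\<lambda>x. norm (g x) powr q)"
    and h: "integrable lborel h" "integrable lborel (\<lambda>x. norm (h x) powr q)"
    and wd: "\<And>\<psi>. \<psi> \<in> test_functions \<Omega> \<Longrightarrow> (LINT x|lborel. g x \<bullet> gradient \<psi> x) = - (LINT x|lborel. h x * \<psi> x)"
    and M: "AE x in lborel. norm (g x) \<le> M"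
  obtains G :: "nat \<Rightarrow> 'a \<Rightarrow> 'a" and \<Phi> :: "nat \<Rightarrow> ennreal" where
    "\<And>n. G n \<in> test_functions UNIV" "\<And>n x. x \<in> \<Omega> \<Longrightarrow> norm (G n x) \<le> M" "\<Phi> \<longlonglongrightarrow> 0"
    "\<And>n. (\<integral>\<^sup>+x. indicator \<Omega> x * ennreal (norm (G n x - g x) powr q) \<partial>lborel) \<le> \<Phi> n"
    "\<And>n. (\<integral>\<^sup>+x. indicator \<Omega> x * ennreal (norm (divergence (G n) x - h x) powr q) \<partial>lborel) \<le> \<Phi> n"
    "\<And>x c. x \<in> \<Omega> \<Longrightarrow> ((\<lambda>r. (LINT y|lborel. indicator (ball x r) y * norm (g y - c)) / measure lborel (ball x r)) \<longlongrightarrow> 0) (at_right 0)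
      \<Longrightarrow> (\<lambda>n. G n x) \<longlonglongrightarrow> c"
proof -
  have \<Omega>: "open \<Omega>" "bounded \<Omega>" "lipschitz_boundary \<Omega>"
    using dom by (simp_all add: bounded_lipschitz_domain_def)
  have gm [measurable]: "g \<in> borel_measurable borel" and hm [measurable]: "h \<in> borel_measurable borel"
    using borel_measurable_integrable[OF g(1)] borel_measurable_integrable[OF h(1)] by simp_all
  have "\<forall>x. \<exists>r a d. x \<in> closure \<Omega> \<longrightarrow> r > 0 \<and> d > 0 \<and> shifts_inside \<Omega> (ball x r) a d"
    using exists_shift_inside[OF \<Omega>(1,3)] by metis
  then obtain r a d where rad: "\<And>x. x \<in> closure \<Omega> \<Longrightarrow> r x > 0 \<and> d x > 0 \<and> shifts_inside \<Omega> (ball x (r x)) (a x) (d x)"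
    by metis
  have cpt: "compact (closure \<Omega>)" using \<Omega>(2) by (simp add: compact_closure)
  have rpos: "r x > 0" if "x \<in> closure \<Omega>" for x using rad[OF that] by simp
  show thesis
  proof (rule partition_of_unity[of "closure \<Omega>" r, OF cpt rpos])
    fix N :: nat and c :: "nat \<Rightarrow> 'a" and \<theta> :: "nat \<Rightarrow> 'a \<Rightarrow> real"
    assume c: "\<And>i. i < N \<Longrightarrow> c i \<in> closure \<Omega>" and \<theta>: "\<And>i. i < N \<Longrightarrow> \<theta> i \<in> test_functions UNIV"
      "\<And>i x. i < N \<Longrightarrow> 0 \<le> \<theta> i x" "\<And>i x. i < N \<Longrightarrow> x \<notin> ball (c i) (r (c i)) \<Longrightarrow> \<theta> i x = 0"
      "\<And>x. x \<in> closure \<Omega> \<Longrightarrow> (\<Sum>i<N. \<theta> i x) = 1"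
    note sm\<theta> = test_functions_smooth[OF \<theta>(1)]
    have sum1: "(\<Sum>i<N. \<theta> i x) = 1" if "x \<in> \<Omega>" for x
      using \<theta>(4) closure_subset that by blast
    have \<theta>1: "\<theta> i x \<le> 1" if "i < N" "x \<in> \<Omega>" for i x
      using member_le_sum[of i "{..<N}" "\<lambda>i. \<theta> i x"] \<theta>(2) sum1[OF that(2)] that(1) by auto
    let ?J = "\<lambda>e i. mollify e (a (c i)) g" and ?H = "\<lambda>e i. mollify e (a (c i)) h"
    \<comment> \<open>The smallest of the finitely many patch thresholds; inserting 1 keeps the set
      nonempty.\<close>
    define \<delta> where "\<delta> = Min (insert 1 ((\<lambda>i. d (c i)) ` {..<N}))"
    have \<delta>2: "\<delta> \<le> d (c i)" if "i < N" for i
      unfolding \<delta>_def using that by (intro Min_le) auto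
    have \<delta>1: "\<delta> > 0"
      unfolding \<delta>_def by (subst Min_gr_iff) (use rad[OF c] in auto)
    \<comment> \<open>A common bound for the gradients of the partition. With 1 inserted it also
      dominates the weights \<theta>, so that one expression bounds both the field and the
      divergence.\<close>
    define B where "B = Max (insert 1 ((\<lambda>i. SOME B. \<forall>x. norm (gradient (\<theta> i) x) \<le> B) ` {..<N}))"
    have B1: "B \<ge> 1" by (simp add: B_def)
    have B: "norm (gradient (\<theta> i) x) \<le> B" if "i < N" for i x
    proof -
      have "\<exists>B. \<forall>x. norm (gradient (\<theta> i) x) \<le> B"
        using test_functions_bounded[OF test_functions_gradient[OF \<theta>(1)[OF that]]] by metis
      from someI_ex[OF this] have "norm (gradient (\<theta> i) x) \<le> (SOME B. \<forall>x. norm (gradient (\<theta> i) x) \<le> B)" by blast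
      also have "\<dots> \<le> B" using that by (auto simp: B_def)
      finally show ?thesis .
    qed
    define F where "F = (\<lambda>e x. \<Sum>i<N. \<theta> i x *\<^sub>R ?J e i x)"
    have smJ: "smooth (?J e i)" if "e > 0" for e i
      by (rule smooth_mollify[OF that g(1)])
    have F_test: "F e \<in> test_functions UNIV" if e: "e > 0" for e
    proof (rule test_functionsI)
      show "smooth (F e)"
        unfolding F_def using smooth_scaleR[OF sm\<theta> smJ[OF e]] by (intro smooth_sum) auto
      show "compact (\<Union>i<N. cball (c i) (r (c i)))" by (intro compact_UN) auto
      show "F e x = 0" if "x \<notin> (\<Union>i<N. cball (c i) (r (c i)))" for x
        unfolding F_def using that \<theta>(3) by (intro sum.neutral) force
    qed simp
    define p where "p = (\<lambda>e i x. norm (?J e i x - g x))"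
    define s where "s = (\<lambda>e i x. norm (?H e i x - h x))"
    have est1: "norm (F e x - g x) \<le> B * ((\<Sum>i<N. p e i x) + (\<Sum>i<N. s e i x))" if x: "x \<in> \<Omega>" for e x
    proof -
      have "F e x - g x = (\<Sum>i<N. \<theta> i x *\<^sub>R (?J e i x - g x))"
        using sum1[OF x] by (simp add: F_def scaleR_diff_right sum_subtractf flip: scaleR_sum_left)
      then have "norm (F e x - g x) \<le> (\<Sum>i<N. norm (\<theta> i x *\<^sub>R (?J e i x - g x)))" by (simp only: norm_sum)
      also have "\<dots> \<le> (\<Sum>i<N. p e i x)"
        using \<theta>(2) \<theta>1[OF _ x] by (intro sum_mono) (auto simp: p_def intro!: mult_left_le_one_le)
      also have "\<dots> \<le> 1 * ((\<Sum>i<N. p e i x) + (\<Sum>i<N. s e i x))"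
        by (simp add: s_def sum_nonneg)
      also have "\<dots> \<le> B * ((\<Sum>i<N. p e i x) + (\<Sum>i<N. s e i x))"
        by (rule mult_right_mono[OF B1]) (simp add: s_def p_def sum_nonneg)
      finally show ?thesis .
    qed
    have divF: "divergence (F e) x = (\<Sum>i<N. gradient (\<theta> i) x \<bullet> ?J e i x + \<theta> i x * ?H e i x)"
      if x: "x \<in> \<Omega>" and e: "0 < e" "e < \<delta>" for e x
    proof -
      have "divergence (F e) x = (\<Sum>i<N. divergence (\<lambda>x. \<theta> i x *\<^sub>R ?J e i x) x)"
        unfolding F_def by (rule divergence_sum) (rule smooth_scaleR[OF sm\<theta> smJ[OF e(1)]], simp)
      also have "\<dots> = (\<Sum>i<N. gradient (\<theta> i) x \<bullet> ?J e i x + \<theta> i x * ?H e i x)"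
      proof (rule sum.cong[OF refl])
        fix i assume "i \<in> {..<N}"
        then have i: "i < N" by simp
        \<comment> \<open>Outside its patch the displaced cube may leave \<Omega> and the divergence
          may not commute with the mollification, but there the weight vanishes.\<close>
        have "\<theta> i x * divergence (?J e i) x = \<theta> i x * ?H e i x"
        proof (cases "x \<in> ball (c i) (r (c i))")
          case True
          have "divergence (?J e i) x = ?H e i x"
          proof (rule divergence_mollify[OF e(1) g(1) hm wd])
            show "x + e *\<^sub>R (a (c i) + y) \<in> \<Omega>" if "y \<in> cbox (- One) (One::'a)" for y
              using rad[OF c[OF i]] x True that e \<delta>2[OF i] unfolding shifts_inside_def by auto
          qed
          then show ?thesis by simp
        qed (simp add: \<theta>(3)[OF i])
        then show "divergence (\<lambda>x. \<theta> i x *\<^sub>R ?J e i x) x = gradient (\<theta> i) x \<bullet> ?J e i x + \<theta> i x * ?H e i x"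
          using divergence_scaleR[OF sm\<theta>[OF i] smJ[OF e(1)]] by simp
      qed
      finally show ?thesis .
    qed
    have est2: "norm (divergence (F e) x - h x) \<le> B * ((\<Sum>i<N. p e i x) + (\<Sum>i<N. s e i x))"
      if x: "x \<in> \<Omega>" and e: "0 < e" "e < \<delta>" for e x
    proof -
      have "(\<Sum>i<N. gradient (\<theta> i) x \<bullet> g x) = 0"
        using sum_gradient_partition[OF \<Omega>(1) x sm\<theta> sum1] by (simp flip: inner_sum_left)
      moreover have "(\<Sum>i<N. \<theta> i x * h x) = h x"
        using sum1[OF x] by (simp flip: sum_distrib_right)
      ultimately have "divergence (F e) x - h x =
          (\<Sum>i<N. gradient (\<theta> i) x \<bullet> (?J e i x - g x)) + (\<Sum>i<N. \<theta> i x * (?H e i x - h x))"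
        unfolding divF[OF x e] by (simp add: inner_diff_right right_diff_distrib sum_subtractf sum.distrib)
      also have "norm \<dots> \<le> (\<Sum>i<N. B * p e i x) + (\<Sum>i<N. B * s e i x)"
      proof (rule order_trans[OF norm_triangle_ineq], rule add_mono)
        show "norm (\<Sum>i<N. gradient (\<theta> i) x \<bullet> (?J e i x - g x)) \<le> (\<Sum>i<N. B * p e i x)"
        proof (rule order_trans[OF norm_sum], rule sum_mono)
          fix i assume "i \<in> {..<N}"
          then show "norm (gradient (\<theta> i) x \<bullet> (?J e i x - g x)) \<le> B * p e i x"
            using Cauchy_Schwarz_ineq2[of "gradient (\<theta> i) x" "?J e i x - g x"]
              mult_right_mono[OF B norm_ge_zero, of i x "?J e i x - g x"]
            unfolding p_def real_norm_def by (auto intro: order_trans)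
        qed
        show "norm (\<Sum>i<N. \<theta> i x * (?H e i x - h x)) \<le> (\<Sum>i<N. B * s e i x)"
        proof (rule order_trans[OF norm_sum], rule sum_mono)
          fix i assume "i \<in> {..<N}"
          then show "norm (\<theta> i x * (?H e i x - h x)) \<le> B * s e i x"
            unfolding s_def norm_mult using \<theta>(2)[of i x] \<theta>1[OF _ x, of i] B1 by (intro mult_right_mono) auto
        qed
      qed
      finally show ?thesis by (simp add: sum_distrib_left distrib_left)
    qed
    \<comment> \<open>There are 2 N errors, N for the field and N for the divergence, hence (2 N)^q
      from \<open>powr_sum_le\<close>.\<close>
    define C where "C = B powr q * (2 * real N) powr q"
    define E where "E = (\<lambda>e. ennreal C * (\<Sum>i<N. Lq_mass q (\<lambda>x. ?J e i x - g x) + Lq_mass q (\<lambda>x. ?H e i x - h x)))"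
    have pw: "(B * ((\<Sum>i<N. p e i x) + (\<Sum>i<N. s e i x))) powr q \<le> C * (\<Sum>i<N. p e i x powr q + s e i x powr q)" for e x
    proof -
      \<comment> \<open>The two families are merged into one, indexed by pairs of a patch and a
        truth value.\<close>
      let ?t = "\<lambda>(i, b). if b then p e i x else s e i x"
      have "(\<Sum>i<N. p e i x) + (\<Sum>i<N. s e i x) = (\<Sum>k\<in>{..<N} \<times> UNIV. ?t k)"
        by (subst sum.cartesian_product[symmetric]) (simp add: UNIV_bool sum.distrib add.commute)
      moreover have "(\<Sum>i<N. p e i x powr q + s e i x powr q) = (\<Sum>k\<in>{..<N} \<times> UNIV. ?t k powr q)"
        by (simp add: sum.cartesian_product' UNIV_bool add.commute)
      moreover have "(\<Sum>k\<in>{..<N} \<times> UNIV. ?t k) powr q \<le> real (card ({..<N} \<times> (UNIV::bool set))) powr q * (\<Sum>k\<in>{..<N} \<times> UNIV. ?t k powr q)"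
        by (rule powr_sum_le[OF _ q]) (auto simp: p_def s_def)
      ultimately show ?thesis
        using B1 by (simp add: C_def powr_mult card_cartesian_product mult.commute mult.left_commute mult_left_mono)
    qed
    have bound: "(\<integral>\<^sup>+x. indicator \<Omega> x * ennreal (norm (k x) powr q) \<partial>lborel) \<le> E e"
      if k: "\<And>x. x \<in> \<Omega> \<Longrightarrow> norm (k x) \<le> B * ((\<Sum>i<N. p e i x) + (\<Sum>i<N. s e i x))"
      for k :: "'a \<Rightarrow> 'b::real_normed_vector" and e
    proof -
      have "(\<integral>\<^sup>+x. indicator \<Omega> x * ennreal (norm (k x) powr q) \<partial>lborel) \<le>
          (\<integral>\<^sup>+x. ennreal C * (\<Sum>i<N. ennreal (p e i x powr q) + ennreal (s e i x powr q)) \<partial>lborel)"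
      proof (rule nn_integral_mono)
        fix x
        show "indicator \<Omega> x * ennreal (norm (k x) powr q) \<le>
            ennreal C * (\<Sum>i<N. ennreal (p e i x powr q) + ennreal (s e i x powr q))"
        proof (cases "x \<in> \<Omega>")
          case True
          have "norm (k x) powr q \<le> (B * ((\<Sum>i<N. p e i x) + (\<Sum>i<N. s e i x))) powr q"
            using q by (intro powr_mono2 k True) auto
          also note pw
          finally have "ennreal (norm (k x) powr q) \<le> ennreal (C * (\<Sum>i<N. p e i x powr q + s e i x powr q))"
            by (rule ennreal_leI)
          also have "\<dots> = ennreal C * (\<Sum>i<N. ennreal (p e i x powr q) + ennreal (s e i x powr q))"
            by (simp add: C_def ennreal_mult sum_nonneg sum_ennreal[symmetric] ennreal_plus)
          finally show ?thesis using True by simp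
        qed simp
      qed
      also have "\<dots> = E e"
        unfolding E_def Lq_mass_def p_def s_def
        by (simp add: nn_integral_cmult nn_integral_sum nn_integral_add)
      finally show ?thesis .
    qed
    have E0: "(E \<longlongrightarrow> 0) (at_right 0)"
    proof -
      have "((\<lambda>e. \<Sum>i<N. Lq_mass q (\<lambda>x. ?J e i x - g x) + Lq_mass q (\<lambda>x. ?H e i x - h x)) \<longlongrightarrow> (\<Sum>i<N. 0 + 0)) (at_right 0)"
        by (intro tendsto_sum tendsto_add Lq_mollifiable_tendsto Lq_mollifiable q g h)
      then have "((\<lambda>e. \<Sum>i<N. Lq_mass q (\<lambda>x. ?J e i x - g x) + Lq_mass q (\<lambda>x. ?H e i x - h x)) \<longlongrightarrow> 0) (at_right 0)"
        by simp
      from ennreal_tendsto_cmult[OF _ this, of "ennreal C"] show ?thesis by (simp add: E_def)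
    qed
    \<comment> \<open>With n + 2 in the denominator every member, the one for n = 0 included, lies
      strictly below \<delta>.\<close>
    define \<epsilon> where "\<epsilon> = (\<lambda>n. \<delta> / real (n + 2))"
    have \<epsilon>: "0 < \<epsilon> n" "\<epsilon> n < \<delta>" for n
      using \<delta>1 by (auto simp: \<epsilon>_def divide_less_eq)
    have "\<epsilon> \<longlonglongrightarrow> 0"
      unfolding \<epsilon>_def using LIMSEQ_ignore_initial_segment[OF lim_const_over_n[of \<delta>], of 2] by simp
    then have \<epsilon>0: "filterlim \<epsilon> (at_right 0) sequentially"
      using \<epsilon>(1) by (auto simp: filterlim_at less_imp_neq[symmetric])
    show thesis
    proof (rule that[of "\<lambda>n. F (\<epsilon> n)" "\<lambda>n. E (\<epsilon> n)"])
      show "F (\<epsilon> n) \<in> test_functions UNIV" for n by (rule F_test[OF \<epsilon>(1)])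
      show "norm (F (\<epsilon> n) x) \<le> M" if x: "x \<in> \<Omega>" for n x
      proof -
        have "norm (F (\<epsilon> n) x) \<le> (\<Sum>i<N. \<theta> i x * M)"
          unfolding F_def
        proof (rule order_trans[OF norm_sum], rule sum_mono)
          fix i assume "i \<in> {..<N}"
          then show "norm (\<theta> i x *\<^sub>R ?J (\<epsilon> n) i x) \<le> \<theta> i x * M"
            using \<theta>(2)[of i x] norm_mollify_le_bound[OF g(1) \<epsilon>(1) M, of n "a (c i)" x] by (simp add: mult_left_mono)
        qed
        also have "\<dots> = M" using sum1[OF x] by (simp flip: sum_distrib_right)
        finally show ?thesis .
      qed
      show "(\<lambda>n. E (\<epsilon> n)) \<longlonglongrightarrow> 0" by (rule filterlim_compose[OF E0 \<epsilon>0])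
      show "(\<integral>\<^sup>+x. indicator \<Omega> x * ennreal (norm (F (\<epsilon> n) x - g x) powr q) \<partial>lborel) \<le> E (\<epsilon> n)" for n
        by (rule bound[OF est1])
      show "(\<integral>\<^sup>+x. indicator \<Omega> x * ennreal (norm (divergence (F (\<epsilon> n)) x - h x) powr q) \<partial>lborel) \<le> E (\<epsilon> n)" for n
        by (rule bound[OF est2[OF _ \<epsilon>]])
      show "(\<lambda>n. F (\<epsilon> n) x) \<longlonglongrightarrow> l" if x: "x \<in> \<Omega>"
        and lp: "((\<lambda>r. (LINT y|lborel. indicator (ball x r) y * norm (g y - l)) / measure lborel (ball x r)) \<longlongrightarrow> 0) (at_right 0)" for x l
      proof -
        have "(\<lambda>n. F (\<epsilon> n) x) \<longlonglongrightarrow> (\<Sum>i<N. \<theta> i x *\<^sub>R l)"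
          unfolding F_def
          by (intro tendsto_sum tendsto_scaleR tendsto_const filterlim_compose[OF mollify_lebesgue_point[OF g(1) lp] \<epsilon>0])
        then show ?thesis using sum1[OF x] by (simp flip: scaleR_sum_left)
      qed
    qed
  qed
qed

lemma lebesgue_on_integral_le:
  fixes k :: "'a::euclidean_space \<Rightarrow> 'b::euclidean_space"
  assumes "open \<Omega>" "k \<in> borel_measurable (lebesgue_on \<Omega>)" "k' \<in> borel_measurable borel"
    and ae: "AE x in lebesgue. x \<in> \<Omega> \<longrightarrow> k x = k' x"
    and le: "(\<integral>\<^sup>+x. indicator \<Omega> x * ennreal (norm (k' x) powr q) \<partial>lborel) \<le> \<Phi>"
  shows "ennreal (LINT x|lebesgue_on \<Omega>. norm (k x) powr q) \<le> \<Phi>"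
proof -
  have [measurable]: "\<Omega> \<in> sets borel" "k' \<in> borel_measurable borel" using assms by simp_all
  have "ennreal (LINT x|lebesgue_on \<Omega>. norm (k x) powr q) \<le> (\<integral>\<^sup>+x. ennreal (norm (k x) powr q) \<partial>lebesgue_on \<Omega>)"
  \<comment> \<open>If the function fails to be integrable, its Bochner integral is 0 by convention
    and the inequality still holds.\<close>
  proof (cases "integrable (lebesgue_on \<Omega>) (\<lambda>x. norm (k x) powr q)")
    case True
    then show ?thesis by (simp add: nn_integral_eq_integral)
  qed (simp add: not_integrable_integral_eq)
  also have "\<dots> = (\<integral>\<^sup>+x. ennreal (norm (k x) powr q) * indicator \<Omega> x \<partial>lebesgue)"
    using assms(1) by (subst nn_integral_restrict_space) simp_all
  also have "\<dots> = (\<integral>\<^sup>+x. indicator \<Omega> x * ennreal (norm (k' x) powr q) \<partial>lebesgue)"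
  proof (rule nn_integral_cong_AE)
    show "AE x in lebesgue. ennreal (norm (k x) powr q) * indicator \<Omega> x = indicator \<Omega> x * ennreal (norm (k' x) powr q)"
      using ae by eventually_elim (auto simp: indicator_def)
  qed
  also have "\<dots> = (\<integral>\<^sup>+x. indicator \<Omega> x * ennreal (norm (k' x) powr q) \<partial>lborel)"
    by (rule nn_integral_completion)
  finally show ?thesis using le by (rule order_trans)
qed

lemma tendsto_0_if_ennreal_le:
  fixes X :: "nat \<Rightarrow> real"
  assumes "\<And>n. 0 \<le> X n" "\<And>n. ennreal (X n) \<le> \<Phi> n" "\<Phi> \<longlonglongrightarrow> 0"
  shows "X \<longlonglongrightarrow> 0"
proof -
  have "(\<lambda>n. ennreal (X n)) \<longlonglongrightarrow> 0"
    by (rule tendsto_sandwich[OF _ _ tendsto_const assms(3)]) (simp_all add: assms(2))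
  then have "(\<lambda>n. ennreal (X n)) \<longlonglongrightarrow> ennreal 0" by simp
  then show ?thesis
    by (subst (asm) tendsto_ennreal_iff) (simp_all add: assms(1))
qed

text \<open>Balls of small radius lie in \<Omega>, where both functions agree almost everywhere, so
  the averages coincide. The subtracted value remains \<open>g x\<close>; at the point x itself the
  representative may differ.\<close>

lemma lebesgue_point_lborel:
  fixes g :: "'a::euclidean_space \<Rightarrow> 'a"
  assumes "open \<Omega>" "lebesgue_point \<Omega> g x"
    and g': "g' \<in> borel_measurable borel" "AE y in lebesgue. y \<in> \<Omega> \<longrightarrow> g y = g' y"
  shows "((\<lambda>r. (LINT y|lborel. indicator (ball x r) y * norm (g' y - g x)) / measure lborel (ball x r)) \<longlongrightarrow> 0) (at_right 0)"
proof -
  have x: "x \<in> \<Omega>" and lp: "((\<lambda>r. (LINT y:ball x r|lebesgue. norm (g y - g x)) / measure lebesgue (ball x r)) \<longlongrightarrow> 0) (at_right 0)"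
    using assms(2) by (simp_all add: lebesgue_point_def)
  obtain R where R: "R > 0" "ball x R \<subseteq> \<Omega>"
    using assms(1) x by (auto simp: open_contains_ball)
  have "eventually (\<lambda>r. (LINT y:ball x r|lebesgue. norm (g y - g x)) / measure lebesgue (ball x r) =
      (LINT y|lborel. indicator (ball x r) y * norm (g' y - g x)) / measure lborel (ball x r)) (at_right 0)"
    unfolding eventually_at_right_field
  proof (rule exI[of _ R], intro conjI allI impI R(1))
    fix r :: real assume "0 < r" "r < R"
    then have sub: "ball x r \<subseteq> \<Omega>" using R(2) by (meson less_imp_le order_trans subset_ball)
    have m: "(\<lambda>y. indicator (ball x r) y * norm (g' y - g x)) \<in> borel_measurable borel"
      using g'(1) by (intro borel_measurable_times borel_measurable_indicator) simp_all
    have ae: "AE y in lebesgue. indicator (ball x r) y * norm (g' y - g x) = indicator (ball x r) y *\<^sub>R norm (g y - g x)"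
      using g'(2) by eventually_elim (use sub in \<open>auto simp: indicator_def\<close>)
    have ml: "(\<lambda>y. indicator (ball x r) y * norm (g' y - g x)) \<in> borel_measurable lebesgue"
      using m by (intro measurable_completion) simp
    have "(LINT y:ball x r|lebesgue. norm (g y - g x)) = (LINT y|lebesgue. indicator (ball x r) y * norm (g' y - g x))"
      unfolding set_lebesgue_integral_def
    proof (rule integral_cong_AE[OF _ ml])
      show "(\<lambda>y. indicator (ball x r) y *\<^sub>R norm (g y - g x)) \<in> borel_measurable lebesgue"
        by (rule borel_measurable_AE[OF ml ae])
      show "AE y in lebesgue. indicator (ball x r) y *\<^sub>R norm (g y - g x) = indicator (ball x r) y * norm (g' y - g x)"
        using ae by eventually_elim (simp only:)
    qed
    also have "\<dots> = (LINT y|lborel. indicator (ball x r) y * norm (g' y - g x))"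
      using m by (intro integral_completion) simp
    finally show "(LINT y:ball x r|lebesgue. norm (g y - g x)) / measure lebesgue (ball x r) =
      (LINT y|lborel. indicator (ball x r) y * norm (g' y - g x)) / measure lborel (ball x r)"
      by simp
  qed
  with lp show ?thesis by (rule Lim_transform_eventually)
qed

text \<open>A negative essential supremum of a norm would force \<Omega> to be a null set, which a
  nonempty open set is not; so the supremum is a nonnegative real.\<close>

lemma Lp_infinity_bound:
  fixes g :: "'a::euclidean_space \<Rightarrow> 'b::euclidean_space"
  assumes "open \<Omega>" "\<Omega> \<noteq> {}" "g \<in> Lp_space \<infinity> (lebesgue_on \<Omega>)"
  obtains M where "ereal M = norm_esssup (lebesgue_on \<Omega>) g" "AE x in lebesgue. x \<in> \<Omega> \<longrightarrow> norm (g x) \<le> M" "0 \<le> M"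
proof -
  have fin: "norm_esssup (lebesgue_on \<Omega>) g < \<infinity>"
    using assms(3) by (simp add: Lp_space_def)
  have ae: "AE x in lebesgue_on \<Omega>. ereal (norm (g x)) \<le> norm_esssup (lebesgue_on \<Omega>) g"
    unfolding norm_esssup_def by (rule esssup_AE)
  have nonneg: "0 \<le> norm_esssup (lebesgue_on \<Omega>) g"
  proof (rule ccontr)
    assume "\<not> 0 \<le> norm_esssup (lebesgue_on \<Omega>) g"
    then have neg: "norm_esssup (lebesgue_on \<Omega>) g < 0" by simp
    have "AE x in lebesgue. x \<notin> \<Omega>"
      using ae unfolding AE_lebesgue_on_open[OF assms(1)]
    proof eventually_elim
      case (elim x)
      have "\<not> ereal (norm (g x)) \<le> norm_esssup (lebesgue_on \<Omega>) g"
        using less_le_trans[OF neg, of "ereal (norm (g x))"] by (simp add: not_le)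
      with elim show ?case by blast
    qed
    then have "AE x in lborel. x \<notin> \<Omega>"
      by (simp only: AE_completion_iff)
    then have "\<Omega> \<in> null_sets lborel"
      using assms(1) by (subst AE_iff_null_sets) simp_all
    then have "negligible \<Omega>"
      by (simp add: negligible_iff_null_sets null_sets_completionI)
    then show False
      using open_not_negligible[OF assms(1,2)] by simp
  qed
  with fin obtain M where M: "norm_esssup (lebesgue_on \<Omega>) g = ereal M"
    by (cases "norm_esssup (lebesgue_on \<Omega>) g") auto
  show thesis
  proof (rule that[of M])
    show "AE x in lebesgue. x \<in> \<Omega> \<longrightarrow> norm (g x) \<le> M"
      using ae unfolding AE_lebesgue_on_open[OF assms(1)] M by eventually_elim auto
    show "0 \<le> M" using nonneg by (simp add: M)
  qed (simp add: M)
qed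

lemma test_function_mem_Wdiv:
  fixes G :: "'a::euclidean_space \<Rightarrow> 'a"
  assumes "open \<Omega>" "bounded \<Omega>" "1 \<le> q" "G \<in> test_functions UNIV"
  shows "G \<in> Wdiv q \<Omega>" "G \<in> Lp_space \<infinity> (lebesgue_on \<Omega>)"
proof -
  note sm = test_functions_smooth[OF assms(4)]
  have Lp: "f \<in> Lp_space (ereal q) (lebesgue_on \<Omega>)" "f \<in> Lp_space \<infinity> (lebesgue_on \<Omega>)"
    if f: "f \<in> borel_measurable borel" "\<And>x. norm (f x) \<le> B" for f :: "'a \<Rightarrow> 'b::euclidean_space" and B
  proof -
    have fm: "f \<in> borel_measurable (lebesgue_on \<Omega>)"
      using f(1) by (intro measurable_restrict_space1 measurable_completion) simp
    have fin: "emeasure (lebesgue_on \<Omega>) (space (lebesgue_on \<Omega>)) < \<infinity>"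
      using assms(1) emeasure_bounded_finite[OF assms(2)] by (simp add: space_restrict_space emeasure_restrict_space)
    have "integrable (lebesgue_on \<Omega>) (\<lambda>x. norm (f x) powr q)"
    proof (rule Bochner_Integration.integrable_bound)
      interpret finite_measure "lebesgue_on \<Omega>"
        by (rule finite_measureI) (use fin in simp)
      show "integrable (lebesgue_on \<Omega>) (\<lambda>x. B powr q)" by simp
      show "(\<lambda>x. norm (f x) powr q) \<in> borel_measurable (lebesgue_on \<Omega>)" using fm by measurable
      show "AE x in lebesgue_on \<Omega>. norm (norm (f x) powr q) \<le> norm (B powr q)"
        using f(2) assms(3) by (intro AE_I2) (simp add: powr_mono2)
    qed
    with fm show "f \<in> Lp_space (ereal q) (lebesgue_on \<Omega>)" by (simp add: Lp_space_ereal)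
    have "norm_esssup (lebesgue_on \<Omega>) f \<le> ereal B"
      unfolding norm_esssup_def using fm f(2) by (intro esssup_I) auto
    then show "f \<in> Lp_space \<infinity> (lebesgue_on \<Omega>)"
      using fm by (auto simp: Lp_space_def)
  qed
  obtain B where B: "\<And>x. norm (G x) \<le> B" using test_functions_bounded[OF assms(4)] by metis
  obtain B' where B': "\<And>x v. norm (frechet_derivative G (at x) v) \<le> B' * norm v"
    using test_functions_derivative_bounded[OF assms(4)] by metis
  have "norm (divergence G x) \<le> (\<Sum>b\<in>(Basis::'a set). B')" for x
    unfolding divergence_def
  proof (rule order_trans[OF norm_sum], rule sum_mono)
    fix b :: 'a assume b: "b \<in> Basis"
    show "norm (frechet_derivative G (at x) b \<bullet> b) \<le> B'"
      using order_trans[OF Basis_le_norm[OF b] B'[of x b]] b by simp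
  qed
  note L = Lp(1)[OF smooth_borel_measurable[OF smooth_divergence[OF sm]] this]
  show "G \<in> Wdiv q \<Omega>"
    unfolding Wdiv_def using Lp(1)[OF smooth_borel_measurable[OF sm] B] L is_weak_div_divergence[OF assms(1) sm] by blast
  show "G \<in> Lp_space \<infinity> (lebesgue_on \<Omega>)"
    by (rule Lp(2)[OF smooth_borel_measurable[OF sm] B])
qed

text \<open>The approximants are built from Borel representatives of g and of its divergence;
  integrals do not see the replacement, and at Lebesgue points the value of g itself is
  recovered.\<close>

theorem exists_smooth_trace_conv:
  fixes \<Omega> :: "'a::euclidean_space set"
  assumes dom: "bounded_lipschitz_domain \<Omega>" and q: "1 \<le> q"
    and g: "g \<in> Wdiv q \<Omega>" "g \<in> Lp_space \<infinity> (lebesgue_on \<Omega>)"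
  obtains G where "\<And>n. G n \<in> test_functions UNIV" "trace_conv \<Omega> q G g"
proof -
  have \<Omega>: "open \<Omega>" "bounded \<Omega>" "\<Omega> \<noteq> {}"
    using dom by (simp_all add: bounded_lipschitz_domain_def)
  obtain h where h: "h \<in> Lp_space (ereal q) (lebesgue_on \<Omega>)" "is_weak_div \<Omega> g h"
    using g(1) unfolding Wdiv_def by blast
  have gq: "g \<in> Lp_space (ereal q) (lebesgue_on \<Omega>)" using g(1) unfolding Wdiv_def by blast
  obtain g' where g': "g' \<in> borel_measurable borel" "\<And>x. x \<notin> \<Omega> \<Longrightarrow> g' x = 0"
    "AE x in lebesgue. x \<in> \<Omega> \<longrightarrow> g x = g' x" "integrable lborel g'" "integrable lborel (\<lambda>x. norm (g' x) powr q)"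
    by (rule Lp_representative[OF \<Omega>(1,2) q gq]) (rule that; assumption)
  obtain h' where h': "h' \<in> borel_measurable borel" "\<And>x. x \<notin> \<Omega> \<Longrightarrow> h' x = 0"
    "AE x in lebesgue. x \<in> \<Omega> \<longrightarrow> h x = h' x" "integrable lborel h'" "integrable lborel (\<lambda>x. norm (h' x) powr q)"
    by (rule Lp_representative[OF \<Omega>(1,2) q h(1)]) (rule that; assumption)
  obtain M where M: "ereal M = norm_esssup (lebesgue_on \<Omega>) g" "AE x in lebesgue. x \<in> \<Omega> \<longrightarrow> norm (g x) \<le> M" "0 \<le> M"
    by (rule Lp_infinity_bound[OF \<Omega>(1,3) g(2)])
  \<comment> \<open>Outside \<Omega> the representative is 0, so 0 \<le> M extends the bound to the
    whole space.\<close>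
  have "AE x in lebesgue. norm (g' x) \<le> M"
    using M(2) g'(3) by eventually_elim (metis M(3) g'(2) norm_zero)
  then have M': "AE x in lborel. norm (g' x) \<le> M"
    by (simp only: AE_completion_iff)
  note wd = is_weak_div_lborel[OF \<Omega>(1) h(2) g'(1-3) h'(1-3)]
  show thesis
  proof (rule exists_smooth_approximants[OF dom q g'(4,5) h'(4,5) wd M'])
    fix G :: "nat \<Rightarrow> 'a \<Rightarrow> 'a" and \<Phi> :: "nat \<Rightarrow> ennreal"
    assume G: "\<And>n. G n \<in> test_functions UNIV" and bd: "\<And>n x. x \<in> \<Omega> \<Longrightarrow> norm (G n x) \<le> M" and \<Phi>: "\<Phi> \<longlonglongrightarrow> 0"
      and 1: "\<And>n. (\<integral>\<^sup>+x. indicator \<Omega> x * ennreal (norm (G n x - g' x) powr q) \<partial>lborel) \<le> \<Phi> n"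
      and 2: "\<And>n. (\<integral>\<^sup>+x. indicator \<Omega> x * ennreal (norm (divergence (G n) x - h' x) powr q) \<partial>lborel) \<le> \<Phi> n"
      and pt: "\<And>x c. x \<in> \<Omega> \<Longrightarrow> ((\<lambda>r. (LINT y|lborel. indicator (ball x r) y * norm (g' y - c)) / measure lborel (ball x r)) \<longlongrightarrow> 0) (at_right 0)
        \<Longrightarrow> (\<lambda>n. G n x) \<longlonglongrightarrow> c"
    note sm = test_functions_smooth[OF G]
    note W = test_function_mem_Wdiv[OF \<Omega>(1,2) q G]
    have wdn: "is_weak_div \<Omega> (\<lambda>x. G n x - g x) (\<lambda>x. divergence (G n) x - h x)" for n
      by (rule is_weak_div_diff[OF \<Omega>(1) is_weak_div_divergence[OF \<Omega>(1) sm] h(2)])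
    let ?A = "\<lambda>n. LINT x|lebesgue_on \<Omega>. norm (G n x - g x) powr q"
    let ?B = "\<lambda>n. LINT x|lebesgue_on \<Omega>. norm (divergence (G n) x - h x) powr q"
    have A: "?A \<longlonglongrightarrow> 0"
    proof (rule tendsto_0_if_ennreal_le[OF _ _ \<Phi>])
      fix n
      show "ennreal (?A n) \<le> \<Phi> n"
      proof (rule lebesgue_on_integral_le[OF \<Omega>(1) _ _ _ 1])
        show "(\<lambda>x. G n x - g x) \<in> borel_measurable (lebesgue_on \<Omega>)"
          by (rule loc_integrable_measurable[OF \<Omega>(1) is_weak_divD(1)[OF wdn]])
        show "(\<lambda>x. G n x - g' x) \<in> borel_measurable borel"
          by (rule borel_measurable_diff[OF smooth_borel_measurable[OF sm] g'(1)])
        show "AE x in lebesgue. x \<in> \<Omega> \<longrightarrow> G n x - g x = G n x - g' x"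
          using g'(3) by eventually_elim simp
      qed
    qed (simp add: integral_nonneg_AE)
    have B: "?B \<longlonglongrightarrow> 0"
    proof (rule tendsto_0_if_ennreal_le[OF _ _ \<Phi>])
      fix n
      show "ennreal (?B n) \<le> \<Phi> n"
      proof (rule lebesgue_on_integral_le[OF \<Omega>(1) _ _ _ 2])
        show "(\<lambda>x. divergence (G n) x - h x) \<in> borel_measurable (lebesgue_on \<Omega>)"
          by (rule loc_integrable_measurable[OF \<Omega>(1) is_weak_divD(2)[OF wdn]])
        show "(\<lambda>x. divergence (G n) x - h' x) \<in> borel_measurable borel"
          by (rule borel_measurable_diff[OF smooth_borel_measurable[OF smooth_divergence[OF sm]] h'(1)])
        show "AE x in lebesgue. x \<in> \<Omega> \<longrightarrow> divergence (G n) x - h x = divergence (G n) x - h' x"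
          using h'(3) by eventually_elim simp
      qed
    qed (simp add: integral_nonneg_AE)
    have "trace_conv \<Omega> q G g"
      unfolding trace_conv_def
    proof (intro conjI allI impI)
      show "g \<in> Wdiv q \<Omega> \<inter> Lp_space \<infinity> (lebesgue_on \<Omega>)" using g by simp
      show "continuous_on (closure \<Omega>) (G n)" for n by (rule smooth_continuous_on[OF sm])
      show "G n \<in> Wdiv q \<Omega>" for n by (rule W(1))
      have "(\<lambda>n. ?A n + ?B n) \<longlonglongrightarrow> 0" using tendsto_add[OF A B] by simp
      then have "(\<lambda>n. (?A n + ?B n) powr (1 / q)) \<longlonglongrightarrow> 0"
        by (rule tendsto_zero_powrI[OF _ tendsto_const]) (use q in \<open>auto simp: integral_nonneg_AE\<close>)
      then show "(\<lambda>n. Wdiv_norm q \<Omega> (\<lambda>x. G n x - g x)) \<longlonglongrightarrow> 0"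
        by (simp only: Wdiv_norm_eq[OF \<Omega>(1) q wdn])
      show "norm_esssup (lebesgue_on \<Omega>) (G n) \<le> norm_esssup (lebesgue_on \<Omega>) g" for n
        unfolding M(1)[symmetric] unfolding norm_esssup_def
      proof (rule esssup_I)
        have "G n \<in> borel_measurable (lebesgue_on \<Omega>)"
          using smooth_borel_measurable[OF sm, of n] by (intro measurable_restrict_space1 measurable_completion) simp
        then show "(\<lambda>x. ereal (norm (G n x))) \<in> borel_measurable (lebesgue_on \<Omega>)" by measurable
        show "AE x in lebesgue_on \<Omega>. ereal (norm (G n x)) \<le> ereal M"
          using bd by (intro AE_I2) (simp add: space_restrict_space)
      qed
      show "(\<lambda>n. G n x) \<longlonglongrightarrow> g x" if lp: "lebesgue_point \<Omega> g x" for x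
      proof (rule pt)
        show "x \<in> \<Omega>" using lp by (simp add: lebesgue_point_def)
        show "((\<lambda>r. (LINT y|lborel. indicator (ball x r) y * norm (g' y - g x)) / measure lborel (ball x r)) \<longlongrightarrow> 0) (at_right 0)"
          by (rule lebesgue_point_lborel[OF \<Omega>(1) lp g'(1,3)])
      qed
    qed
    with G show thesis by (rule that)
  qed
qed


section \<open>The measure |Du| and the full trace of continuous fields\<close>

section \<open>The variation measure and its polar density\<close>

lemma variation_measure_space_sets:
  fixes \<Omega> :: "'a::euclidean_space set"
  shows "space (variation_measure \<Omega> \<nu>) = \<Omega>"
    and "sets (variation_measure \<Omega> \<nu>) = sets (restrict_space borel \<Omega>)"
proof -
  have sp: "space (restrict_space (borel :: 'a measure) \<Omega>) = \<Omega>"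
    by (simp add: space_restrict_space)
  have sub: "sets (restrict_space borel \<Omega>) \<subseteq> Pow \<Omega>"
    using sets.space_closed[of "restrict_space (borel :: 'a measure) \<Omega>"] by (simp add: sp)
  show "space (variation_measure \<Omega> \<nu>) = \<Omega>"
    unfolding variation_measure_def by (rule space_measure_of[OF sub])
  show "sets (variation_measure \<Omega> \<nu>) = sets (restrict_space borel \<Omega>)"
    unfolding variation_measure_def sets_measure_of[OF sub]
    using sets.sigma_sets_eq[of "restrict_space (borel :: 'a measure) \<Omega>"] by (simp add: sp)
qed

text \<open>By the convention for \<^const>\<open>measure_of\<close>, the variation measure is zero in case the
  variation should fail to be countably additive. All statements about it then hold trivially, so
  that countable additivity need not be established.\<close>

lemma variation_measure_cases:
  fixes \<Omega> :: "'a::euclidean_space set"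
  shows "(\<forall>A\<in>sets (variation_measure \<Omega> \<nu>). emeasure (variation_measure \<Omega> \<nu>) A = variation \<Omega> \<nu> A) \<or>
    (\<forall>A. emeasure (variation_measure \<Omega> \<nu>) A = 0)"
proof -
  have sub: "sets (restrict_space borel \<Omega>) \<subseteq> Pow \<Omega>"
    using sets.space_closed[of "restrict_space (borel :: 'a measure) \<Omega>"] by (simp add: space_restrict_space)
  show ?thesis
    using sets_measure_of[OF sub, of "variation \<Omega> \<nu>"] unfolding variation_measure_def emeasure_measure_of_conv by auto
qed

lemma finite_measure_variation_measure:
  fixes \<Omega> :: "'a::euclidean_space set"
  assumes "finite_vector_measure \<Omega> \<nu>"
  shows "finite_measure (variation_measure \<Omega> \<nu>)"
proof (rule finite_measureI)
  have "variation \<Omega> \<nu> \<Omega> < \<infinity>" using assms unfolding finite_vector_measure_def by blast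
  moreover have "\<Omega> \<in> sets (variation_measure \<Omega> \<nu>)"
    using sets.top[of "variation_measure \<Omega> \<nu>"] by (simp add: variation_measure_space_sets)
  ultimately show "emeasure (variation_measure \<Omega> \<nu>) (space (variation_measure \<Omega> \<nu>)) \<noteq> \<infinity>"
    using variation_measure_cases[of \<Omega> \<nu>] by (auto simp: variation_measure_space_sets)
qed

text \<open>Additivity along the constant sequence of empty sets makes a constant series
  converge.\<close>

lemma finite_vector_measure_empty:
  fixes \<Omega> :: "'a::euclidean_space set"
  assumes "finite_vector_measure \<Omega> \<nu>"
  shows "\<nu> {} = 0"
proof -
  have "(\<lambda>n. \<nu> ((\<lambda>_::nat. {}) n)) sums \<nu> (\<Union>n. (\<lambda>_::nat. {}) n)"
    using assms unfolding finite_vector_measure_def by (auto simp: disjoint_family_on_def)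
  then have "summable (\<lambda>n::nat. \<nu> {})" by (auto dest: sums_summable)
  then show ?thesis by (simp add: summable_const_iff)
qed

lemma norm_le_variation:
  fixes \<Omega> :: "'a::euclidean_space set"
  assumes "finite_vector_measure \<Omega> \<nu>" "A \<in> sets (restrict_space borel \<Omega>)"
  shows "ennreal (norm (\<nu> A)) \<le> variation \<Omega> \<nu> A"
proof -
  let ?E = "\<lambda>n::nat. if n = 0 then A else {}"
  have "(\<Sum>n. ennreal (norm (\<nu> (?E n)))) = (\<Sum>n\<in>{0}. ennreal (norm (\<nu> (?E n))))"
    by (rule suminf_finite) (simp_all add: finite_vector_measure_empty[OF assms(1)])
  then have "ennreal (norm (\<nu> A)) = (\<Sum>n. ennreal (norm (\<nu> (?E n))))" by simp
  also have "\<dots> \<le> variation \<Omega> \<nu> A"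
    unfolding variation_def
    by (rule SUP_upper) (use assms(2) in \<open>auto simp: disjoint_family_on_def\<close>)
  finally show ?thesis .
qed

text \<open>A coordinate of \<nu> is a signed measure dominated by the variation, so adding the
  variation makes it nonnegative and Radon-Nikodym applies. Subtracting 1 from the density obtained
  gives the coordinate of the polar density.\<close>

lemma exists_polar_density:
  fixes \<Omega> :: "'a::euclidean_space set"
  assumes fin: "finite_vector_measure \<Omega> \<nu>"
    and var: "\<And>A. A \<in> sets (variation_measure \<Omega> \<nu>) \<Longrightarrow> emeasure (variation_measure \<Omega> \<nu>) A = variation \<Omega> \<nu> A"
  shows "\<exists>\<sigma>. integrable (variation_measure \<Omega> \<nu>) \<sigma> \<and>
    (\<forall>A\<in>sets (restrict_space borel \<Omega>). \<nu> A = set_lebesgue_integral (variation_measure \<Omega> \<nu>) A \<sigma>)"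
proof -
  let ?\<mu> = "variation_measure \<Omega> \<nu>"
  interpret finite_measure ?\<mu> by (rule finite_measure_variation_measure[OF fin])
  note ss = variation_measure_space_sets[of \<Omega> \<nu>]
  have le: "norm (\<nu> A) \<le> measure ?\<mu> A" if "A \<in> sets ?\<mu>" for A
  proof -
    have "ennreal (norm (\<nu> A)) \<le> ennreal (measure ?\<mu> A)"
      using norm_le_variation[OF fin, of A] that var[OF that] by (simp add: ss emeasure_eq_measure)
    then show ?thesis by (subst (asm) ennreal_le_iff) simp_all
  qed
  have "\<exists>s. integrable ?\<mu> s \<and> (\<forall>A\<in>sets ?\<mu>. \<nu> A \<bullet> b = (LINT x|?\<mu>. indicator A x * s x))" if b: "b \<in> Basis" for b
  proof -
    let ?m = "\<lambda>A. measure ?\<mu> A + \<nu> A \<bullet> b"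
    define N where "N = measure_of \<Omega> (sets ?\<mu>) (\<lambda>A. ennreal (?m A))"
    have m0: "0 \<le> ?m A" if "A \<in> sets ?\<mu>" for A
      using le[OF that] Basis_le_norm[OF b, of "\<nu> A"] by linarith
    have sub: "sets ?\<mu> \<subseteq> Pow \<Omega>" using sets.space_closed[of ?\<mu>] by (simp add: ss(1))
    have sN: "sets N = sets ?\<mu>"
      unfolding N_def sets_measure_of[OF sub] using sets.sigma_sets_eq[of ?\<mu>] by (simp add: ss(1))
    have eN: "emeasure N A = ennreal (?m A)" if "A \<in> sets ?\<mu>" for A
      unfolding N_def
    proof (rule emeasure_measure_of_sigma[OF _ _ _ that])
      show "sigma_algebra \<Omega> (sets ?\<mu>)" using sets.sigma_algebra_axioms[of ?\<mu>] by (simp add: ss(1))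
      show "positive (sets ?\<mu>) (\<lambda>A. ennreal (?m A))"
        by (simp add: positive_def finite_vector_measure_empty[OF fin])
      show "countably_additive (sets ?\<mu>) (\<lambda>A. ennreal (?m A))"
      proof (rule countably_additiveI)
        fix A :: "nat \<Rightarrow> 'a set"
        assume A: "range A \<subseteq> sets ?\<mu>" "disjoint_family A" "(\<Union>i. A i) \<in> sets ?\<mu>"
        have "(\<lambda>i. \<nu> (A i)) sums \<nu> (\<Union>i. A i)"
          using fin A unfolding finite_vector_measure_def ss by blast
        then have "(\<lambda>i. \<nu> (A i) \<bullet> b) sums (\<nu> (\<Union>i. A i) \<bullet> b)"
          by (rule bounded_linear.sums[OF bounded_linear_inner_left])
        then have "(\<lambda>i. ?m (A i)) sums ?m (\<Union>i. A i)"
          by (intro sums_add finite_measure_UNION A)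
        then show "(\<Sum>i. ennreal (?m (A i))) = ennreal (?m (\<Union>i. A i))"
          by (rule suminf_ennreal_eq[rotated]) (use A(1) m0 in blast)
      qed
    qed
    have "absolutely_continuous ?\<mu> N"
      unfolding absolutely_continuous_def
    proof
      fix A assume "A \<in> null_sets ?\<mu>"
      then have A: "A \<in> sets ?\<mu>" "measure ?\<mu> A = 0" by (auto simp: measure_eq_0_null_sets)
      then have "\<nu> A = 0" using le[OF A(1)] by simp
      then show "A \<in> null_sets N" using A eN[OF A(1)] sN by (simp add: null_sets_def)
    qed
    from Radon_Nikodym[OF this sN] obtain f where f: "f \<in> borel_measurable ?\<mu>" "density ?\<mu> f = N" by blast
    have fN: "(\<integral>\<^sup>+x. f x * indicator A x \<partial>?\<mu>) = ennreal (?m A)" if "A \<in> sets ?\<mu>" for A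
      using emeasure_density[OF f(1) that] eN[OF that] f(2) by simp
    have "(\<integral>\<^sup>+x. f x \<partial>?\<mu>) = (\<integral>\<^sup>+x. f x * indicator (space ?\<mu>) x \<partial>?\<mu>)"
      by (rule nn_integral_cong) simp
    also have "\<dots> = ennreal (?m (space ?\<mu>))" by (rule fN) simp
    finally have f_fin: "(\<integral>\<^sup>+x. f x \<partial>?\<mu>) \<noteq> \<infinity>" by simp
    have aef: "AE x in ?\<mu>. f x \<noteq> \<infinity>" by (rule nn_integral_PInf_AE[OF f(1) f_fin])
    have e2: "(\<integral>\<^sup>+x. ennreal (enn2real (f x) * indicator A x) \<partial>?\<mu>) = ennreal (?m A)" if "A \<in> sets ?\<mu>" for A
    proof -
      have "(\<integral>\<^sup>+x. ennreal (enn2real (f x) * indicator A x) \<partial>?\<mu>) = (\<integral>\<^sup>+x. f x * indicator A x \<partial>?\<mu>)"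
        using aef by (intro nn_integral_cong_AE, eventually_elim) (auto simp: indicator_def less_top)
      with fN[OF that] show ?thesis by simp
    qed
    have fr [measurable]: "(\<lambda>x. enn2real (f x)) \<in> borel_measurable ?\<mu>" using f(1) by measurable
    have hb: "has_bochner_integral ?\<mu> (\<lambda>x. enn2real (f x) * indicator A x) (?m A)" if A: "A \<in> sets ?\<mu>" for A
      by (rule has_bochner_integral_nn_integral[OF _ _ _ e2[OF A]]) (use A m0[OF A] in auto)
    have "integrable ?\<mu> (\<lambda>x. enn2real (f x))"
    proof -
      have "integrable ?\<mu> (\<lambda>x. enn2real (f x) * indicator (space ?\<mu>) x)"
        using hb[OF sets.top] by (simp add: has_bochner_integral_iff)
      then show ?thesis by (subst Bochner_Integration.integrable_cong[OF refl]) (auto simp: indicator_def)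
    qed
    then have "integrable ?\<mu> (\<lambda>x. enn2real (f x) - 1)" by simp
    moreover have "\<nu> A \<bullet> b = (LINT x|?\<mu>. indicator A x * (enn2real (f x) - 1))" if A: "A \<in> sets ?\<mu>" for A
    proof -
      have "(LINT x|?\<mu>. indicator A x * (enn2real (f x) - 1)) = (LINT x|?\<mu>. enn2real (f x) * indicator A x - indicator A x)"
        by (simp add: algebra_simps)
      also have "\<dots> = ?m A - measure ?\<mu> A"
        using hb[OF A] A by (subst Bochner_Integration.integral_diff)
          (auto simp: has_bochner_integral_iff integrable_indicator_iff emeasure_eq_measure)
      finally show ?thesis by simp
    qed
    ultimately show ?thesis by blast
  qed
  then obtain s where s: "\<And>b. b \<in> Basis \<Longrightarrow> integrable ?\<mu> (s b)"
    "\<And>b A. b \<in> Basis \<Longrightarrow> A \<in> sets ?\<mu> \<Longrightarrow> \<nu> A \<bullet> b = (LINT x|?\<mu>. indicator A x * s b x)"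
    by metis
  let ?\<sigma> = "\<lambda>x. \<Sum>b\<in>Basis. s b x *\<^sub>R b"
  have "integrable ?\<mu> ?\<sigma>" by (intro Bochner_Integration.integrable_sum integrable_scaleR_left s)
  moreover have "\<nu> A = set_lebesgue_integral ?\<mu> A ?\<sigma>" if "A \<in> sets (restrict_space borel \<Omega>)" for A
  proof -
    have A: "A \<in> sets ?\<mu>" using that by (simp add: ss)
    have i: "integrable ?\<mu> (\<lambda>x. indicator A x * s b x)" if "b \<in> Basis" for b
      using integrable_mult_indicator[OF A s(1)[OF that]] by simp
    have "set_lebesgue_integral ?\<mu> A ?\<sigma> = (LINT x|?\<mu>. (\<Sum>b\<in>Basis. (indicator A x * s b x) *\<^sub>R b))"
      unfolding set_lebesgue_integral_def by (simp add: scaleR_sum_right)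
    also have "\<dots> = (\<Sum>b\<in>Basis. (LINT x|?\<mu>. indicator A x * s b x) *\<^sub>R b)"
      using i by (subst Bochner_Integration.integral_sum) (auto intro!: sum.cong integrable_scaleR_left)
    also have "\<dots> = (\<Sum>b\<in>Basis. (\<nu> A \<bullet> b) *\<^sub>R b)" using s(2)[OF _ A] by simp
    finally show ?thesis by (simp add: euclidean_representation)
  qed
  ultimately show ?thesis by blast
qed

text \<open>For a unit vector c let D be the set where the component of the density along c exceeds
  1. The integral of the excess over D is the component of \<nu>(D) minus the variation of D, hence
  not positive, and D is null. With the basis vectors and their negatives as c, each coordinate is
  at most 1 in modulus, which bounds the norm by \<open>DIM('a)\<close>.\<close>

lemma polar_density_bounded:
  fixes \<Omega> :: "'a::euclidean_space set"
  assumes fin: "finite_vector_measure \<Omega> \<nu>"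
    and var: "\<And>A. A \<in> sets (variation_measure \<Omega> \<nu>) \<Longrightarrow> emeasure (variation_measure \<Omega> \<nu>) A = variation \<Omega> \<nu> A"
  shows "polar_density \<Omega> \<nu> \<in> borel_measurable (variation_measure \<Omega> \<nu>)"
    and "AE x in variation_measure \<Omega> \<nu>. norm (polar_density \<Omega> \<nu> x) \<le> DIM('a)"
proof -
  let ?\<mu> = "variation_measure \<Omega> \<nu>" and ?\<sigma> = "polar_density \<Omega> \<nu>"
  interpret finite_measure ?\<mu> by (rule finite_measure_variation_measure[OF fin])
  note ss = variation_measure_space_sets[of \<Omega> \<nu>]
  have \<sigma>: "integrable ?\<mu> ?\<sigma>" "\<forall>A\<in>sets (restrict_space borel \<Omega>). \<nu> A = set_lebesgue_integral ?\<mu> A ?\<sigma>"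
    using someI_ex[OF exists_polar_density[OF fin var]] unfolding polar_density_def by blast+
  show m: "?\<sigma> \<in> borel_measurable ?\<mu>" using \<sigma>(1) by (rule borel_measurable_integrable)
  have le1: "AE x in ?\<mu>. ?\<sigma> x \<bullet> c \<le> 1" if c: "norm c = 1" for c
  proof -
    let ?h = "\<lambda>x. ?\<sigma> x \<bullet> c - 1"
    define D where "D = {x \<in> space ?\<mu>. 0 < ?h x}"
    have h: "integrable ?\<mu> ?h" using \<sigma>(1) by simp
    have D: "D \<in> sets ?\<mu>" unfolding D_def using borel_measurable_integrable[OF h] by measurable
    have ih: "integrable ?\<mu> (\<lambda>x. indicator D x * ?h x)" using integrable_mult_indicator[OF D h] by simp
    have "(LINT x|?\<mu>. indicator D x * ?h x) = (LINT x|?\<mu>. (indicator D x *\<^sub>R ?\<sigma> x) \<bullet> c - indicator D x)"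
      by (simp add: algebra_simps)
    also have "\<dots> = \<nu> D \<bullet> c - measure ?\<mu> D"
    proof -
      note i = integrable_mult_indicator[OF D \<sigma>(1)]
      have "(LINT x|?\<mu>. (indicator D x *\<^sub>R ?\<sigma> x) \<bullet> c) = \<nu> D \<bullet> c"
        using \<sigma>(2) D i unfolding ss set_lebesgue_integral_def by (subst integral_inner_left) auto
      moreover have "integrable ?\<mu> (indicator D :: 'a \<Rightarrow> real)"
        using D by (simp add: integrable_indicator_iff emeasure_eq_measure)
      ultimately show ?thesis
        using D Bochner_Integration.integral_diff[OF integrable_inner_left[of c, OF i], of "indicator D"] by simp
    qed
    also have "\<nu> D \<bullet> c \<le> norm (\<nu> D)"
      using norm_cauchy_schwarz[of "\<nu> D" c] c by simp
    also have "norm (\<nu> D) \<le> measure ?\<mu> D"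
    proof -
      have "ennreal (norm (\<nu> D)) \<le> ennreal (measure ?\<mu> D)"
        using norm_le_variation[OF fin, of D] D var[OF D] by (simp add: ss emeasure_eq_measure)
      then show ?thesis by (subst (asm) ennreal_le_iff) simp_all
    qed
    finally have "(LINT x|?\<mu>. indicator D x * ?h x) \<le> 0" by simp
    moreover have nn: "0 \<le> indicator D x * ?h x" for x by (auto simp: D_def indicator_def)
    ultimately have "(LINT x|?\<mu>. indicator D x * ?h x) = 0"
      by (intro antisym Bochner_Integration.integral_nonneg)
    then have "AE x in ?\<mu>. indicator D x * ?h x = 0"
      using integral_nonneg_eq_0_iff_AE[OF ih] nn by simp
    with AE_space show ?thesis
      by eventually_elim (auto simp: D_def indicator_def split: if_splits)
  qed
  have "AE x in ?\<mu>. \<forall>b\<in>Basis. ?\<sigma> x \<bullet> b \<le> 1 \<and> ?\<sigma> x \<bullet> (- b) \<le> 1"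
    using le1 by (subst AE_ball_countable) (auto simp: countable_finite simp del: inner_minus_right)
  then show "AE x in ?\<mu>. norm (?\<sigma> x) \<le> DIM('a)"
  proof eventually_elim
    case (elim x)
    have "norm (?\<sigma> x) \<le> (\<Sum>b\<in>Basis. \<bar>?\<sigma> x \<bullet> b\<bar>)" by (rule norm_le_l1)
    also have "\<dots> \<le> (\<Sum>b\<in>(Basis::'a set). 1)"
      using elim by (intro sum_mono) (auto simp: abs_le_iff)
    finally show ?case by simp
  qed
qed

lemma BV_gradient_measure: "u \<in> BV \<Omega> \<Longrightarrow> is_gradient_measure \<Omega> u (gradient_measure \<Omega> u)"
  unfolding BV_def gradient_measure_def using someI_ex[of "is_gradient_measure \<Omega> u"] by blast

lemma TV_space_sets:
  fixes \<Omega> :: "'a::euclidean_space set"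
  shows "space (TV \<Omega> u) = \<Omega>" "sets (TV \<Omega> u) = sets (restrict_space borel \<Omega>)"
  unfolding TV_def by (rule variation_measure_space_sets)+

lemma finite_measure_TV:
  fixes \<Omega> :: "'a::euclidean_space set"
  assumes "u \<in> BV \<Omega>" shows "finite_measure (TV \<Omega> u)"
  unfolding TV_def
  by (rule finite_measure_variation_measure) (use BV_gradient_measure[OF assms] in \<open>simp add: is_gradient_measure_def\<close>)

text \<open>The density is under control only if the variation measure has its intended values; the
  other alternative is the zero measure, and later arguments split accordingly.\<close>

lemma TV_cases:
  fixes \<Omega> :: "'a::euclidean_space set"
  assumes "u \<in> BV \<Omega>"
  obtains "\<And>A. emeasure (TV \<Omega> u) A = 0"
    | "TV_density \<Omega> u \<in> borel_measurable (TV \<Omega> u)" "AE x in TV \<Omega> u. norm (TV_density \<Omega> u x) \<le> DIM('a)"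
proof -
  have fin: "finite_vector_measure \<Omega> (gradient_measure \<Omega> u)"
    using BV_gradient_measure[OF assms] by (simp add: is_gradient_measure_def)
  show thesis
    using variation_measure_cases[of \<Omega> "gradient_measure \<Omega> u"]
  proof
    assume "\<forall>A\<in>sets (variation_measure \<Omega> (gradient_measure \<Omega> u)).
      emeasure (variation_measure \<Omega> (gradient_measure \<Omega> u)) A = variation \<Omega> (gradient_measure \<Omega> u) A"
    then show thesis
      by (intro that(2)[unfolded TV_def TV_density_def, OF polar_density_bounded[OF fin]]) simp_all
  qed (use that(1) in \<open>simp add: TV_def\<close>)
qed

lemma TV_integral_gradient:
  fixes \<Omega> :: "'a::euclidean_space set"
  assumes "u \<in> BV \<Omega>" "\<psi> \<in> test_functions \<Omega>"
  shows "(LINT x|lebesgue_on \<Omega>. u x *\<^sub>R gradient \<psi> x) = - (LINT x|TV \<Omega> u. \<psi> x *\<^sub>R TV_density \<Omega> u x)"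
  using bspec[OF conjunct2[OF BV_gradient_measure[OF assms(1), unfolded is_gradient_measure_def]] assms(2)]
  by (simp add: vector_measure_integral_def TV_def TV_density_def)

lemma continuous_on_TV_measurable:
  fixes \<Omega> :: "'a::euclidean_space set"
  assumes "open \<Omega>" "continuous_on \<Omega> f"
  shows "f \<in> borel_measurable (TV \<Omega> u)"
  unfolding measurable_cong_sets[OF TV_space_sets(2) refl]
  by (rule borel_measurable_continuous_on_restrict[OF assms(2)])

text \<open>The fundamental lemma concerns measures on all Borel sets of the space, so the measure
  on \<Omega> is pushed forward along the inclusion and the difference extended by zero.\<close>

lemma TV_AE_eq:
  fixes \<Omega> :: "'a::euclidean_space set" and v w :: "'a \<Rightarrow> real"
  assumes "open \<Omega>" "u \<in> BV \<Omega>" and v: "integrable (TV \<Omega> u) v" and w: "integrable (TV \<Omega> u) w"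
    and eq: "\<And>\<psi>. \<psi> \<in> test_functions \<Omega> \<Longrightarrow> (LINT x|TV \<Omega> u. v x * \<psi> x) = (LINT x|TV \<Omega> u. w x * \<psi> x)"
  shows "AE x in TV \<Omega> u. v x = w x"
proof -
  let ?\<mu> = "TV \<Omega> u"
  let ?f = "\<lambda>x. indicator \<Omega> x *\<^sub>R (v x - w x)"
  have d: "integrable ?\<mu> (\<lambda>x. v x - w x)" using v w by simp
  have "(\<lambda>x. v x - w x) \<in> borel_measurable (restrict_space borel \<Omega>)"
    using borel_measurable_integrable[OF d] unfolding measurable_cong_sets[OF TV_space_sets(2) refl] .
  then have f: "?f \<in> borel_measurable borel"
    using assms(1) by (subst (asm) borel_measurable_restrict_space_iff) simp_all
  have id: "(\<lambda>x. x) \<in> measurable ?\<mu> borel"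
    unfolding measurable_cong_sets[OF TV_space_sets(2) refl] by (rule measurable_restrict_space1) simp
  let ?N = "distr ?\<mu> borel (\<lambda>x. x)"
  have fi: "integrable ?\<mu> ?f"
    by (subst Bochner_Integration.integrable_cong[OF refl, of _ _ "\<lambda>x. v x - w x"]) (use d in \<open>auto simp: TV_space_sets\<close>)
  have int: "integrable ?\<mu> (\<lambda>x. k x * ?f x)" if k: "k \<in> borel_measurable borel" "\<And>x. norm (k x) \<le> B" for k :: "'a \<Rightarrow> real" and B
  proof (rule Bochner_Integration.integrable_bound)
    show "integrable ?\<mu> (\<lambda>x. B * ?f x)" using fi by simp
    show "(\<lambda>x. k x * ?f x) \<in> borel_measurable ?\<mu>"
      using measurable_compose[OF id k(1)] borel_measurable_integrable[OF fi] by simp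
    show "AE x in ?\<mu>. norm (k x * ?f x) \<le> norm (B * ?f x)"
      unfolding norm_mult using order_trans[OF k(2) abs_ge_self] by (intro AE_I2 mult_right_mono) simp_all
  qed
  have "AE x in ?N. x \<in> \<Omega> \<longrightarrow> ?f x = 0"
  proof (rule AE_zero_if_test_integrals_zero[OF _ assms(1) f])
    fix K :: "'a set" assume "compact K"
    then have Km: "indicator K \<in> borel_measurable (borel :: 'a measure)" by (intro borel_measurable_indicator borel_closed compact_imp_closed)
    show "integrable ?N (\<lambda>x. indicator K x * ?f x)"
      using int[OF Km, of 1] borel_measurable_times[OF Km f]
      by (subst integrable_distr_eq[OF id]) (auto simp: indicator_def)
  next
    fix \<psi> :: "'a \<Rightarrow> real" assume \<psi>: "\<psi> \<in> test_functions \<Omega>"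
    note sm = smooth_borel_measurable[OF test_functions_smooth[OF \<psi>]]
    obtain B where B: "\<And>x. norm (\<psi> x) \<le> B" using test_functions_bounded[OF \<psi>] by metis
    have i: "integrable ?\<mu> (\<lambda>x. k x * \<psi> x)" if "integrable ?\<mu> k" for k :: "'a \<Rightarrow> real"
    proof (rule Bochner_Integration.integrable_bound)
      show "integrable ?\<mu> (\<lambda>x. B * k x)" using that by simp
      show "(\<lambda>x. k x * \<psi> x) \<in> borel_measurable ?\<mu>"
        using measurable_compose[OF id sm] borel_measurable_integrable[OF that] by simp
      show "AE x in ?\<mu>. norm (k x * \<psi> x) \<le> norm (B * k x)"
        unfolding norm_mult using order_trans[OF B abs_ge_self]
        by (intro AE_I2) (simp add: mult.commute mult_right_mono)
    qed
    have "(LINT x|?N. \<psi> x * ?f x) = (LINT x|?\<mu>. \<psi> x * ?f x)"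
      by (rule integral_distr[OF id]) (rule borel_measurable_times[OF sm f])
    also have "\<dots> = (LINT x|?\<mu>. v x * \<psi> x - w x * \<psi> x)"
      by (rule Bochner_Integration.integral_cong) (auto simp: TV_space_sets algebra_simps)
    also have "\<dots> = 0"
      using i[OF v] i[OF w] eq[OF \<psi>] by simp
    finally show "(LINT x|?N. \<psi> x * ?f x) = 0" .
  qed simp
  then have "AE x in ?N. ?f x = 0"
    by eventually_elim (auto simp: indicator_def)
  moreover have "{x \<in> space borel. ?f x = 0} \<in> sets borel"
    using measurable_sets[OF f, of "{0}"] by (simp add: vimage_def)
  ultimately have "AE x in ?\<mu>. ?f x = 0"
    by (simp only: AE_distr_iff[OF id])
  with AE_space show ?thesis
    by eventually_elim (auto simp: TV_space_sets)
qed


section \<open>The full trace of a continuous field\<close>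

text \<open>The points where the norm exceeds M form an open null set, hence none. This turns the
  bound in \<open>trace_conv\<close> into one that holds |Du|-almost everywhere.\<close>

lemma continuous_norm_le_esssup:
  fixes f :: "'a::euclidean_space \<Rightarrow> 'b::euclidean_space"
  assumes "open \<Omega>" "continuous_on \<Omega> f" "norm_esssup (lebesgue_on \<Omega>) f \<le> ereal M" "x \<in> \<Omega>"
  shows "norm (f x) \<le> M"
proof (rule ccontr)
  assume "\<not> norm (f x) \<le> M"
  define U where "U = \<Omega> \<inter> (\<lambda>x. norm (f x)) -` {M<..}"
  have U: "open U"
    unfolding U_def
    by (rule continuous_on_open_vimage[THEN iffD1, rule_format, OF assms(1)] continuous_open_preimage)
       (use assms(1) continuous_on_norm[OF assms(2)] in auto)
  have "x \<in> U" using assms(4) \<open>\<not> norm (f x) \<le> M\<close> by (auto simp: U_def)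
  have "AE x in lebesgue_on \<Omega>. ereal (norm (f x)) \<le> ereal M"
    using esssup_AE[of "\<lambda>x. ereal (norm (f x))" "lebesgue_on \<Omega>"]
    by (rule eventually_mono) (rule order_trans[OF _ assms(3)[unfolded norm_esssup_def]])
  then have "AE x in lebesgue. x \<notin> U"
    unfolding AE_lebesgue_on_open[OF assms(1)] by eventually_elim (auto simp: U_def)
  then have "AE x in lborel. x \<notin> U" by (simp only: AE_completion_iff)
  then have "U \<in> null_sets lborel" using U by (subst AE_iff_null_sets) simp_all
  then have "negligible U" by (simp add: negligible_iff_null_sets null_sets_completionI)
  with open_not_negligible[OF U] \<open>x \<in> U\<close> show False by blast
qed

lemma lebesgue_point_continuous:
  fixes f :: "'a::euclidean_space \<Rightarrow> 'a"
  assumes "open \<Omega>" "continuous_on \<Omega> f" "x \<in> \<Omega>"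
  shows "lebesgue_point \<Omega> f x"
  unfolding lebesgue_point_def
proof (intro conjI assms(3) tendstoI)
  fix \<epsilon> :: real assume \<epsilon>: "\<epsilon> > 0"
  have "continuous (at x) f"
    using assms by (simp add: continuous_on_eq_continuous_at)
  then obtain d where d: "d > 0" "\<And>y. dist y x < d \<Longrightarrow> dist (f y) (f x) < \<epsilon> / 2"
    using \<epsilon> unfolding continuous_at by (metis half_gt_zero Lim_at continuous_at_eps_delta \<open>continuous (at x) f\<close>)
  show "eventually (\<lambda>r. dist ((LINT y:ball x r|lebesgue. norm (f y - f x)) / measure lebesgue (ball x r)) 0 < \<epsilon>) (at_right 0)"
    unfolding eventually_at_right_field
  proof (rule exI[of _ d], intro conjI allI impI d(1))
    fix r :: real assume r: "0 < r" "r < d"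
    let ?I = "LINT y:ball x r|lebesgue. norm (f y - f x)"
    have pos: "measure lebesgue (ball x r) > 0" using content_ball_pos[OF r(1), of x] by simp
    have fin: "emeasure lebesgue (ball x r) < \<infinity>" using emeasure_bounded_finite[OF bounded_ball, of x r] by simp
    have i: "integrable lebesgue (\<lambda>y. indicator (ball x r) y * (\<epsilon> / 2))"
      using fin by (intro integrable_mult_left) (simp add: integrable_indicator_iff)
    have "?I \<le> (LINT y|lebesgue. indicator (ball x r) y * (\<epsilon> / 2))"
      unfolding set_lebesgue_integral_def
    proof (rule integral_mono'[OF i])
      fix y
      show "indicator (ball x r) y *\<^sub>R norm (f y - f x) \<le> indicator (ball x r) y * (\<epsilon> / 2)"
        using d(2)[of y] r(2) by (auto simp: indicator_def dist_commute dist_norm norm_minus_commute)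
      show "0 \<le> indicator (ball x r) y * (\<epsilon> / 2)" using \<epsilon> by simp
    qed
    also have "\<dots> = measure lebesgue (ball x r) * (\<epsilon> / 2)" by simp
    finally have "?I / measure lebesgue (ball x r) \<le> \<epsilon> / 2"
      using pos by (simp add: pos_divide_le_eq mult.commute)
    moreover have "0 \<le> ?I"
      unfolding set_lebesgue_integral_def by (intro Bochner_Integration.integral_nonneg) simp
    ultimately show "dist (?I / measure lebesgue (ball x r)) 0 < \<epsilon>"
    proof -
      assume "0 \<le> ?I"
      then have "0 \<le> ?I / measure lebesgue (ball x r)" using pos by simp
      with \<open>?I / measure lebesgue (ball x r) \<le> \<epsilon> / 2\<close> \<epsilon> show ?thesis
        unfolding dist_real_def by linarith
    qed
  qed
qed

lemma L1_limit_unique: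
  fixes v w :: "'a \<Rightarrow> 'b::euclidean_space"
  assumes v: "integrable M v" and w: "integrable M w" and G: "\<And>n::nat. integrable M (G n)"
    and lim: "(\<lambda>n. LINT x|M. norm (G n x - v x)) \<longlonglongrightarrow> 0" "(\<lambda>n. LINT x|M. norm (G n x - w x)) \<longlonglongrightarrow> 0"
  shows "AE x in M. v x = w x"
proof -
  have le: "(LINT x|M. norm (v x - w x)) \<le> (LINT x|M. norm (G n x - v x)) + (LINT x|M. norm (G n x - w x))" for n
  proof -
    have "(LINT x|M. norm (v x - w x)) \<le> (LINT x|M. norm (G n x - v x) + norm (G n x - w x))"
    proof (rule integral_mono)
      fix x
      show "norm (v x - w x) \<le> norm (G n x - v x) + norm (G n x - w x)"
        using norm_triangle_ineq4[of "G n x - w x" "G n x - v x"] by (simp add: add.commute)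
    qed (use v w G in auto)
    then show ?thesis using v w G by simp
  qed
  have "(LINT x|M. norm (v x - w x)) \<le> 0"
    by (rule tendsto_lowerbound[OF tendsto_add_zero[OF lim]]) (simp_all add: le)
  then have "(LINT x|M. norm (v x - w x)) = 0"
    by (rule antisym) simp
  then have "AE x in M. norm (v x - w x) = 0"
    using v w by (subst (asm) integral_nonneg_eq_0_iff_AE) auto
  then show ?thesis by eventually_elim simp
qed

lemma test_functions_smooth_up_to_boundary:
  "G \<in> test_functions UNIV \<Longrightarrow> G \<in> smooth_up_to_boundary \<Omega>"
  unfolding smooth_up_to_boundary_def by blast

text \<open>The approximants inherit the bound of \<phi> at every point of \<Omega>, which supplies
  the dominating constant. For the equation with the chosen trace an approximating sequence must
  exist: if there were none, every integrable function would qualify as a trace.\<close>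

lemma full_trace_continuous:
  fixes \<Omega> :: "'a::euclidean_space set"
  assumes dom: "bounded_lipschitz_domain \<Omega>" and q: "1 \<le> q" and u: "u \<in> BV \<Omega>"
    and \<phi>: "continuous_on (closure \<Omega>) \<phi>" "\<phi> \<in> Wdiv q \<Omega>"
  shows "\<phi> \<in> full_trace_dom \<Omega> q u" and "AE x in TV \<Omega> u. full_trace \<Omega> q u \<phi> x = \<phi> x"
proof -
  have \<Omega>: "open \<Omega>" "bounded \<Omega>" "\<Omega> \<noteq> {}"
    using dom by (simp_all add: bounded_lipschitz_domain_def)
  interpret finite_measure "TV \<Omega> u" by (rule finite_measure_TV[OF u])
  have c: "continuous_on \<Omega> \<phi>" by (rule continuous_on_subset[OF \<phi>(1) closure_subset])
  have "compact (\<phi> ` closure \<Omega>)"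
    by (rule compact_continuous_image[OF \<phi>(1)]) (use \<Omega>(2) in \<open>simp add: compact_closure\<close>)
  then obtain B where B: "\<And>x. x \<in> closure \<Omega> \<Longrightarrow> norm (\<phi> x) \<le> B"
    using compact_imp_bounded by (force simp: bounded_iff)
  have B': "norm (\<phi> x) \<le> B" if "x \<in> \<Omega>" for x using B closure_subset that by blast
  have \<phi>m: "\<phi> \<in> borel_measurable (lebesgue_on \<Omega>)" using \<phi>(2) by (simp add: Wdiv_def Lp_space_def)
  have ess: "norm_esssup (lebesgue_on \<Omega>) \<phi> \<le> ereal B"
    unfolding norm_esssup_def using \<phi>m B' by (intro esssup_I) (auto intro!: AE_I2 simp: space_restrict_space)
  then have \<phi>L: "\<phi> \<in> Lp_space \<infinity> (lebesgue_on \<Omega>)" using \<phi>m by (auto simp: Lp_space_def)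
  have \<phi>T: "\<phi> \<in> borel_measurable (TV \<Omega> u)" by (rule continuous_on_TV_measurable[OF \<Omega>(1) c])
  have int\<phi>: "integrable (TV \<Omega> u) \<phi>"
    by (rule integrable_const_bound[of _ B]) (use B' \<phi>T in \<open>auto intro!: AE_I2 simp: TV_space_sets\<close>)
  have G_facts: "integrable (TV \<Omega> u) (G n)" "x \<in> \<Omega> \<Longrightarrow> norm (G n x) \<le> B" "G n \<in> borel_measurable (TV \<Omega> u)"
    if G: "trace_conv \<Omega> q G \<phi>" for G n x
  proof -
    have cG: "continuous_on \<Omega> (G n)"
      using G unfolding trace_conv_def by (blast intro: continuous_on_subset[OF _ closure_subset])
    have "norm_esssup (lebesgue_on \<Omega>) (G n) \<le> ereal B"
      using G ess unfolding trace_conv_def by (blast intro: order_trans)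
    then have b: "norm (G n x) \<le> B" if "x \<in> \<Omega>" for x
      by (rule continuous_norm_le_esssup[OF \<Omega>(1) cG _ that])
    then show "x \<in> \<Omega> \<Longrightarrow> norm (G n x) \<le> B" .
    show m: "G n \<in> borel_measurable (TV \<Omega> u)" by (rule continuous_on_TV_measurable[OF \<Omega>(1) cG])
    show "integrable (TV \<Omega> u) (G n)"
      by (rule integrable_const_bound[of _ B]) (use b m in \<open>auto intro!: AE_I2 simp: TV_space_sets\<close>)
  qed
  have conv: "(\<lambda>n. LINT x|TV \<Omega> u. norm (G n x - \<phi> x)) \<longlonglongrightarrow> 0" if G: "trace_conv \<Omega> q G \<phi>" for G
  proof -
    have "(\<lambda>n. LINT x|TV \<Omega> u. norm (G n x - \<phi> x)) \<longlonglongrightarrow> (LINT x|TV \<Omega> u. (0::real))"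
    proof (rule integral_dominated_convergence[where w="\<lambda>_. 2 * B"])
      show "AE x in TV \<Omega> u. (\<lambda>n. norm (G n x - \<phi> x)) \<longlonglongrightarrow> 0"
      proof (rule AE_I2)
        fix x assume "x \<in> space (TV \<Omega> u)"
        then have x: "x \<in> \<Omega>" by (simp add: TV_space_sets)
        have "(\<lambda>n. G n x) \<longlonglongrightarrow> \<phi> x"
          using G lebesgue_point_continuous[OF \<Omega>(1) c x] unfolding trace_conv_def by blast
        then show "(\<lambda>n. norm (G n x - \<phi> x)) \<longlonglongrightarrow> 0"
          by (intro tendsto_norm_zero LIM_zero)
      qed
      show "AE x in TV \<Omega> u. norm (norm (G n x - \<phi> x)) \<le> 2 * B" for n
      proof (rule AE_I2)
        fix x assume "x \<in> space (TV \<Omega> u)"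
        then have x: "x \<in> \<Omega>" by (simp add: TV_space_sets)
        show "norm (norm (G n x - \<phi> x)) \<le> 2 * B"
          using norm_triangle_ineq4[of "G n x" "\<phi> x"] G_facts(2)[OF G x, of n] B'[OF x] by simp
      qed
    qed (use G_facts(3)[OF G] \<phi>T in auto)
    then show ?thesis by simp
  qed
  have ft: "is_full_trace \<Omega> q u \<phi> \<phi>"
    unfolding is_full_trace_def using int\<phi> conv by blast
  then show "\<phi> \<in> full_trace_dom \<Omega> q u"
    unfolding full_trace_dom_def using \<phi>(2) \<phi>L by blast
  have ft': "is_full_trace \<Omega> q u \<phi> (full_trace \<Omega> q u \<phi>)"
    unfolding full_trace_def by (rule someI[of "is_full_trace \<Omega> q u \<phi>", OF ft])
  show "AE x in TV \<Omega> u. full_trace \<Omega> q u \<phi> x = \<phi> x"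
  proof (rule exists_smooth_trace_conv[OF dom q \<phi>(2) \<phi>L])
    fix G assume G: "\<And>n. G n \<in> test_functions UNIV" "trace_conv \<Omega> q G \<phi>"
    have sb: "\<And>n. G n \<in> smooth_up_to_boundary \<Omega>" by (rule test_functions_smooth_up_to_boundary[OF G(1)])
    show ?thesis
    proof (rule L1_limit_unique[OF _ int\<phi> G_facts(1)[OF G(2)] _ conv[OF G(2)]])
      show "integrable (TV \<Omega> u) (full_trace \<Omega> q u \<phi>)" using ft' by (simp add: is_full_trace_def)
      show "(\<lambda>n. LINT x|TV \<Omega> u. norm (G n x - full_trace \<Omega> q u \<phi> x)) \<longlonglongrightarrow> 0"
        using ft' sb G(2) unfolding is_full_trace_def by blast
    qed
  qed
qed

section \<open>Weak limits, the pairing with Du and the normal trace\<close>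

section \<open>Weak limits of bounded sequences\<close>

text \<open>Dyadic convex combinations of the tail from index n on; closure under midpoints is
  exactly what the parallelogram law uses.\<close>

inductive_set midpoint_hull :: "(nat \<Rightarrow> 'a \<Rightarrow> real) \<Rightarrow> nat \<Rightarrow> ('a \<Rightarrow> real) set" for t n where
  base: "n \<le> k \<Longrightarrow> t k \<in> midpoint_hull t n"
| mid: "f \<in> midpoint_hull t n \<Longrightarrow> g \<in> midpoint_hull t n \<Longrightarrow> (\<lambda>x. (f x + g x) / 2) \<in> midpoint_hull t n"

lemma midpoint_hull_mono: "n \<le> m \<Longrightarrow> f \<in> midpoint_hull t m \<Longrightarrow> f \<in> midpoint_hull t n"
  by (rotate_tac 1, induction rule: midpoint_hull.induct) (auto intro: midpoint_hull.intros)

text \<open>A substitute for weak compactness: elements of almost minimal \<open>L\<^sup>2\<close> norm in the convex hulls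
  of the tails form a Cauchy sequence by the parallelogram law.\<close>

lemma exists_weak_limit:
  fixes t :: "nat \<Rightarrow> 'a \<Rightarrow> real"
  assumes "finite_measure M" and meas: "\<And>n. t n \<in> borel_measurable M"
    and bd: "\<And>n. AE x in M. \<bar>t n x\<bar> \<le> C" and C: "0 \<le> C"
  obtains s where "integrable M s"
    "\<And>\<psi> B L. \<psi> \<in> borel_measurable M \<Longrightarrow> (\<And>x. x \<in> space M \<Longrightarrow> \<bar>\<psi> x\<bar> \<le> B) \<Longrightarrow>
      (\<lambda>n. LINT x|M. t n x * \<psi> x) \<longlonglongrightarrow> L \<Longrightarrow> (LINT x|M. s x * \<psi> x) = L"
proof -
  interpret finite_measure M by fact
  let ?H = "midpoint_hull t"
  have H: "f \<in> borel_measurable M \<and> (AE x in M. \<bar>f x\<bar> \<le> C)" if "f \<in> ?H n" for f n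
    using that
  proof induction
    case (mid f g)
    then have m: "f \<in> borel_measurable M" "g \<in> borel_measurable M" and "AE x in M. \<bar>f x\<bar> \<le> C" "AE x in M. \<bar>g x\<bar> \<le> C" by auto
    from this(3,4) have "AE x in M. \<bar>(f x + g x) / 2\<bar> \<le> C" by eventually_elim (auto simp: abs_le_iff)
    with m show ?case by auto
  qed (use meas bd in auto)
  have bi: "integrable M k" if "k \<in> borel_measurable M" "AE x in M. \<bar>k x\<bar> \<le> D" for k :: "'a \<Rightarrow> real" and D
    by (rule integrable_const_bound[of _ D]) (use that in auto)
  have Hi: "integrable M f" if "f \<in> ?H n" for f n using bi H[OF that] by blast
  have Hfg: "integrable M (\<lambda>x. f x * g x)" if "f \<in> ?H n" "g \<in> ?H m" for f g n m
  proof (rule bi[of _ "C * C"])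
    show "AE x in M. \<bar>f x * g x\<bar> \<le> C * C"
      using conjunct2[OF H[OF that(1)]] conjunct2[OF H[OF that(2)]]
      by eventually_elim (auto simp: abs_mult intro!: mult_mono C)
  qed (use H[OF that(1)] H[OF that(2)] in auto)
  define Q :: "('a \<Rightarrow> real) \<Rightarrow> real" where "Q = (\<lambda>f. LINT x|M. f x * f x)"
  have Q0: "0 \<le> Q f" for f unfolding Q_def by (intro Bochner_Integration.integral_nonneg) simp
  have QC: "Q f \<le> C * C * measure M (space M)" if "f \<in> ?H n" for f n
  proof -
    have "Q f \<le> (LINT x|M. C * C)"
      unfolding Q_def
    proof (rule integral_mono_AE[OF Hfg[OF that that]])
      show "AE x in M. f x * f x \<le> C * C"
        using conjunct2[OF H[OF that]]
        by eventually_elim (metis C abs_ge_zero abs_mult_self_eq mult_mono)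
    qed simp
    then show ?thesis by (simp add: mult.commute)
  qed
  \<comment> \<open>The least squared norm in the hull of each tail. The hulls shrink as n grows, so
    these numbers increase; being bounded, they converge.\<close>
  define d where "d = (\<lambda>n. Inf (Q ` ?H n))"
  have ne: "?H n \<noteq> {}" for n using midpoint_hull.base[of n n t] by blast
  have bdd: "bdd_below (Q ` ?H n)" for n using Q0 by (intro bdd_belowI2)
  have dle: "d n \<le> Q f" if "f \<in> ?H n" for f n
    unfolding d_def by (rule cInf_lower[OF imageI[OF that] bdd])
  have "incseq d"
  proof (rule monoI)
    fix n m :: nat assume nm: "n \<le> m"
    show "d n \<le> d m"
      unfolding d_def
      by (rule cInf_superset_mono[OF _ bdd image_mono]) (use ne midpoint_hull_mono[OF nm] in auto)
  qed
  have "d n \<le> C * C * measure M (space M)" for n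
    using dle[OF midpoint_hull.base[OF order_refl]] QC[OF midpoint_hull.base[OF order_refl]] by (rule order_trans)
  then obtain dl where dl: "d \<longlonglongrightarrow> dl" "\<And>n. d n \<le> dl"
    using incseq_convergent[OF \<open>incseq d\<close>] by metis
  have "\<exists>f. f \<in> ?H n \<and> Q f < d n + 1 / real (Suc n)" for n
  proof -
    have "Inf (Q ` ?H n) < d n + 1 / real (Suc n)" by (simp add: d_def)
    from cInf_lessD[OF _ this] ne show ?thesis by auto
  qed
  then obtain f where f: "\<And>n. f n \<in> ?H n" "\<And>n. Q (f n) < d n + 1 / real (Suc n)" by metis
  have fn: "f m \<in> ?H n" if "n \<le> m" for n m by (rule midpoint_hull_mono[OF that f(1)])
  \<comment> \<open>By the parallelogram law the squared distance is 2 Q(f_n) + 2 Q(f_m) minus 4 Q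
    of the midpoint, which lies in the hull of tail k and thus has Q at least d k.\<close>
  have close: "(LINT x|M. (f n x - f m x) * (f n x - f m x)) \<le> 4 * ((dl - d k) + 1 / real (Suc k))"
    if "k \<le> n" "k \<le> m" for n m k
  proof -
    note i = Hfg[OF fn[OF that(1)] fn[OF that(1)]] Hfg[OF fn[OF that(2)] fn[OF that(2)]] Hfg[OF fn[OF that(1)] fn[OF that(2)]]
    let ?g = "\<lambda>x. (f n x + f m x) / 2"
    have g: "?g \<in> ?H k" by (rule midpoint_hull.mid[OF fn[OF that(1)] fn[OF that(2)]])
    have "(LINT x|M. (f n x - f m x) * (f n x - f m x)) = (LINT x|M. 2 * (f n x * f n x) + 2 * (f m x * f m x) - 4 * (?g x * ?g x))"
      by (rule Bochner_Integration.integral_cong) (simp_all add: field_simps)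
    also have "\<dots> = 2 * Q (f n) + 2 * Q (f m) - 4 * Q ?g"
    proof -
      have 1: "integrable M (\<lambda>x. 2 * (f n x * f n x) + 2 * (f m x * f m x))"
        by (intro Bochner_Integration.integrable_add integrable_mult_right i)
      have 2: "integrable M (\<lambda>x. 4 * (?g x * ?g x))"
        by (rule integrable_mult_right[OF Hfg[OF g g]])
      from Bochner_Integration.integral_diff[OF 1 2] show ?thesis
        unfolding Q_def using i(1,2) by (simp only: integral_mult_right_zero Bochner_Integration.integral_add integrable_mult_right)
    qed
    also have "\<dots> \<le> 2 * (dl + 1 / real (Suc k)) + 2 * (dl + 1 / real (Suc k)) - 4 * d k"
    proof -
      have "Q (f n) \<le> dl + 1 / real (Suc k)" if "k \<le> n" for n
      proof -
        have "1 / real (Suc n) \<le> 1 / real (Suc k)" using that by (intro divide_left_mono) auto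
        then show ?thesis using f(2)[of n] dl(2)[of n] by linarith
      qed
      note b = this
      have "2 * x + 2 * y - 4 * z \<le> 2 * X + 2 * X - 4 * w" if "x \<le> X" "y \<le> X" "w \<le> z" for x y z w X :: real
        using that by linarith
      from this[OF b[OF that(1)] b[OF that(2)] dle[OF g]] show ?thesis .
    qed
    finally show ?thesis by simp
  qed
  have cauchy: "\<exists>N. \<forall>i\<ge>N. \<forall>j\<ge>N. (LINT x|M. norm (f i x - f j x)) < e" if e: "e > 0" for e
  proof -
    \<comment> \<open>L^1 is reached from L^2 by |w| \<le> \<eta> + w^2 / \<eta>. This \<eta> makes
      the constant term contribute at most e / 2; the added 1 takes care of the zero
      measure.\<close>
    define \<eta> where "\<eta> = e / (2 * (measure M (space M) + 1))"
    have mp: "measure M (space M) + 1 > 0" by (simp add: add_nonneg_pos)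
    have \<eta>: "\<eta> > 0" "\<eta> * measure M (space M) \<le> e / 2"
      using e mp by (auto simp: \<eta>_def field_simps)
    have "(\<lambda>k. 4 * ((dl - d k) + 1 / real (Suc k)) / \<eta>) \<longlonglongrightarrow> 4 * ((dl - dl) + 0) / \<eta>"
      using LIMSEQ_inverse_real_of_nat by (intro tendsto_intros dl(1)) (use \<eta> in \<open>simp_all add: inverse_eq_divide\<close>)
    then have lim0: "(\<lambda>k. 4 * ((dl - d k) + 1 / real (Suc k)) / \<eta>) \<longlonglongrightarrow> 0"
      by simp
    have "eventually (\<lambda>k. 4 * ((dl - d k) + 1 / real (Suc k)) / \<eta> < e / 2) sequentially"
      by (rule order_tendstoD(2)[OF lim0]) (use e in simp)
    then obtain k where k: "4 * ((dl - d k) + 1 / real (Suc k)) / \<eta> < e / 2"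
      by (auto simp: eventually_sequentially)
    have "(LINT x|M. norm (f i x - f j x)) < e" if "i \<ge> k" "j \<ge> k" for i j
    proof -
      let ?w = "\<lambda>x. f i x - f j x"
      have i2: "integrable M (\<lambda>x. ?w x * ?w x)"
      proof (rule bi[of _ "(2 * C) * (2 * C)"])
        show "AE x in M. \<bar>?w x * ?w x\<bar> \<le> (2 * C) * (2 * C)"
          using conjunct2[OF H[OF f(1)[of i]]] conjunct2[OF H[OF f(1)[of j]]]
        proof eventually_elim
          case (elim x)
          then have "\<bar>?w x\<bar> \<le> 2 * C" by (auto simp: abs_le_iff)
          then show ?case unfolding abs_mult by (intro mult_mono) (use C in auto)
        qed
      qed (use H[OF f(1)[of i]] H[OF f(1)[of j]] in auto)
      have "(LINT x|M. norm (?w x)) \<le> (LINT x|M. \<eta> + (?w x * ?w x) / \<eta>)"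
      proof (rule integral_mono)
        fix x
        have "0 \<le> (\<bar>?w x\<bar> - \<eta>)\<^sup>2 + \<bar>?w x\<bar> * \<eta>" using \<eta>(1) by simp
        also have "\<dots> = ?w x * ?w x + \<eta> * \<eta> - \<bar>?w x\<bar> * \<eta>"
          by (simp add: power2_eq_square algebra_simps abs_mult_self_eq)
        finally have "\<bar>?w x\<bar> \<le> (?w x * ?w x + \<eta> * \<eta>) / \<eta>"
          using pos_le_divide_eq[OF \<eta>(1)] by simp
        also have "\<dots> = \<eta> + (?w x * ?w x) / \<eta>"
          using \<eta>(1) by (simp add: add_divide_distrib del: times_divide_eq_right)
        finally show "norm (?w x) \<le> \<eta> + (?w x * ?w x) / \<eta>" by simp
      qed (use Hi[OF f(1)] i2 in auto)
      also have "\<dots> = \<eta> * measure M (space M) + (LINT x|M. ?w x * ?w x) / \<eta>"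
        using i2 by (simp add: mult.commute)
      also have "\<dots> \<le> e / 2 + 4 * ((dl - d k) + 1 / real (Suc k)) / \<eta>"
        using close[OF that] \<eta> by (intro add_mono divide_right_mono) auto
      also have "\<dots> < e" using k by linarith
      finally show ?thesis .
    qed
    then show ?thesis by blast
  qed
  obtain r where r: "strict_mono r" "AE x in M. Cauchy (\<lambda>i. f (r i) x)"
    using cauchy_L1_AE_cauchy_subseq[of M f, OF Hi[OF f(1)] cauchy] by blast
  define s where "s = (\<lambda>x. lim (\<lambda>i. f (r i) x))"
  have fm: "f i \<in> borel_measurable M" for i using H[OF f(1)[of i]] by blast
  have sm: "s \<in> borel_measurable M" unfolding s_def using fm by measurable
  have lim: "AE x in M. (\<lambda>i. f (r i) x) \<longlonglongrightarrow> s x"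
    using r(2) by eventually_elim (simp add: s_def Cauchy_convergent_iff convergent_LIMSEQ_iff)
  have "AE x in M. \<forall>i. \<bar>f i x\<bar> \<le> C" using H[OF f(1)] by (subst AE_all_countable) blast
  with lim have sb: "AE x in M. \<bar>s x\<bar> \<le> C"
  proof eventually_elim
    case (elim x)
    then show ?case by (intro LIMSEQ_le_const2[OF tendsto_rabs[OF elim(1)]]) auto
  qed
  show thesis
  proof (rule that)
    show "integrable M s" by (rule bi[OF sm sb])
    fix \<psi> :: "'a \<Rightarrow> real" and B L
    assume \<psi>: "\<psi> \<in> borel_measurable M" "\<And>x. x \<in> space M \<Longrightarrow> \<bar>\<psi> x\<bar> \<le> B"
      and L: "(\<lambda>n. LINT x|M. t n x * \<psi> x) \<longlonglongrightarrow> L"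
    have i\<psi>: "integrable M (\<lambda>x. k x * \<psi> x)" if "k \<in> borel_measurable M" "AE x in M. \<bar>k x\<bar> \<le> C" for k
    proof (rule bi[of _ "C * B"])
      show "AE x in M. \<bar>k x * \<psi> x\<bar> \<le> C * B"
        using that(2) AE_space by eventually_elim (use \<psi>(2) C in \<open>auto simp: abs_mult intro!: mult_mono\<close>)
    qed (use that \<psi>(1) in auto)
    have 1: "(\<lambda>i. LINT x|M. f (r i) x * \<psi> x) \<longlonglongrightarrow> (LINT x|M. s x * \<psi> x)"
    proof (rule integral_dominated_convergence[where w="\<lambda>_. C * B"])
      show "AE x in M. (\<lambda>i. f (r i) x * \<psi> x) \<longlonglongrightarrow> s x * \<psi> x"
        using lim by eventually_elim (intro tendsto_intros)
      show "AE x in M. norm (f (r i) x * \<psi> x) \<le> C * B" for i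
        using conjunct2[OF H[OF f(1)[of "r i"]]] AE_space
        by eventually_elim (use \<psi>(2) C in \<open>auto simp: abs_mult intro!: mult_mono\<close>)
    qed (use sm fm \<psi>(1) in auto)
    have 2: "(\<lambda>i. LINT x|M. f (r i) x * \<psi> x) \<longlonglongrightarrow> L"
    proof (rule LIMSEQ_I)
      fix e :: real assume e: "e > 0"
      obtain N where N: "\<And>k. k \<ge> N \<Longrightarrow> norm ((LINT x|M. t k x * \<psi> x) - L) < e"
        using LIMSEQ_D[OF L e] by blast
      \<comment> \<open>To lie within e of L is a property preserved by midpoints, so it passes from
        the members of a tail to its hull, which contains f (r i) for large i.\<close>
      have hull: "norm ((LINT x|M. g x * \<psi> x) - L) < e" if "g \<in> ?H N" for g
        using that
      proof induction
        case (mid g h)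
        have "(LINT x|M. (g x + h x) / 2 * \<psi> x) = ((LINT x|M. g x * \<psi> x) + (LINT x|M. h x * \<psi> x)) / 2"
        proof -
          have "(LINT x|M. (g x + h x) / 2 * \<psi> x) = (LINT x|M. (g x * \<psi> x + h x * \<psi> x) / 2)"
            by (rule Bochner_Integration.integral_cong) (simp_all add: algebra_simps)
          then show ?thesis using i\<psi> H[OF mid(1)] H[OF mid(2)] by simp
        qed
        with mid.IH show ?case by (simp add: abs_less_iff field_simps)
      qed (use N in blast)
      have "norm ((LINT x|M. f (r i) x * \<psi> x) - L) < e" if "i \<ge> N" for i
        by (rule hull, rule fn) (use that seq_suble[OF r(1), of i] in linarith)
      then show "\<exists>no. \<forall>n\<ge>no. norm ((LINT x|M. f (r n) x * \<psi> x) - L) < e" by blast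
    qed
    show "(LINT x|M. s x * \<psi> x) = L" by (rule LIMSEQ_unique[OF 1 2])
  qed
qed


section \<open>The pairing with a smooth field\<close>

text \<open>The defining identity of Du is vector valued with scalar test functions; its b-th
  component for the test function \<open>F x \<bullet> b\<close> gives one summand of the
  divergence.\<close>

lemma TV_integral_divergence:
  fixes \<Omega> :: "'a::euclidean_space set" and F :: "'a \<Rightarrow> 'a"
  assumes "open \<Omega>" and u: "u \<in> BV \<Omega>" and F: "F \<in> test_functions \<Omega>"
    and \<sigma>: "TV_density \<Omega> u \<in> borel_measurable (TV \<Omega> u)" "AE x in TV \<Omega> u. norm (TV_density \<Omega> u x) \<le> DIM('a)"
  shows "(LINT x|lebesgue_on \<Omega>. u x * divergence F x) = - (LINT x|TV \<Omega> u. F x \<bullet> TV_density \<Omega> u x)"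
proof -
  interpret finite_measure "TV \<Omega> u" by (rule finite_measure_TV[OF u])
  have ui: "integrable (lebesgue_on \<Omega>) u" using u by (simp add: BV_def)
  note smF = test_functions_smooth[OF F]
  have T: "(\<lambda>x. F x \<bullet> b) \<in> test_functions \<Omega>" for b
    by (rule test_functions_bounded_linear[OF F bounded_linear_inner_left])
  have gr: "frechet_derivative F (at x) b \<bullet> b = gradient (\<lambda>x. F x \<bullet> b) x \<bullet> b" for x b
  proof -
    have "frechet_derivative (\<lambda>x. F x \<bullet> b) (at x) = (\<lambda>v. frechet_derivative F (at x) v \<bullet> b)"
      by (rule sym, rule frechet_derivative_at, rule has_derivative_inner_left[OF smooth_has_derivative[OF smF]])
    then show ?thesis using gradient_inner[OF test_functions_smooth[OF T], of b x b] by simp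
  qed
  have iu: "integrable (lebesgue_on \<Omega>) (\<lambda>x. u x *\<^sub>R gradient (\<lambda>x. F x \<bullet> b) x)" for b
  proof -
    obtain B where B: "\<And>x. norm (gradient (\<lambda>x. F x \<bullet> b) x) \<le> B"
      using test_functions_bounded[OF test_functions_gradient[OF T[of b]]] by metis
    show ?thesis
    proof (rule Bochner_Integration.integrable_bound)
      show "integrable (lebesgue_on \<Omega>) (\<lambda>x. B * u x)" using ui by simp
      have "gradient (\<lambda>x. F x \<bullet> b) \<in> borel_measurable (lebesgue_on \<Omega>)"
        using smooth_borel_measurable[OF smooth_gradient[OF test_functions_smooth[OF T[of b]]]]
        by (intro measurable_restrict_space1 measurable_completion) simp
      then show "(\<lambda>x. u x *\<^sub>R gradient (\<lambda>x. F x \<bullet> b) x) \<in> borel_measurable (lebesgue_on \<Omega>)"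
        by (intro borel_measurable_scaleR borel_measurable_integrable[OF ui])
      show "AE x in lebesgue_on \<Omega>. norm (u x *\<^sub>R gradient (\<lambda>x. F x \<bullet> b) x) \<le> norm (B * u x)"
        using order_trans[OF B abs_ge_self] by (intro AE_I2) (simp add: abs_mult mult.commute[of "\<bar>u _\<bar>"] mult_right_mono)
    qed
  qed
  have Tm: "\<psi> \<in> borel_measurable (TV \<Omega> u)" if "\<psi> \<in> test_functions \<Omega>" for \<psi> :: "'a \<Rightarrow> real"
    by (rule continuous_on_TV_measurable[OF assms(1) smooth_continuous_on[OF test_functions_smooth[OF that]]])
  have i\<sigma>: "integrable (TV \<Omega> u) (\<lambda>x. (F x \<bullet> b) *\<^sub>R TV_density \<Omega> u x)" for b
  proof -
    obtain B where B: "\<And>x. norm (F x \<bullet> b) \<le> B" using test_functions_bounded[OF T[of b]] by metis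
    show ?thesis
    proof (rule integrable_const_bound[of _ "B * DIM('a)"])
      show "AE x in TV \<Omega> u. norm ((F x \<bullet> b) *\<^sub>R TV_density \<Omega> u x) \<le> B * DIM('a)"
        using \<sigma>(2) by eventually_elim (use B in \<open>auto intro!: mult_mono order_trans[OF norm_ge_zero B]\<close>)
    qed (use Tm[OF T] \<sigma>(1) in simp)
  qed
  have "(LINT x|lebesgue_on \<Omega>. u x * divergence F x) =
      (LINT x|lebesgue_on \<Omega>. (\<Sum>b\<in>Basis. (u x *\<^sub>R gradient (\<lambda>x. F x \<bullet> b) x) \<bullet> b))"
    unfolding divergence_def gr by (simp add: sum_distrib_left)
  also have "\<dots> = (\<Sum>b\<in>Basis. (LINT x|lebesgue_on \<Omega>. (u x *\<^sub>R gradient (\<lambda>x. F x \<bullet> b) x) \<bullet> b))"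
    by (rule Bochner_Integration.integral_sum, rule integrable_inner_left[OF iu])
  also have "\<dots> = (\<Sum>b\<in>Basis. - (LINT x|TV \<Omega> u. ((F x \<bullet> b) *\<^sub>R TV_density \<Omega> u x) \<bullet> b))"
  proof (rule sum.cong[OF refl])
    fix b :: 'a
    have "(LINT x|lebesgue_on \<Omega>. (u x *\<^sub>R gradient (\<lambda>x. F x \<bullet> b) x) \<bullet> b) =
        (LINT x|lebesgue_on \<Omega>. u x *\<^sub>R gradient (\<lambda>x. F x \<bullet> b) x) \<bullet> b"
      by (rule integral_inner_left[OF iu])
    also have "\<dots> = - ((LINT x|TV \<Omega> u. (F x \<bullet> b) *\<^sub>R TV_density \<Omega> u x) \<bullet> b)"
      unfolding TV_integral_gradient[OF u T] by simp
    also have "\<dots> = - (LINT x|TV \<Omega> u. ((F x \<bullet> b) *\<^sub>R TV_density \<Omega> u x) \<bullet> b)"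
      by (subst integral_inner_left[OF i\<sigma>]) simp
    finally show "(LINT x|lebesgue_on \<Omega>. (u x *\<^sub>R gradient (\<lambda>x. F x \<bullet> b) x) \<bullet> b) =
        - (LINT x|TV \<Omega> u. ((F x \<bullet> b) *\<^sub>R TV_density \<Omega> u x) \<bullet> b)" .
  qed
  also have "\<dots> = - (LINT x|TV \<Omega> u. (\<Sum>b\<in>Basis. ((F x \<bullet> b) *\<^sub>R TV_density \<Omega> u x) \<bullet> b))"
    unfolding sum_negf
    by (subst Bochner_Integration.integral_sum[symmetric]) (simp_all only: integrable_inner_left[OF i\<sigma>])
  also have "(LINT x|TV \<Omega> u. (\<Sum>b\<in>Basis. ((F x \<bullet> b) *\<^sub>R TV_density \<Omega> u x) \<bullet> b)) = (LINT x|TV \<Omega> u. F x \<bullet> TV_density \<Omega> u x)"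
    by (rule Bochner_Integration.integral_cong[OF refl]) (simp only: inner_scaleR_left euclidean_inner[symmetric])
  finally show ?thesis .
qed

lemma loc_integrable_bound:
  fixes z :: "'a::euclidean_space \<Rightarrow> 'b::euclidean_space" and w :: "'a \<Rightarrow> 'c::euclidean_space"
  assumes "open \<Omega>" "loc_integrable \<Omega> z" "w \<in> borel_measurable (lebesgue_on \<Omega>)" "\<And>x. norm (w x) \<le> B * norm (z x)"
  shows "loc_integrable \<Omega> w"
  unfolding loc_integrable_def
proof (intro allI impI)
  fix K assume K: "compact K \<and> K \<subseteq> \<Omega>"
  have z: "integrable lebesgue (\<lambda>x. indicator K x *\<^sub>R z x)"
    using assms(2) K unfolding loc_integrable_def set_integrable_def by blast
  have wm: "(\<lambda>x. indicator \<Omega> x *\<^sub>R w x) \<in> borel_measurable lebesgue"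
    using assms(1,3) by (subst borel_measurable_restrict_space_iff[symmetric]) auto
  show "set_integrable lebesgue K w"
    unfolding set_integrable_def
  proof (rule Bochner_Integration.integrable_bound)
    show "integrable lebesgue (\<lambda>x. B *\<^sub>R (indicator K x *\<^sub>R z x))" by (rule integrable_scaleR_right[OF z])
    have "K \<in> sets lebesgue" using K by (simp add: compact_imp_closed)
    then have "(\<lambda>x. (indicator K x :: real) *\<^sub>R (indicator \<Omega> x *\<^sub>R w x)) \<in> borel_measurable lebesgue"
      by (intro borel_measurable_scaleR wm borel_measurable_indicator)
    moreover have "(\<lambda>x. (indicator K x :: real) *\<^sub>R (indicator \<Omega> x *\<^sub>R w x)) = (\<lambda>x. indicator K x *\<^sub>R w x)"
      using K by (intro ext) (auto simp: indicator_def)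
    ultimately show "(\<lambda>x. indicator K x *\<^sub>R w x) \<in> borel_measurable lebesgue" by (simp only:)
    show "AE x in lebesgue. norm (indicator K x *\<^sub>R w x) \<le> norm (B *\<^sub>R (indicator K x *\<^sub>R z x))"
    proof (rule AE_I2)
      fix x
      have "norm (w x) \<le> \<bar>B\<bar> * norm (z x)"
        by (rule order_trans[OF assms(4)]) (simp add: mult_right_mono)
      then show "norm (indicator K x *\<^sub>R w x) \<le> norm (B *\<^sub>R (indicator K x *\<^sub>R z x))"
        by (simp add: indicator_def)
    qed
  qed
qed

text \<open>Testing \<psi> z against \<eta> amounts to testing z against \<psi> \<eta>, whose
  gradient has the additional part \<eta> times the gradient of \<psi>.\<close>

lemma is_weak_div_scaleR:
  fixes z :: "'a::euclidean_space \<Rightarrow> 'a"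
  assumes \<Omega>: "open \<Omega>" and z: "is_weak_div \<Omega> z h" and \<psi>: "\<psi> \<in> test_functions \<Omega>"
  shows "is_weak_div \<Omega> (\<lambda>x. \<psi> x *\<^sub>R z x) (\<lambda>x. gradient \<psi> x \<bullet> z x + \<psi> x * h x)"
proof -
  note lz = is_weak_divD(1)[OF z] and lh = is_weak_divD(2)[OF z]
  note sm = test_functions_smooth[OF \<psi>]
  have m: "z \<in> borel_measurable (lebesgue_on \<Omega>)" "h \<in> borel_measurable (lebesgue_on \<Omega>)"
    by (rule loc_integrable_measurable[OF \<Omega> lz], rule loc_integrable_measurable[OF \<Omega> lh])
  have \<psi>m: "\<psi> \<in> borel_measurable (lebesgue_on \<Omega>)" "gradient \<psi> \<in> borel_measurable (lebesgue_on \<Omega>)"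
    using smooth_borel_measurable[OF sm] smooth_borel_measurable[OF smooth_gradient[OF sm]]
    by (auto intro!: measurable_restrict_space1 measurable_completion)
  obtain B where B: "\<And>x. norm (\<psi> x) \<le> B" using test_functions_bounded[OF \<psi>] by metis
  obtain B' where B': "\<And>x. norm (gradient \<psi> x) \<le> B'" using test_functions_bounded[OF test_functions_gradient[OF \<psi>]] by metis
  have l1: "loc_integrable \<Omega> (\<lambda>x. \<psi> x *\<^sub>R z x)"
  proof (rule loc_integrable_bound[OF \<Omega> lz borel_measurable_scaleR[OF \<psi>m(1) m(1)]])
    show "norm (\<psi> x *\<^sub>R z x) \<le> B * norm (z x)" for x
      unfolding norm_scaleR using mult_right_mono[OF B norm_ge_zero[of "z x"], of x] by simp
  qed
  \<comment> \<open>Negated, so that \<open>loc_integrable_diff\<close> yields the sum.\<close>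
  have l2: "loc_integrable \<Omega> (\<lambda>x. - (\<psi> x * h x))"
  proof (rule loc_integrable_bound[OF \<Omega> lh])
    show "(\<lambda>x. - (\<psi> x * h x)) \<in> borel_measurable (lebesgue_on \<Omega>)" using \<psi>m(1) m(2) by simp
    show "norm (- (\<psi> x * h x)) \<le> B * norm (h x)" for x
      unfolding norm_minus_cancel norm_mult using mult_right_mono[OF B norm_ge_zero[of "h x"], of x] by simp
  qed
  have l3: "loc_integrable \<Omega> (\<lambda>x. gradient \<psi> x \<bullet> z x)"
  proof (rule loc_integrable_bound[OF \<Omega> lz borel_measurable_inner[OF \<psi>m(2) m(1)]])
    show "norm (gradient \<psi> x \<bullet> z x) \<le> B' * norm (z x)" for x
      using Cauchy_Schwarz_ineq2[of "gradient \<psi> x" "z x"] mult_right_mono[OF B' norm_ge_zero[of "z x"], of x]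
      by simp
  qed
  show ?thesis
    unfolding is_weak_div_def
  proof (intro conjI ballI)
    show "loc_integrable \<Omega> (\<lambda>x. \<psi> x *\<^sub>R z x)" by (rule l1)
    show "loc_integrable \<Omega> (\<lambda>x. gradient \<psi> x \<bullet> z x + \<psi> x * h x)"
      using loc_integrable_diff[OF l3 l2] by simp
    fix \<eta> :: "'a \<Rightarrow> real" assume \<eta>: "\<eta> \<in> test_functions \<Omega>"
    note sm\<eta> = test_functions_smooth[OF \<eta>]
    have P: "(\<lambda>x. \<psi> x * \<eta> x) \<in> test_functions \<Omega>"
      using test_functions_scaleR_left[OF \<psi> sm\<eta>] by simp
    have gP: "gradient (\<lambda>x. \<psi> x * \<eta> x) x = \<psi> x *\<^sub>R gradient \<eta> x + \<eta> x *\<^sub>R gradient \<psi> x" for x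
    proof (rule gradientI)
      have "((\<lambda>x. \<psi> x * \<eta> x) has_derivative
          (\<lambda>v. \<psi> x * frechet_derivative \<eta> (at x) v + frechet_derivative \<psi> (at x) v * \<eta> x)) (at x)"
        by (rule has_derivative_mult[OF smooth_has_derivative[OF sm] smooth_has_derivative[OF sm\<eta>]])
      then show "((\<lambda>x. \<psi> x * \<eta> x) has_derivative (\<lambda>v. (\<psi> x *\<^sub>R gradient \<eta> x + \<eta> x *\<^sub>R gradient \<psi> x) \<bullet> v)) (at x)"
        by (simp add: inner_add_left gradient_inner[OF sm] gradient_inner[OF sm\<eta>] mult.commute)
    qed
    have i1: "integrable (lebesgue_on \<Omega>) (\<lambda>x. z x \<bullet> gradient (\<lambda>x. \<psi> x * \<eta> x) x)"
      by (rule loc_integrable_inner_test_function[OF \<Omega> lz test_functions_gradient[OF P]])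
    have i2: "integrable (lebesgue_on \<Omega>) (\<lambda>x. (gradient \<psi> x \<bullet> z x) * \<eta> x)"
      by (rule loc_integrable_inner_test_function[OF \<Omega> l3 \<eta>, unfolded inner_real_def])
    have i3: "integrable (lebesgue_on \<Omega>) (\<lambda>x. h x * (\<psi> x * \<eta> x))"
      by (rule loc_integrable_inner_test_function[OF \<Omega> lh P, unfolded inner_real_def])
    have "(LINT x|lebesgue_on \<Omega>. (\<psi> x *\<^sub>R z x) \<bullet> gradient \<eta> x) =
        (LINT x|lebesgue_on \<Omega>. z x \<bullet> gradient (\<lambda>x. \<psi> x * \<eta> x) x - (gradient \<psi> x \<bullet> z x) * \<eta> x)"
      by (rule Bochner_Integration.integral_cong) (simp_all add: gP inner_add_right inner_commute)
    also have "\<dots> = - (LINT x|lebesgue_on \<Omega>. h x * (\<psi> x * \<eta> x)) - (LINT x|lebesgue_on \<Omega>. (gradient \<psi> x \<bullet> z x) * \<eta> x)"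
      using Bochner_Integration.integral_diff[OF i1 i2] is_weak_divD(3)[OF z P] by simp
    also have "\<dots> = - (LINT x|lebesgue_on \<Omega>. (gradient \<psi> x \<bullet> z x) * \<eta> x + h x * (\<psi> x * \<eta> x))"
      using Bochner_Integration.integral_add[OF i2 i3] by simp
    also have "(LINT x|lebesgue_on \<Omega>. (gradient \<psi> x \<bullet> z x) * \<eta> x + h x * (\<psi> x * \<eta> x)) =
        (LINT x|lebesgue_on \<Omega>. (gradient \<psi> x \<bullet> z x + \<psi> x * h x) * \<eta> x)"
      by (rule Bochner_Integration.integral_cong) (simp_all add: algebra_simps)
    finally show "(LINT x|lebesgue_on \<Omega>. (\<psi> x *\<^sub>R z x) \<bullet> gradient \<eta> x) =
        - (LINT x|lebesgue_on \<Omega>. (gradient \<psi> x \<bullet> z x + \<psi> x * h x) * \<eta> x)" .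
  qed
qed

text \<open>Multiplied by \<psi>, the smooth field becomes compactly supported in \<Omega>; its weak
  divergence is the classical one almost everywhere, and integration by parts against Du
  applies.\<close>

lemma is_anzellotti_smooth:
  fixes \<Omega> :: "'a::euclidean_space set"
  assumes \<Omega>: "open \<Omega>" and u: "u \<in> BV \<Omega>" and G: "G \<in> test_functions UNIV"
    and \<sigma>: "TV_density \<Omega> u \<in> borel_measurable (TV \<Omega> u)" "AE x in TV \<Omega> u. norm (TV_density \<Omega> u x) \<le> DIM('a)"
  shows "is_anzellotti \<Omega> u G (\<lambda>x. G x \<bullet> TV_density \<Omega> u x)"
  unfolding is_anzellotti_def
proof (intro conjI ballI)
  interpret finite_measure "TV \<Omega> u" by (rule finite_measure_TV[OF u])
  note sm = test_functions_smooth[OF G]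
  obtain B where B: "\<And>x. norm (G x) \<le> B" using test_functions_bounded[OF G] by metis
  have Gm: "G \<in> borel_measurable (TV \<Omega> u)"
    by (rule continuous_on_TV_measurable[OF \<Omega> smooth_continuous_on[OF sm]])
  show "integrable (TV \<Omega> u) (\<lambda>x. G x \<bullet> TV_density \<Omega> u x)"
  proof (rule integrable_const_bound[of _ "B * DIM('a)"])
    show "AE x in TV \<Omega> u. norm (G x \<bullet> TV_density \<Omega> u x) \<le> B * DIM('a)"
      using \<sigma>(2)
    proof eventually_elim
      case (elim x)
      have "norm (G x \<bullet> TV_density \<Omega> u x) \<le> norm (G x) * norm (TV_density \<Omega> u x)"
        using Cauchy_Schwarz_ineq2 by simp
      also have "\<dots> \<le> B * DIM('a)"
        by (intro mult_mono B elim) (use order_trans[OF norm_ge_zero B] in auto)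
      finally show ?case .
    qed
  qed (use Gm \<sigma>(1) in simp)
  fix \<psi> :: "'a \<Rightarrow> real" assume \<psi>: "\<psi> \<in> test_functions \<Omega>"
  note T = test_functions_scaleR_left[OF \<psi> sm]
  note wd = is_weak_div_divergence[OF \<Omega> test_functions_smooth[OF T]]
  have um: "u \<in> borel_measurable (lebesgue_on \<Omega>)"
    using u by (auto simp: BV_def dest: borel_measurable_integrable)
  have "(LINT x|lebesgue_on \<Omega>. u x * weak_div \<Omega> (\<lambda>y. \<psi> y *\<^sub>R G y) x) = (LINT x|lebesgue_on \<Omega>. u x * divergence (\<lambda>y. \<psi> y *\<^sub>R G y) x)"
  proof (rule integral_cong_AE)
    show "(\<lambda>x. u x * weak_div \<Omega> (\<lambda>y. \<psi> y *\<^sub>R G y) x) \<in> borel_measurable (lebesgue_on \<Omega>)"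
      by (rule borel_measurable_times[OF um loc_integrable_measurable[OF \<Omega> is_weak_divD(2)[OF is_weak_div_weak_div[OF wd]]]])
    show "(\<lambda>x. u x * divergence (\<lambda>y. \<psi> y *\<^sub>R G y) x) \<in> borel_measurable (lebesgue_on \<Omega>)"
      by (rule borel_measurable_times[OF um loc_integrable_measurable[OF \<Omega> is_weak_divD(2)[OF wd]]])
    show "AE x in lebesgue_on \<Omega>. u x * weak_div \<Omega> (\<lambda>y. \<psi> y *\<^sub>R G y) x = u x * divergence (\<lambda>y. \<psi> y *\<^sub>R G y) x"
      using weak_div_AE[OF \<Omega> wd] by eventually_elim simp
  qed
  also have "\<dots> = - (LINT x|TV \<Omega> u. (\<psi> x *\<^sub>R G x) \<bullet> TV_density \<Omega> u x)"
    by (rule TV_integral_divergence[OF \<Omega> u T \<sigma>])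
  finally show "(LINT x|TV \<Omega> u. G x \<bullet> TV_density \<Omega> u x * \<psi> x) = - (LINT x|lebesgue_on \<Omega>. u x * weak_div \<Omega> (\<lambda>y. \<psi> y *\<^sub>R G y) x)"
    by (simp add: mult.commute)
qed

section \<open>Continuity of the pairing\<close>

text \<open>Young's inequality for the factors t a and b / t with t^p = s, after dropping the
  factors 1 / p and 1 / q. The coefficient of the first power can be made as small as desired at the
  expense of the second.\<close>

lemma young_scaled:
  fixes p q s :: real
  assumes "1 < q" "p = q / (q - 1)" "0 < s"
  obtains C where "0 < C" "\<And>a b. 0 \<le> a \<Longrightarrow> 0 \<le> b \<Longrightarrow> a * b \<le> s * a powr p + C * b powr q"
proof -
  have p1: "p > 1" unfolding assms(2) using assms(1) by (simp add: less_divide_eq)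
  have "1 / p + 1 / q = (q - 1 + 1) / q" unfolding assms(2) add_divide_distrib by simp
  then have p: "p > 1" "1 / p + 1 / q = 1" using p1 assms(1) by simp_all
  define t where "t = s powr (1 / p)"
  have t: "t > 0" "t powr p = s" using assms(3) p(1) by (auto simp: t_def powr_powr)
  show thesis
  proof (rule that[of "(1 / t) powr q"])
    fix a b :: real assume ab: "0 \<le> a" "0 \<le> b"
    have "a * b = (t * a) * (b / t)" using t by simp
    also have "\<dots> \<le> (t * a) powr p / p + (b / t) powr q / q"
      using ab t assms(1) p by (intro Youngs_inequality) auto
    also have "\<dots> \<le> (t * a) powr p / 1 + (b / t) powr q / 1"
      using assms(1) p(1) by (intro add_mono divide_left_mono) auto
    also have "\<dots> = s * a powr p + (1 / t) powr q * b powr q"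
      using t ab powr_mult[of t a p] powr_mult[of "1 / t" b q] by simp
    finally show "a * b \<le> s * a powr p + (1 / t) powr q * b powr q" .
  qed (use t in simp)
qed

text \<open>For a fixed small s the integral is at most s I + C times the integral of k_n^q; first n
  tends to infinity, then s to 0. This takes the place of Hoelder's inequality and gives
  integrability along the way.\<close>

lemma holder_integrable_tendsto:
  fixes u :: "'a \<Rightarrow> real" and k :: "nat \<Rightarrow> 'a \<Rightarrow> real"
  assumes q: "1 \<le> q" and p: "p = (if q = 1 then \<infinity> else ereal (q / (q - 1)))"
    and u: "u \<in> Lp_space p M" and km: "\<And>n. k n \<in> borel_measurable M"
    and k0: "\<And>n x. 0 \<le> k n x" and ki: "\<And>n. integrable M (\<lambda>x. k n x powr q)"
  shows "integrable M (\<lambda>x. \<bar>u x\<bar> * k n x)"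
    and "(\<lambda>n. LINT x|M. k n x powr q) \<longlonglongrightarrow> 0 \<Longrightarrow> (\<lambda>n. LINT x|M. \<bar>u x\<bar> * k n x) \<longlonglongrightarrow> 0"
proof -
  have um: "u \<in> borel_measurable M" using u by (simp add: Lp_space_def)
  have key: "\<exists>I\<ge>0. \<forall>s>0. \<exists>C>0. \<forall>n. integrable M (\<lambda>x. \<bar>u x\<bar> * k n x) \<and>
      (LINT x|M. \<bar>u x\<bar> * k n x) \<le> s * I + C * (LINT x|M. k n x powr q)"
  proof (cases "q = 1")
    case True
    then have "norm_esssup M u < \<infinity>" using u p by (simp add: Lp_space_def)
    moreover have ae: "AE x in M. ereal (norm (u x)) \<le> norm_esssup M u"
      unfolding norm_esssup_def by (rule esssup_AE)
    \<comment> \<open>On a null space the essential supremum may be negative or minus infinity; U is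
      kept positive by comparison with 1.\<close>
    ultimately obtain U where U: "AE x in M. \<bar>u x\<bar> \<le> U" "U > 0"
    proof (cases "norm_esssup M u")
      case (real r)
      have "AE x in M. \<bar>u x\<bar> \<le> max r 1" using ae unfolding real by eventually_elim auto
      then show thesis by (rule that) simp
    next
      case MInf
      have "AE x in M. \<bar>u x\<bar> \<le> 1" using ae unfolding MInf by eventually_elim auto
      then show thesis by (rule that) simp
    qed simp
    have ki1: "integrable M (k n)" for n
      using ki[of n] k0 True by (simp add: powr_one)
    have i: "integrable M (\<lambda>x. \<bar>u x\<bar> * k n x)" for n
    proof (rule Bochner_Integration.integrable_bound)
      show "integrable M (\<lambda>x. U * k n x)" using ki1 by simp
      show "AE x in M. norm (\<bar>u x\<bar> * k n x) \<le> norm (U * k n x)"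
        using U(1) by eventually_elim (use U(2) k0 in \<open>auto simp: abs_mult intro!: mult_right_mono\<close>)
    qed (use um km in simp)
    have "(LINT x|M. \<bar>u x\<bar> * k n x) \<le> U * (LINT x|M. k n x powr q)" for n
    proof -
      have "(LINT x|M. \<bar>u x\<bar> * k n x) \<le> (LINT x|M. U * k n x)"
        by (rule integral_mono_AE[OF i]) (use ki1 U(1) k0 in \<open>auto intro!: mult_right_mono elim!: eventually_mono\<close>)
      then show ?thesis using k0 True by (simp add: powr_one)
    qed
    \<comment> \<open>For q = 1 the term with s is absent: I = 0, and C = U works for every
      s.\<close>
    then show ?thesis using i U(2) by (intro exI[of _ 0]) auto
  next
    case False
    then have q1: "1 < q" using q by simp
    let ?p = "q / (q - 1)"
    have ui: "integrable M (\<lambda>x. \<bar>u x\<bar> powr ?p)" using u p False by (simp add: Lp_space_def)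
    show ?thesis
    proof (rule exI[of _ "LINT x|M. \<bar>u x\<bar> powr ?p"], intro conjI allI impI)
      show "0 \<le> (LINT x|M. \<bar>u x\<bar> powr ?p)" by (intro Bochner_Integration.integral_nonneg) simp
      fix s :: real assume "s > 0"
      obtain C where C: "0 < C" "\<And>a b. 0 \<le> a \<Longrightarrow> 0 \<le> b \<Longrightarrow> a * b \<le> s * a powr ?p + C * b powr q"
        using young_scaled[OF q1 refl \<open>s > 0\<close>] by metis
      have j: "integrable M (\<lambda>x. s * \<bar>u x\<bar> powr ?p + C * k n x powr q)" for n using ui ki by simp
      have i: "integrable M (\<lambda>x. \<bar>u x\<bar> * k n x)" for n
      proof (rule Bochner_Integration.integrable_bound[OF j])
        show "AE x in M. norm (\<bar>u x\<bar> * k n x) \<le> norm (s * \<bar>u x\<bar> powr ?p + C * k n x powr q)"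
        proof (rule AE_I2)
          fix x
          have "norm (\<bar>u x\<bar> * k n x) = \<bar>u x\<bar> * k n x" using k0 by simp
          also have "\<dots> \<le> s * \<bar>u x\<bar> powr ?p + C * k n x powr q" by (rule C(2)) (use k0 in auto)
          finally show "norm (\<bar>u x\<bar> * k n x) \<le> norm (s * \<bar>u x\<bar> powr ?p + C * k n x powr q)" by simp
        qed
      qed (use um km in simp)
      have "(LINT x|M. \<bar>u x\<bar> * k n x) \<le> s * (LINT x|M. \<bar>u x\<bar> powr ?p) + C * (LINT x|M. k n x powr q)" for n
      proof -
        have "(LINT x|M. \<bar>u x\<bar> * k n x) \<le> (LINT x|M. s * \<bar>u x\<bar> powr ?p + C * k n x powr q)"
          by (rule integral_mono[OF i j]) (rule C(2), use k0 in auto)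
        then show ?thesis using ui ki by simp
      qed
      then show "\<exists>C>0. \<forall>n. integrable M (\<lambda>x. \<bar>u x\<bar> * k n x) \<and>
          (LINT x|M. \<bar>u x\<bar> * k n x) \<le> s * (LINT x|M. \<bar>u x\<bar> powr ?p) + C * (LINT x|M. k n x powr q)"
        using i C(1) by blast
    qed
  qed
  then obtain I where I: "I \<ge> 0" "\<And>s. s > 0 \<Longrightarrow> \<exists>C>0. \<forall>n. integrable M (\<lambda>x. \<bar>u x\<bar> * k n x) \<and>
      (LINT x|M. \<bar>u x\<bar> * k n x) \<le> s * I + C * (LINT x|M. k n x powr q)" by blast
  show "integrable M (\<lambda>x. \<bar>u x\<bar> * k n x)" using I(2)[of 1] by auto
  assume lim: "(\<lambda>n. LINT x|M. k n x powr q) \<longlonglongrightarrow> 0"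
  show "(\<lambda>n. LINT x|M. \<bar>u x\<bar> * k n x) \<longlonglongrightarrow> 0"
  proof (rule LIMSEQ_I)
    fix e :: real assume e: "e > 0"
    have halve: "e / (2 * y) * y = e / 2" if "y \<noteq> 0" for y :: real using that by simp
    \<comment> \<open>I may be 0, hence I + 1. The part s I is then at most e / 2, and e / 4 remains
      for the other summand.\<close>
    define s where "s = e / (2 * (I + 1))"
    have s: "s > 0" "s * I < e / 2 + e / 4"
    proof -
      show "s > 0" using e I(1) by (simp add: s_def)
      then have "s * I \<le> s * (I + 1)" by simp
      also have "\<dots> = e / 2" unfolding s_def by (rule halve) (use I(1) in simp)
      finally show "s * I < e / 2 + e / 4" using e by simp
    qed
    obtain C where C: "C > 0" "\<And>n. (LINT x|M. \<bar>u x\<bar> * k n x) \<le> s * I + C * (LINT x|M. k n x powr q)"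
      using I(2)[OF s(1)] by blast
    have "(\<lambda>n. C * (LINT x|M. k n x powr q)) \<longlonglongrightarrow> 0" by (rule tendsto_mult_right_zero[OF lim])
    then have "eventually (\<lambda>n. C * (LINT x|M. k n x powr q) < e / 4) sequentially"
      by (rule order_tendstoD(2)) (use e in simp)
    then obtain N where N: "\<And>n. n \<ge> N \<Longrightarrow> C * (LINT x|M. k n x powr q) < e / 4"
      by (auto simp: eventually_sequentially)
    have "norm ((LINT x|M. \<bar>u x\<bar> * k n x) - 0) < e" if "n \<ge> N" for n
    proof -
      have "0 \<le> (LINT x|M. \<bar>u x\<bar> * k n x)" using k0 by (intro Bochner_Integration.integral_nonneg) simp
      then show ?thesis using C(2)[of n] N[OF that] s(2) by simp
    qed
    then show "\<exists>no. \<forall>n\<ge>no. norm ((LINT x|M. \<bar>u x\<bar> * k n x) - 0) < e" by blast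
  qed
qed


lemma Lp_space_ereal_diff:
  fixes f g :: "'a \<Rightarrow> 'b::euclidean_space"
  assumes q: "1 \<le> q" and "f \<in> Lp_space (ereal q) M" "g \<in> Lp_space (ereal q) M"
  shows "(\<lambda>x. f x - g x) \<in> Lp_space (ereal q) M"
proof -
  have m [measurable]: "f \<in> borel_measurable M" "g \<in> borel_measurable M"
    and i: "integrable M (\<lambda>x. norm (f x) powr q)" "integrable M (\<lambda>x. norm (g x) powr q)"
    using assms by (simp_all add: Lp_space_ereal)
  have le: "norm (f x - g x) powr q \<le> 2 powr q * (norm (f x) powr q + norm (g x) powr q)" for x
  proof -
    \<comment> \<open>Two summands, indexed by the truth values, bring the inequality into the form
      of \<open>powr_sum_le\<close> with constant 2^q.\<close>
    have "norm (f x - g x) powr q \<le> (\<Sum>b\<in>(UNIV::bool set). if b then norm (f x) else norm (g x)) powr q"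
      using norm_triangle_ineq4[of "f x" "g x"] q by (intro powr_mono2) (auto simp: UNIV_bool)
    also have "\<dots> \<le> real (card (UNIV::bool set)) powr q * (\<Sum>b\<in>(UNIV::bool set). (if b then norm (f x) else norm (g x)) powr q)"
      by (rule powr_sum_le[OF _ q]) auto
    finally show ?thesis by (simp add: UNIV_bool add.commute)
  qed
  have "integrable M (\<lambda>x. norm (f x - g x) powr q)"
  proof (rule Bochner_Integration.integrable_bound)
    show "integrable M (\<lambda>x. 2 powr q * (norm (f x) powr q + norm (g x) powr q))" using i by simp
    show "AE x in M. norm (norm (f x - g x) powr q) \<le> norm (2 powr q * (norm (f x) powr q + norm (g x) powr q))"
      using le by (intro AE_I2) simp
  qed simp
  then show ?thesis by (simp add: Lp_space_ereal)
qed

text \<open>By the product rule the weak divergence of \<psi> z is a combination of z and its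
  divergence with bounded coefficients. The difference of the pairings is thus bounded by integrals
  of |u| against errors that tend to 0 in L^q.\<close>

lemma pairing_tendsto:
  fixes \<Omega> :: "'a::euclidean_space set"
  assumes \<Omega>: "open \<Omega>" and q: "1 \<le> q" and p: "p = (if q = 1 then \<infinity> else ereal (q / (q - 1)))"
    and u: "u \<in> Lp_space p (lebesgue_on \<Omega>)"
    and Z: "\<And>n. Z n \<in> Wdiv q \<Omega>" and z: "z \<in> Wdiv q \<Omega>"
    and lim: "(\<lambda>n. Wdiv_norm q \<Omega> (\<lambda>x. Z n x - z x)) \<longlonglongrightarrow> 0"
    and \<psi>: "\<psi> \<in> test_functions \<Omega>"
  shows "(\<lambda>n. LINT x|lebesgue_on \<Omega>. u x * weak_div \<Omega> (\<lambda>y. \<psi> y *\<^sub>R Z n y) x)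
    \<longlonglongrightarrow> (LINT x|lebesgue_on \<Omega>. u x * weak_div \<Omega> (\<lambda>y. \<psi> y *\<^sub>R z y) x)"
proof -
  let ?M = "lebesgue_on \<Omega>"
  have um: "u \<in> borel_measurable ?M" using u by (simp add: Lp_space_def)
  have "\<forall>n. \<exists>h. h \<in> Lp_space (ereal q) ?M \<and> is_weak_div \<Omega> (Z n) h" using Z unfolding Wdiv_def by blast
  then obtain H where H: "\<And>n. H n \<in> Lp_space (ereal q) ?M" "\<And>n. is_weak_div \<Omega> (Z n) (H n)" by metis
  obtain h where h: "h \<in> Lp_space (ereal q) ?M" "is_weak_div \<Omega> z h" using z unfolding Wdiv_def by blast
  have ZL: "Z n \<in> Lp_space (ereal q) ?M" and zL: "z \<in> Lp_space (ereal q) ?M" for n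
    using Z z unfolding Wdiv_def by blast+
  let ?D = "\<lambda>n x. Z n x - z x" and ?K = "\<lambda>n x. H n x - h x"
  note D = Lp_space_ereal_diff[OF q ZL zL] and K = Lp_space_ereal_diff[OF q H(1) h(1)]
  have wd: "is_weak_div \<Omega> (?D n) (?K n)" for n by (rule is_weak_div_diff[OF \<Omega> H(2) h(2)])
  let ?A = "\<lambda>n. LINT x|?M. norm (?D n x) powr q" and ?B = "\<lambda>n. LINT x|?M. norm (?K n x) powr q"
  have AB0: "0 \<le> ?A n" "0 \<le> ?B n" for n by (intro Bochner_Integration.integral_nonneg; simp)+
  \<comment> \<open>The q-th power of the norm is the sum of two nonnegative integrals, each of
    which must therefore tend to 0.\<close>
  have "(\<lambda>n. Wdiv_norm q \<Omega> (?D n) powr q) \<longlonglongrightarrow> 0"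
    by (rule tendsto_zero_powrI[OF lim tendsto_const]) (use q in \<open>auto simp: Wdiv_norm_def\<close>)
  moreover have "Wdiv_norm q \<Omega> (?D n) powr q = ?A n + ?B n" for n
    unfolding Wdiv_norm_eq[OF \<Omega> q wd] using q AB0[of n] by (simp add: powr_powr powr_one)
  ultimately have S: "(\<lambda>n. ?A n + ?B n) \<longlonglongrightarrow> 0" by simp
  have A: "?A \<longlonglongrightarrow> 0"
    by (rule tendsto_sandwich[OF _ _ tendsto_const S]) (use AB0 in auto)
  have B: "?B \<longlonglongrightarrow> 0"
    by (rule tendsto_sandwich[OF _ _ tendsto_const S]) (use AB0 in auto)
  have hol: "integrable ?M (\<lambda>x. \<bar>u x\<bar> * norm (k x))" if "k \<in> Lp_space (ereal q) ?M" for k :: "'a \<Rightarrow> 'b::euclidean_space"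
  proof -
    have "k \<in> borel_measurable ?M" "integrable ?M (\<lambda>x. norm (k x) powr q)"
      using that by (simp_all add: Lp_space_ereal)
    then show ?thesis
      by (intro holder_integrable_tendsto(1)[OF q p u, of "\<lambda>_ x. norm (k x)"]) simp_all
  qed
  have Dm: "?D n \<in> borel_measurable ?M" "integrable ?M (\<lambda>x. norm (?D n x) powr q)" for n
    using D[of n] by (simp_all add: Lp_space_ereal)
  have Km: "?K n \<in> borel_measurable ?M" "integrable ?M (\<lambda>x. norm (?K n x) powr q)" for n
    using K[of n] by (simp_all add: Lp_space_ereal)
  have holD: "(\<lambda>n. LINT x|?M. \<bar>u x\<bar> * norm (?D n x)) \<longlonglongrightarrow> 0"
    by (rule holder_integrable_tendsto(2)[OF q p u _ _ _ A]) (use Dm in simp_all)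
  have holK: "(\<lambda>n. LINT x|?M. \<bar>u x\<bar> * norm (?K n x)) \<longlonglongrightarrow> 0"
    by (rule holder_integrable_tendsto(2)[OF q p u _ _ _ B]) (use Km in simp_all)
  obtain B1 where B1: "\<And>x. norm (\<psi> x) \<le> B1" using test_functions_bounded[OF \<psi>] by metis
  obtain B2 where B2: "\<And>x. norm (gradient \<psi> x) \<le> B2" using test_functions_bounded[OF test_functions_gradient[OF \<psi>]] by metis
  have est: "\<bar>u x * (gradient \<psi> x \<bullet> y + \<psi> x * c)\<bar> \<le> B2 * (\<bar>u x\<bar> * norm y) + B1 * (\<bar>u x\<bar> * norm c)" for x y and c :: real
  proof -
    have "\<bar>gradient \<psi> x \<bullet> y + \<psi> x * c\<bar> \<le> \<bar>gradient \<psi> x \<bullet> y\<bar> + \<bar>\<psi> x * c\<bar>" by (rule abs_triangle_ineq)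
    also have "\<dots> \<le> B2 * norm y + B1 * norm c"
    proof (rule add_mono)
      show "\<bar>gradient \<psi> x \<bullet> y\<bar> \<le> B2 * norm y"
        by (rule order_trans[OF Cauchy_Schwarz_ineq2 mult_right_mono[OF B2]]) simp
      show "\<bar>\<psi> x * c\<bar> \<le> B1 * norm c"
        using mult_right_mono[OF B1, of "norm c" x] by (simp add: abs_mult)
    qed
    finally have "\<bar>u x\<bar> * \<bar>gradient \<psi> x \<bullet> y + \<psi> x * c\<bar> \<le> \<bar>u x\<bar> * (B2 * norm y + B1 * norm c)"
      by (rule mult_left_mono) simp
    also have "\<dots> = B2 * (\<bar>u x\<bar> * norm y) + B1 * (\<bar>u x\<bar> * norm c)"
      by (simp add: algebra_simps)
    finally show ?thesis
      by (simp only: abs_mult[of "u x" "gradient \<psi> x \<bullet> y + \<psi> x * c"])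
  qed
  have \<psi>m: "\<psi> \<in> borel_measurable ?M" "gradient \<psi> \<in> borel_measurable ?M"
    using smooth_borel_measurable[OF test_functions_smooth[OF \<psi>]]
      smooth_borel_measurable[OF smooth_gradient[OF test_functions_smooth[OF \<psi>]]]
    by (auto intro!: measurable_restrict_space1 measurable_completion)
  have m: "(\<lambda>x. u x * (gradient \<psi> x \<bullet> y x + \<psi> x * c x)) \<in> borel_measurable ?M"
    if "y \<in> Lp_space (ereal q) ?M" "c \<in> Lp_space (ereal q) ?M" for y c
  proof -
    have "y \<in> borel_measurable ?M" "c \<in> borel_measurable ?M"
      using that by (simp_all add: Lp_space_ereal)
    then show ?thesis using um \<psi>m by simp
  qed
  have i: "integrable ?M (\<lambda>x. u x * (gradient \<psi> x \<bullet> y x + \<psi> x * c x))"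
    if "y \<in> Lp_space (ereal q) ?M" "c \<in> Lp_space (ereal q) ?M" for y c
  proof (rule Bochner_Integration.integrable_bound)
    show "integrable ?M (\<lambda>x. B2 * (\<bar>u x\<bar> * norm (y x)) + B1 * (\<bar>u x\<bar> * norm (c x)))"
      using hol[OF that(1)] hol[OF that(2)] by (intro Bochner_Integration.integrable_add integrable_mult_right)
    show "AE x in ?M. norm (u x * (gradient \<psi> x \<bullet> y x + \<psi> x * c x)) \<le>
        norm (B2 * (\<bar>u x\<bar> * norm (y x)) + B1 * (\<bar>u x\<bar> * norm (c x)))"
      unfolding real_norm_def using order_trans[OF est abs_ge_self] by (intro AE_I2) (simp only: real_norm_def)
  qed (rule m[OF that])
  have pair: "(LINT x|?M. u x * weak_div \<Omega> (\<lambda>y. \<psi> y *\<^sub>R Y y) x) = (LINT x|?M. u x * (gradient \<psi> x \<bullet> Y x + \<psi> x * c x))"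
    if "is_weak_div \<Omega> Y c" "Y \<in> Lp_space (ereal q) ?M" "c \<in> Lp_space (ereal q) ?M" for Y c
  proof (rule integral_cong_AE)
    note w = is_weak_div_scaleR[OF \<Omega> that(1) \<psi>]
    show "(\<lambda>x. u x * weak_div \<Omega> (\<lambda>y. \<psi> y *\<^sub>R Y y) x) \<in> borel_measurable ?M"
      by (rule borel_measurable_times[OF um loc_integrable_measurable[OF \<Omega> is_weak_divD(2)[OF is_weak_div_weak_div[OF w]]]])
    show "(\<lambda>x. u x * (gradient \<psi> x \<bullet> Y x + \<psi> x * c x)) \<in> borel_measurable ?M" by (rule m[OF that(2,3)])
    show "AE x in ?M. u x * weak_div \<Omega> (\<lambda>y. \<psi> y *\<^sub>R Y y) x = u x * (gradient \<psi> x \<bullet> Y x + \<psi> x * c x)"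
      using weak_div_AE[OF \<Omega> w] by eventually_elim simp
  qed
  let ?P = "\<lambda>n. LINT x|?M. u x * (gradient \<psi> x \<bullet> Z n x + \<psi> x * H n x)"
  let ?Q = "LINT x|?M. u x * (gradient \<psi> x \<bullet> z x + \<psi> x * h x)"
  have "?P \<longlonglongrightarrow> ?Q"
  proof (rule LIM_zero_cancel, rule Lim_null_comparison)
    show "(\<lambda>n. B2 * (LINT x|?M. \<bar>u x\<bar> * norm (?D n x)) + B1 * (LINT x|?M. \<bar>u x\<bar> * norm (?K n x))) \<longlonglongrightarrow> 0"
      using tendsto_add[OF tendsto_mult_right_zero[OF holD, of B2] tendsto_mult_right_zero[OF holK, of B1]] by simp
    show "eventually (\<lambda>n. norm (?P n - ?Q) \<le> B2 * (LINT x|?M. \<bar>u x\<bar> * norm (?D n x)) + B1 * (LINT x|?M. \<bar>u x\<bar> * norm (?K n x))) sequentially"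
    proof (rule always_eventually, rule allI)
      fix n
      have "?P n - ?Q = (LINT x|?M. u x * (gradient \<psi> x \<bullet> Z n x + \<psi> x * H n x) - u x * (gradient \<psi> x \<bullet> z x + \<psi> x * h x))"
        by (rule Bochner_Integration.integral_diff[symmetric, OF i[OF ZL H(1)] i[OF zL h(1)]])
      also have "\<dots> = (LINT x|?M. u x * (gradient \<psi> x \<bullet> ?D n x + \<psi> x * ?K n x))"
        by (rule Bochner_Integration.integral_cong) (simp_all add: inner_diff_right algebra_simps)
      also have "norm \<dots> \<le> (LINT x|?M. B2 * (\<bar>u x\<bar> * norm (?D n x)) + B1 * (\<bar>u x\<bar> * norm (?K n x)))"
      proof (rule Bochner_Integration.integral_norm_bound_integral[OF i[OF D K]])
        show "integrable ?M (\<lambda>x. B2 * (\<bar>u x\<bar> * norm (?D n x)) + B1 * (\<bar>u x\<bar> * norm (?K n x)))"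
          by (intro Bochner_Integration.integrable_add integrable_mult_right hol D K)
        show "norm (u x * (gradient \<psi> x \<bullet> ?D n x + \<psi> x * ?K n x)) \<le> B2 * (\<bar>u x\<bar> * norm (?D n x)) + B1 * (\<bar>u x\<bar> * norm (?K n x))" for x
          unfolding real_norm_def[of "u x * _"] by (rule est)
      qed
      also have "\<dots> = B2 * (LINT x|?M. \<bar>u x\<bar> * norm (?D n x)) + B1 * (LINT x|?M. \<bar>u x\<bar> * norm (?K n x))"
        using Bochner_Integration.integral_add[OF integrable_mult_right[OF hol[OF D]] integrable_mult_right[OF hol[OF K]]]
        by (simp only: integral_mult_right_zero)
      finally show "norm (?P n - ?Q) \<le> B2 * (LINT x|?M. \<bar>u x\<bar> * norm (?D n x)) + B1 * (LINT x|?M. \<bar>u x\<bar> * norm (?K n x))" .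
    qed
  qed
  then show ?thesis
    unfolding pair[OF H(2) ZL H(1)] pair[OF h(2) zL h(1)] .
qed

section \<open>The normal trace\<close>

lemma is_anzellotti_unique:
  fixes \<Omega> :: "'a::euclidean_space set"
  assumes "open \<Omega>" "u \<in> BV \<Omega>" "is_anzellotti \<Omega> u z s" "is_anzellotti \<Omega> u z t"
  shows "AE x in TV \<Omega> u. s x = t x"
  by (rule TV_AE_eq[OF assms(1,2)]) (use assms(3,4) in \<open>simp_all add: is_anzellotti_def\<close>)

text \<open>The pairings of the smooth approximants are uniformly bounded, and their integrals
  against each \<psi> converge by continuity of the functional. The weak limit is identified through
  these integrals, for all \<psi> at once.\<close>

lemma exists_anzellotti:
  fixes \<Omega> :: "'a::euclidean_space set"
  assumes dom: "bounded_lipschitz_domain \<Omega>" and q: "1 \<le> q"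
    and p: "p = (if q = 1 then \<infinity> else ereal (q / (q - 1)))"
    and u: "u \<in> BV \<Omega>" "u \<in> Lp_space p (lebesgue_on \<Omega>)"
    and \<sigma>: "TV_density \<Omega> u \<in> borel_measurable (TV \<Omega> u)" "AE x in TV \<Omega> u. norm (TV_density \<Omega> u x) \<le> DIM('a)"
    and z: "z \<in> Wdiv q \<Omega>" "z \<in> Lp_space \<infinity> (lebesgue_on \<Omega>)"
  shows "\<exists>t. is_anzellotti \<Omega> u z t"
proof (rule exists_smooth_trace_conv[OF dom q z])
  fix G assume G: "\<And>n. G n \<in> test_functions UNIV" "trace_conv \<Omega> q G z"
  have \<Omega>: "open \<Omega>" "bounded \<Omega>" "\<Omega> \<noteq> {}"
    using dom by (simp_all add: bounded_lipschitz_domain_def)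
  note sm = test_functions_smooth[OF G(1)]
  obtain M where M: "ereal M = norm_esssup (lebesgue_on \<Omega>) z" "AE x in lebesgue. x \<in> \<Omega> \<longrightarrow> norm (z x) \<le> M" "0 \<le> M"
    by (rule Lp_infinity_bound[OF \<Omega>(1,3) z(2)])
  \<comment> \<open>Needed at every point of \<Omega>, for |Du| may charge Lebesgue null
    sets.\<close>
  have GM: "norm (G n x) \<le> M" if "x \<in> \<Omega>" for n x
    by (rule continuous_norm_le_esssup[OF \<Omega>(1) smooth_continuous_on[OF sm] _ that])
       (use G(2) M(1) in \<open>simp add: trace_conv_def\<close>)
  have an: "is_anzellotti \<Omega> u (G n) (\<lambda>x. G n x \<bullet> TV_density \<Omega> u x)" for n
    by (rule is_anzellotti_smooth[OF \<Omega>(1) u(1) G(1) \<sigma>])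
  let ?t = "\<lambda>n x. G n x \<bullet> TV_density \<Omega> u x"
  have tm: "?t n \<in> borel_measurable (TV \<Omega> u)" for n
    using an[of n] by (auto simp: is_anzellotti_def dest: borel_measurable_integrable)
  have tb: "AE x in TV \<Omega> u. \<bar>?t n x\<bar> \<le> M * DIM('a)" for n
    using \<sigma>(2) AE_space
  proof eventually_elim
    case (elim x)
    have "\<bar>?t n x\<bar> \<le> norm (G n x) * norm (TV_density \<Omega> u x)" by (rule Cauchy_Schwarz_ineq2)
    also have "\<dots> \<le> M * DIM('a)"
      by (intro mult_mono elim GM) (use elim M(3) in \<open>auto simp: TV_space_sets\<close>)
    finally show ?case .
  qed
  have C: "0 \<le> M * DIM('a)" using M(3) by simp
  show ?thesis
  proof (rule exists_weak_limit[OF finite_measure_TV[OF u(1)], of ?t, OF tm tb C])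
    fix s :: "'a \<Rightarrow> real"
    assume s: "integrable (TV \<Omega> u) s" "\<And>\<psi> B L. \<psi> \<in> borel_measurable (TV \<Omega> u) \<Longrightarrow>
      (\<And>x. x \<in> space (TV \<Omega> u) \<Longrightarrow> \<bar>\<psi> x\<bar> \<le> B) \<Longrightarrow>
      (\<lambda>n. LINT x|TV \<Omega> u. ?t n x * \<psi> x) \<longlonglongrightarrow> L \<Longrightarrow> (LINT x|TV \<Omega> u. s x * \<psi> x) = L"
    have "is_anzellotti \<Omega> u z s"
      unfolding is_anzellotti_def
    proof (intro conjI ballI s(1))
      fix \<psi> :: "'a \<Rightarrow> real" assume \<psi>: "\<psi> \<in> test_functions \<Omega>"
      obtain B where B: "\<And>x. norm (\<psi> x) \<le> B" using test_functions_bounded[OF \<psi>] by metis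
      show "(LINT x|TV \<Omega> u. s x * \<psi> x) = - (LINT x|lebesgue_on \<Omega>. u x * weak_div \<Omega> (\<lambda>y. \<psi> y *\<^sub>R z y) x)"
      proof (rule s(2))
        show "\<psi> \<in> borel_measurable (TV \<Omega> u)"
          by (rule continuous_on_TV_measurable[OF \<Omega>(1) smooth_continuous_on[OF test_functions_smooth[OF \<psi>]]])
        show "\<bar>\<psi> x\<bar> \<le> B" for x using B[of x] by simp
        have "(\<lambda>n. LINT x|lebesgue_on \<Omega>. u x * weak_div \<Omega> (\<lambda>y. \<psi> y *\<^sub>R G n y) x)
            \<longlonglongrightarrow> (LINT x|lebesgue_on \<Omega>. u x * weak_div \<Omega> (\<lambda>y. \<psi> y *\<^sub>R z y) x)"
          by (rule pairing_tendsto[OF \<Omega>(1) q p u(2) _ z(1) _ \<psi>]) (use G(2) in \<open>simp_all add: trace_conv_def\<close>)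
        from tendsto_minus[OF this]
        show "(\<lambda>n. LINT x|TV \<Omega> u. ?t n x * \<psi> x)
            \<longlonglongrightarrow> - (LINT x|lebesgue_on \<Omega>. u x * weak_div \<Omega> (\<lambda>y. \<psi> y *\<^sub>R z y) x)"
          using an \<psi> unfolding is_anzellotti_def by simp
      qed
    qed
    then show ?thesis by blast
  qed
qed

text \<open>Along a sequence that witnesses the closure, the left side converges because \<psi> is
  bounded and the pairings converge in L^1, the right side because the fields converge in
  W^q(div).\<close>

lemma normal_trace_integral:
  fixes \<Omega> :: "'a::euclidean_space set"
  assumes dom: "bounded_lipschitz_domain \<Omega>" and q: "1 \<le> q"
    and p: "p = (if q = 1 then \<infinity> else ereal (q / (q - 1)))"
    and u: "u \<in> BV \<Omega>" "u \<in> Lp_space p (lebesgue_on \<Omega>)"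
    and \<sigma>: "TV_density \<Omega> u \<in> borel_measurable (TV \<Omega> u)" "AE x in TV \<Omega> u. norm (TV_density \<Omega> u x) \<le> DIM('a)"
    and w: "is_normal_trace \<Omega> q u z w" and \<psi>: "\<psi> \<in> test_functions \<Omega>"
  shows "(LINT x|TV \<Omega> u. w x * \<psi> x) = - (LINT x|lebesgue_on \<Omega>. u x * weak_div \<Omega> (\<lambda>y. \<psi> y *\<^sub>R z y) x)"
proof -
  have \<Omega>: "open \<Omega>" using dom by (simp add: bounded_lipschitz_domain_def)
  have z: "z \<in> Wdiv q \<Omega>" and wi: "integrable (TV \<Omega> u) w" using w by (simp_all add: is_normal_trace_def)
  obtain Z where Z: "\<And>n. Z n \<in> Wdiv q \<Omega>" "\<And>n. Z n \<in> Lp_space \<infinity> (lebesgue_on \<Omega>)"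
    "(\<lambda>n. Wdiv_norm q \<Omega> (\<lambda>x. Z n x - z x)) \<longlonglongrightarrow> 0"
    "(\<lambda>n. LINT x|TV \<Omega> u. \<bar>anzellotti \<Omega> u (Z n) x - w x\<bar>) \<longlonglongrightarrow> 0"
    using w unfolding is_normal_trace_def by blast
  have an: "is_anzellotti \<Omega> u (Z n) (anzellotti \<Omega> u (Z n))" for n
    unfolding anzellotti_def by (rule someI_ex[OF exists_anzellotti[OF dom q p u \<sigma> Z(1,2)]])
  have ai: "integrable (TV \<Omega> u) (anzellotti \<Omega> u (Z n))" for n using an by (simp add: is_anzellotti_def)
  obtain B where B: "\<And>x. norm (\<psi> x) \<le> B" using test_functions_bounded[OF \<psi>] by metis
  have \<psi>m: "\<psi> \<in> borel_measurable (TV \<Omega> u)"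
    by (rule continuous_on_TV_measurable[OF \<Omega> smooth_continuous_on[OF test_functions_smooth[OF \<psi>]]])
  have i: "integrable (TV \<Omega> u) (\<lambda>x. k x * \<psi> x)" if "integrable (TV \<Omega> u) k" for k :: "'a \<Rightarrow> real"
  proof (rule Bochner_Integration.integrable_bound)
    show "integrable (TV \<Omega> u) (\<lambda>x. B * k x)" using that by simp
    show "(\<lambda>x. k x * \<psi> x) \<in> borel_measurable (TV \<Omega> u)"
      by (rule borel_measurable_times[OF borel_measurable_integrable[OF that] \<psi>m])
    show "AE x in TV \<Omega> u. norm (k x * \<psi> x) \<le> norm (B * k x)"
      unfolding norm_mult using order_trans[OF B abs_ge_self]
      by (intro AE_I2) (simp add: mult.commute[of "\<bar>k _\<bar>"] mult_right_mono)
  qed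
  have "(\<lambda>n. LINT x|TV \<Omega> u. anzellotti \<Omega> u (Z n) x * \<psi> x) \<longlonglongrightarrow> (LINT x|TV \<Omega> u. w x * \<psi> x)"
  proof (rule LIM_zero_cancel, rule Lim_null_comparison)
    show "(\<lambda>n. B * (LINT x|TV \<Omega> u. \<bar>anzellotti \<Omega> u (Z n) x - w x\<bar>)) \<longlonglongrightarrow> 0"
      by (rule tendsto_mult_right_zero[OF Z(4)])
    show "eventually (\<lambda>n. norm ((LINT x|TV \<Omega> u. anzellotti \<Omega> u (Z n) x * \<psi> x) - (LINT x|TV \<Omega> u. w x * \<psi> x))
        \<le> B * (LINT x|TV \<Omega> u. \<bar>anzellotti \<Omega> u (Z n) x - w x\<bar>)) sequentially"
    proof (rule always_eventually, rule allI)
      fix n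
      have "(LINT x|TV \<Omega> u. anzellotti \<Omega> u (Z n) x * \<psi> x) - (LINT x|TV \<Omega> u. w x * \<psi> x) =
          (LINT x|TV \<Omega> u. anzellotti \<Omega> u (Z n) x * \<psi> x - w x * \<psi> x)"
        by (rule Bochner_Integration.integral_diff[symmetric, OF i[OF ai] i[OF wi]])
      also have "norm \<dots> \<le> (LINT x|TV \<Omega> u. B * \<bar>anzellotti \<Omega> u (Z n) x - w x\<bar>)"
      proof (rule Bochner_Integration.integral_norm_bound_integral)
        show "integrable (TV \<Omega> u) (\<lambda>x. anzellotti \<Omega> u (Z n) x * \<psi> x - w x * \<psi> x)"
          by (rule Bochner_Integration.integrable_diff[OF i[OF ai] i[OF wi]])
        show "integrable (TV \<Omega> u) (\<lambda>x. B * \<bar>anzellotti \<Omega> u (Z n) x - w x\<bar>)" using ai wi by simp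
        show "norm (anzellotti \<Omega> u (Z n) x * \<psi> x - w x * \<psi> x) \<le> B * \<bar>anzellotti \<Omega> u (Z n) x - w x\<bar>" for x
          unfolding left_diff_distrib[symmetric] norm_mult
          using mult_right_mono[OF B, of "\<bar>anzellotti \<Omega> u (Z n) x - w x\<bar>" x] by (simp add: mult.commute)
      qed
      finally show "norm ((LINT x|TV \<Omega> u. anzellotti \<Omega> u (Z n) x * \<psi> x) - (LINT x|TV \<Omega> u. w x * \<psi> x))
        \<le> B * (LINT x|TV \<Omega> u. \<bar>anzellotti \<Omega> u (Z n) x - w x\<bar>)" by simp
    qed
  qed
  moreover have "(\<lambda>n. LINT x|TV \<Omega> u. anzellotti \<Omega> u (Z n) x * \<psi> x)
      \<longlonglongrightarrow> - (LINT x|lebesgue_on \<Omega>. u x * weak_div \<Omega> (\<lambda>y. \<psi> y *\<^sub>R z y) x)"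
    using tendsto_minus[OF pairing_tendsto[OF \<Omega> q p u(2) Z(1) z Z(3) \<psi>]] an \<psi>
    unfolding is_anzellotti_def by simp
  ultimately show ?thesis by (rule LIMSEQ_unique)
qed

text \<open>Closability of the pairing: two limits over the same z have the same integrals against
  test functions, so the chosen normal trace is any one that can be exhibited.\<close>

lemma normal_trace_eqI:
  fixes \<Omega> :: "'a::euclidean_space set"
  assumes dom: "bounded_lipschitz_domain \<Omega>" and q: "1 \<le> q"
    and p: "p = (if q = 1 then \<infinity> else ereal (q / (q - 1)))"
    and u: "u \<in> BV \<Omega>" "u \<in> Lp_space p (lebesgue_on \<Omega>)"
    and \<sigma>: "TV_density \<Omega> u \<in> borel_measurable (TV \<Omega> u)" "AE x in TV \<Omega> u. norm (TV_density \<Omega> u x) \<le> DIM('a)"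
    and w: "is_normal_trace \<Omega> q u z w"
  shows "AE x in TV \<Omega> u. normal_trace \<Omega> q u z x = w x"
proof -
  have \<Omega>: "open \<Omega>" using dom by (simp add: bounded_lipschitz_domain_def)
  have w': "is_normal_trace \<Omega> q u z (normal_trace \<Omega> q u z)"
    unfolding normal_trace_def by (rule someI[of "is_normal_trace \<Omega> q u z", OF w])
  note I = normal_trace_integral[OF dom q p u \<sigma>]
  show ?thesis
    by (rule TV_AE_eq[OF \<Omega> u(1)]) (use w w' I[OF w] I[OF w'] in \<open>simp_all add: is_normal_trace_def\<close>)
qed

text \<open>The sequence that approximates g for the full trace also witnesses the closure: its
  pairings are G_n \<bullet> \<sigma>, and bounded \<sigma> carries the L^1 convergence of G_n over
  to them.\<close>

lemma is_normal_trace_full_trace: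
  fixes \<Omega> :: "'a::euclidean_space set"
  assumes dom: "bounded_lipschitz_domain \<Omega>" and q: "1 \<le> q" and u: "u \<in> BV \<Omega>"
    and \<sigma>: "TV_density \<Omega> u \<in> borel_measurable (TV \<Omega> u)" "AE x in TV \<Omega> u. norm (TV_density \<Omega> u x) \<le> DIM('a)"
    and g: "g \<in> full_trace_dom \<Omega> q u"
  shows "is_normal_trace \<Omega> q u g (\<lambda>x. full_trace \<Omega> q u g x \<bullet> TV_density \<Omega> u x)"
proof -
  have \<Omega>: "open \<Omega>" "bounded \<Omega>" using dom by (simp_all add: bounded_lipschitz_domain_def)
  have gW: "g \<in> Wdiv q \<Omega>" "g \<in> Lp_space \<infinity> (lebesgue_on \<Omega>)" and ex: "\<exists>v. is_full_trace \<Omega> q u g v"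
    using g unfolding full_trace_dom_def by blast+
  let ?v = "full_trace \<Omega> q u g" and ?\<sigma> = "TV_density \<Omega> u"
  have ft: "is_full_trace \<Omega> q u g ?v" unfolding full_trace_def by (rule someI_ex[OF ex])
  have vi: "integrable (TV \<Omega> u) ?v" using ft by (simp add: is_full_trace_def)
  have \<sigma>i: "integrable (TV \<Omega> u) (\<lambda>x. k x \<bullet> ?\<sigma> x)"
    and \<sigma>le: "AE x in TV \<Omega> u. \<bar>k x \<bullet> ?\<sigma> x\<bar> \<le> DIM('a) * norm (k x)" if k: "integrable (TV \<Omega> u) k" for k
  proof -
    show le: "AE x in TV \<Omega> u. \<bar>k x \<bullet> ?\<sigma> x\<bar> \<le> DIM('a) * norm (k x)"
      using \<sigma>(2)
    proof eventually_elim
      case (elim x)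
      then show ?case
        using Cauchy_Schwarz_ineq2[of "k x" "?\<sigma> x"] mult_left_mono[OF elim norm_ge_zero[of "k x"]]
        by (simp add: mult.commute)
    qed
    show "integrable (TV \<Omega> u) (\<lambda>x. k x \<bullet> ?\<sigma> x)"
    proof (rule Bochner_Integration.integrable_bound)
      show "integrable (TV \<Omega> u) (\<lambda>x. DIM('a) * norm (k x))" using k by simp
      show "(\<lambda>x. k x \<bullet> ?\<sigma> x) \<in> borel_measurable (TV \<Omega> u)"
        by (rule borel_measurable_inner[OF borel_measurable_integrable[OF k] \<sigma>(1)])
      show "AE x in TV \<Omega> u. norm (k x \<bullet> ?\<sigma> x) \<le> norm (DIM('a) * norm (k x))"
        using le by eventually_elim simp
    qed
  qed
  show ?thesis
  proof (rule exists_smooth_trace_conv[OF dom q gW])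
    fix G assume G: "\<And>n. G n \<in> test_functions UNIV" "trace_conv \<Omega> q G g"
    have sb: "\<And>n. G n \<in> smooth_up_to_boundary \<Omega>" by (rule test_functions_smooth_up_to_boundary[OF G(1)])
    interpret finite_measure "TV \<Omega> u" by (rule finite_measure_TV[OF u])
    have Gi: "integrable (TV \<Omega> u) (G n)" for n
    proof -
      obtain B where B: "\<And>x. norm (G n x) \<le> B" using test_functions_bounded[OF G(1)] by metis
      show ?thesis
        by (rule integrable_const_bound[of _ B])
           (use B continuous_on_TV_measurable[OF \<Omega>(1) smooth_continuous_on[OF test_functions_smooth[OF G(1)]]] in auto)
    qed
    have an: "is_anzellotti \<Omega> u (G n) (\<lambda>x. G n x \<bullet> ?\<sigma> x)" for n
      by (rule is_anzellotti_smooth[OF \<Omega>(1) u G(1) \<sigma>])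
    have an': "is_anzellotti \<Omega> u (G n) (anzellotti \<Omega> u (G n))" for n
      unfolding anzellotti_def by (rule someI[of "is_anzellotti \<Omega> u (G n)", OF an])
    have ai: "integrable (TV \<Omega> u) (anzellotti \<Omega> u (G n))" for n using an'[of n] by (simp add: is_anzellotti_def)
    have le: "(LINT x|TV \<Omega> u. \<bar>anzellotti \<Omega> u (G n) x - ?v x \<bullet> ?\<sigma> x\<bar>) \<le> DIM('a) * (LINT x|TV \<Omega> u. norm (G n x - ?v x))" for n
    proof -
      have d: "integrable (TV \<Omega> u) (\<lambda>x. G n x - ?v x)" using Gi vi by simp
      have "(LINT x|TV \<Omega> u. \<bar>anzellotti \<Omega> u (G n) x - ?v x \<bullet> ?\<sigma> x\<bar>) \<le> (LINT x|TV \<Omega> u. DIM('a) * norm (G n x - ?v x))"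
      proof (rule integral_mono_AE)
        show "integrable (TV \<Omega> u) (\<lambda>x. \<bar>anzellotti \<Omega> u (G n) x - ?v x \<bullet> ?\<sigma> x\<bar>)"
          using ai \<sigma>i[OF vi] by simp
        show "integrable (TV \<Omega> u) (\<lambda>x. DIM('a) * norm (G n x - ?v x))" using d by simp
        show "AE x in TV \<Omega> u. \<bar>anzellotti \<Omega> u (G n) x - ?v x \<bullet> ?\<sigma> x\<bar> \<le> DIM('a) * norm (G n x - ?v x)"
          using is_anzellotti_unique[OF \<Omega>(1) u an'[of n] an[of n]] \<sigma>le[OF d]
          by eventually_elim (simp add: inner_diff_left)
      qed
      then show ?thesis by simp
    qed
    have lim: "(\<lambda>n. LINT x|TV \<Omega> u. norm (G n x - ?v x)) \<longlonglongrightarrow> 0"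
      using ft sb G(2) unfolding is_full_trace_def by blast
    have "(\<lambda>n. LINT x|TV \<Omega> u. \<bar>anzellotti \<Omega> u (G n) x - ?v x \<bullet> ?\<sigma> x\<bar>) \<longlonglongrightarrow> 0"
      by (rule tendsto_sandwich[OF _ _ tendsto_const tendsto_mult_right_zero[OF lim, of "DIM('a)"]]) (simp_all add: le)
    then show ?thesis
      unfolding is_normal_trace_def
      using gW \<sigma>i[OF vi] G(2) test_function_mem_Wdiv[OF \<Omega> q G(1)]
      by (intro conjI exI[of _ G]) (simp_all add: trace_conv_def)
  qed
qed

theorem proposition6:
  fixes \<Omega> :: "'a::euclidean_space set" and q :: real and p :: ereal and u :: "'a \<Rightarrow> real"
  assumes "bounded_lipschitz_domain \<Omega>"
    and "1 \<le> q"
    and "p = (if q = 1 then \<infinity> else ereal (q / (q - 1)))"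
    and "u \<in> BV \<Omega>"
  shows "(\<forall>\<phi>. continuous_on (closure \<Omega>) \<phi> \<and> \<phi> \<in> Wdiv q \<Omega> \<longrightarrow>
             \<phi> \<in> full_trace_dom \<Omega> q u \<and>
             (AE x in TV \<Omega> u. full_trace \<Omega> q u \<phi> x = \<phi> x)) \<and>
         (u \<in> Lp_space p (lebesgue_on \<Omega>) \<longrightarrow>
           (\<forall>g \<in> full_trace_dom \<Omega> q u.
             g \<in> normal_trace_dom \<Omega> q u \<and>
             (AE x in TV \<Omega> u. normal_trace \<Omega> q u g x = full_trace \<Omega> q u g x \<bullet> TV_density \<Omega> u x)))"
proof (intro conjI allI impI ballI)
  fix \<phi> assume "continuous_on (closure \<Omega>) \<phi> \<and> \<phi> \<in> Wdiv q \<Omega>"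
  then show "\<phi> \<in> full_trace_dom \<Omega> q u" "AE x in TV \<Omega> u. full_trace \<Omega> q u \<phi> x = \<phi> x"
    using full_trace_continuous[OF assms(1,2,4)] by blast+
next
  fix g assume u: "u \<in> Lp_space p (lebesgue_on \<Omega>)" and g: "g \<in> full_trace_dom \<Omega> q u"
  have \<Omega>: "open \<Omega>" using assms(1) by (simp add: bounded_lipschitz_domain_def)
  have gW: "g \<in> Wdiv q \<Omega>" "g \<in> Lp_space \<infinity> (lebesgue_on \<Omega>)"
    using g unfolding full_trace_dom_def by blast+
  have "g \<in> normal_trace_dom \<Omega> q u \<and>
      (AE x in TV \<Omega> u. normal_trace \<Omega> q u g x = full_trace \<Omega> q u g x \<bullet> TV_density \<Omega> u x)"
  proof (rule TV_cases[OF assms(4)])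
    assume null: "\<And>A. emeasure (TV \<Omega> u) A = 0"
    have ae: "AE x in TV \<Omega> u. P x" for P
      by (rule emeasure_0_AE) (rule null)
    \<comment> \<open>For the zero measure the equation is trivial, but membership in the domain
      still asks for a sequence: the constant one g, with limit 0.\<close>
    have "(LINT x|TV \<Omega> u. \<bar>anzellotti \<Omega> u g x - 0\<bar>) = 0"
      by (rule integral_eq_zero_AE) (rule ae)
    moreover have "Wdiv_norm q \<Omega> (\<lambda>x. g x - g x) = 0"
    proof -
      obtain h where "is_weak_div \<Omega> g h" using gW(1) unfolding Wdiv_def by blast
      from Wdiv_norm_eq[OF \<Omega> assms(2) is_weak_div_diff[OF \<Omega> this this]] show ?thesis by simp
    qed
    ultimately have "is_normal_trace \<Omega> q u g (\<lambda>x. 0)"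
      unfolding is_normal_trace_def using gW by (intro conjI exI[of _ "\<lambda>_. g"]) simp_all
    then have "g \<in> normal_trace_dom \<Omega> q u" unfolding normal_trace_dom_def by blast
    then show ?thesis using ae by blast
  next
    assume density: "TV_density \<Omega> u \<in> borel_measurable (TV \<Omega> u)" "AE x in TV \<Omega> u. norm (TV_density \<Omega> u x) \<le> DIM('a)"
    note nt = is_normal_trace_full_trace[OF assms(1,2,4) density g]
    then have "g \<in> normal_trace_dom \<Omega> q u" unfolding normal_trace_dom_def by blast
    then show ?thesis using normal_trace_eqI[OF assms(1-4) u density nt] by blast
  qed
  then show "g \<in> normal_trace_dom \<Omega> q u"
    "AE x in TV \<Omega> u. normal_trace \<Omega> q u g x = full_trace \<Omega> q u g x \<bullet> TV_density \<Omega> u x" by blast+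
qed

end
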